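(* Let $m\in\mathbb{N}$ and let $-\Lambda\in\mathbb{R}^{m\times m}$ be a Routh--Hurwitz matrix (all eigenvalues of $-\Lambda$ have negative real part). Let $D=(D_t)_{t\in\mathbb{R}}$ be a square integrable $\mathbb{R}^m$-valued process with stationary increments for which the integrals $$S_t=\int_0^t e^{-\Lambda(t-s)}\,\mathrm{d}D_s,\qquad U_t=\int_{-\infty}^t e^{-\Lambda(t-s)}\,\mathrm{d}D_s,\qquad t\ge0,$$ are well-defined, so that $(U_t)_{t\ge0}$ is a stationary process, and assume $\mathbb{E}[S_t]=0_m$ for all $t\geq 0$. Then, as $t\to\infty$, $S_t-U_t\to0$ almost surely, and also in $L^p(\Omega)$ for any $p\ge1$ such that $U_0\in L^p(\Omega)$. In particular, let $p\ge 1$ be such that $U_0\in L^p(\Omega)$, let $x\in\mathbb{R}^m\setminus\{0_m\}$, let $Z$ have the law of $U_0$, and for $\varepsilon>0$ let $X^\varepsilon_t(x)$ have the law of $e^{-\Lambda t}x+\varepsilon S_t$ for each $t\ge0$. With $\lambda=\lambda(x)$, $\ell=\ell(x)$, $\omega(x)$ and $t^{\mathsf{cut}}_\varepsilon$ as in the context, the following hold for any $(w_\varepsilon)_{\varepsilon\in(0,1)}$ with $w_\varepsilon\to w>0$ as $\varepsilon\to0^+$. (i) $\lim_{t\to\infty}\mathcal{W}_p(S_t,Z)=0$; for every $r\in\mathbb{R}$ there exist $\check v(x),\hat v(x)\in\omega(x)$ with $$\liminf_{\varepsilon\to0^+}\mathcal{W}_p\left(\tfrac1\varepsilon X^\varepsilon_{t^{\mathsf{cut}}_\varepsilon+rw_\varepsilon}(x),Z\right)=\mathcal{W}_p\left(\lambda^{1-\ell}e^{-\lambda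 rw}\check v(x)+Z,Z\right)=\lambda^{1-\ell}e^{-\lambda rw}\|\check v(x)\|,$$ $$\limsup_{\varepsilon\to0^+}\mathcal{W}_p\left(\tfrac1\varepsilon X^\varepsilon_{t^{\mathsf{cut}}_\varepsilon+rw_\varepsilon}(x),Z\right)=\mathcal{W}_p\left(\lambda^{1-\ell}e^{-\lambda rw}\hat v(x)+Z,Z\right)=\lambda^{1-\ell}e^{-\lambda rw}\|\hat v(x)\|;$$ moreover the $\liminf$ tends to $\infty$ as $r\to-\infty$ and the $\limsup$ tends to $0$ as $r\to\infty$. (ii) One has $$\lim_{\varepsilon\to0^+}\mathcal{W}_p\left(\tfrac1\varepsilon X^\varepsilon_{t^{\mathsf{cut}}_\varepsilon+rw_\varepsilon}(x),Z\right)=\mathcal{W}_p\left(\lambda^{1-\ell}e^{-\lambda rw}v(x)+Z,Z\right)$$ for every $r\in\mathbb{R}$ and every $v(x)\in\omega(x)$ if and only if for every $\rho>0$ the map $\omega(x)\ni v\mapsto\mathcal{W}_p(\rho v+Z,Z)=\rho\|v\|$ is constant.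
   Context: $\|\cdot\|$ is the Euclidean norm on $\mathbb{R}^m$. For random vectors $X_1,X_2$ in $\mathbb{R}^m$ with finite absolute $p$-th moments, $\mathcal{W}_p(X_1,X_2)=\inf_\nu\left(\int\|u_1-u_2\|^p\,\nu(\mathrm{d}u_1,\mathrm{d}u_2)\right)^{1/p}$ over all couplings $\nu$ of the laws of $X_1,X_2$. Integrals of the deterministic smooth kernel $s\mapsto e^{-\Lambda(t-s)}$ against $D$ are defined through integration by parts, e.g. for $a<t$, $\int_a^t e^{-\Lambda(t-s)}\,\mathrm{d}D_s=D_t-e^{-\Lambda(t-a)}D_a-\int_a^t\Lambda e^{-\Lambda(t-s)}D_s\,\mathrm{d}s$, and $\int_{-\infty}^t$ is the limit as $a\to-\infty$; the integral is additive over intervals, so that $S_t=U_t-e^{-\Lambda t}U_0$. Asymptotics of $e^{-\Lambda t}x$ (known fact used to define the notation): for $x\neq 0_m$ there exist $\lambda=\lambda(x)>0$, integers $\ell=\ell(x),m_*=m_*(x)\in\{1,\dots,m\}$, real numbers $\theta_1,\dots,\theta_{m_*}$ and linearly independent vectors $v_1,\dots,v_{m_*}\in\mathbb{C}^m$ such that, with $v(t;x):=\sum_{j=1}^{m_*}e^{\mathrm{i}\theta_j t}v_j$, $$\lim_{t\to\infty}\left\|\frac{e^{\lambda t}}{t^{\ell-1}}e^{-\Lambda t}x-v(t;x)\right\|=0,\qquad 0<\liminf_{t\to\infty}\|v(t;x)\|\le\limsup_{t\to\infty}\|v(t;x)\|<\infty.$$ $\omega(x)$ is the set of $v\in\mathbb{R}^m$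 for which there is a sequence $t_n\to\infty$ with $v(t_n;x)\to v$; it is non-empty and does not contain $0_m$. For $\varepsilon\in(0,1)$, $t^*_\varepsilon:=\frac1\lambda\ln\left(\frac1\varepsilon\right)$ and $t^{\mathsf{cut}}_{\varepsilon}:=t^*_\varepsilon+\frac{\ell-1}{\lambda}\ln(\lambda t^*_\varepsilon)$ (the paper's cut-off time with $\sigma_t\equiv1$). *)

theory Defs
  imports "HOL-Probability.Probability"
begin

section \<open>Matrices\<close>

text \<open>On \<^typ>\<open>real^'m^'m\<close> the library's \<^const>\<open>times\<close> and \<^const>\<open>power\<close> act entrywise, so the
  exponential series is written with the matrix product.\<close>

definition matrix_exp :: "real^'m^'m \<Rightarrow> real^'m^'m" where
  "matrix_exp A = (\<Sum>k. (1 / fact k) *\<^sub>R (((**) A ^^ k) (mat 1)))"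

definition eigenvalue :: "complex^'m^'m \<Rightarrow> complex \<Rightarrow> bool" where
  "eigenvalue A z \<longleftrightarrow> (\<exists>v. v \<noteq> 0 \<and> A *v v = z *s v)"

definition Routh_Hurwitz :: "real^'m^'m \<Rightarrow> bool" where
  "Routh_Hurwitz A \<longleftrightarrow> (\<forall>z. eigenvalue (map_matrix complex_of_real A) z \<longrightarrow> Re z < 0)"


section \<open>Processes\<close>

definition square_integrable_process ::
    "'a measure \<Rightarrow> (real \<Rightarrow> 'a \<Rightarrow> real^'m) \<Rightarrow> bool" where
  "square_integrable_process M D \<longleftrightarrow>
     (\<forall>t. D t \<in> borel_measurable M \<and> integrable M (\<lambda>\<omega>. (norm (D t \<omega>))\<^sup>2))"

definition stationary_increments ::
    "'a measure \<Rightarrow> (real \<Rightarrow> 'a \<Rightarrow> real^'m) \<Rightarrow> bool" where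
  "stationary_increments M D \<longleftrightarrow>
     (\<forall>J h. finite J \<longrightarrow>
        distr M (\<Pi>\<^sub>M t\<in>J. borel) (\<lambda>\<omega>. \<lambda>t\<in>J. D (t + h) \<omega> - D h \<omega>) =
        distr M (\<Pi>\<^sub>M t\<in>J. borel) (\<lambda>\<omega>. \<lambda>t\<in>J. D t \<omega> - D 0 \<omega>))"

text \<open>Stationarity for a process indexed by \<open>t \<ge> 0\<close>.\<close>

definition stationary_process ::
    "'a measure \<Rightarrow> (real \<Rightarrow> 'a \<Rightarrow> real^'m) \<Rightarrow> bool" where
  "stationary_process M U \<longleftrightarrow>
     (\<forall>J h. finite J \<longrightarrow> J \<subseteq> {0..} \<longrightarrow> 0 \<le> h \<longrightarrow>
        distr M (\<Pi>\<^sub>M t\<in>J. borel) (\<lambda>\<omega>. \<lambda>t\<in>J. U (t + h) \<omega>) =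
        distr M (\<Pi>\<^sub>M t\<in>J. borel) (\<lambda>\<omega>. \<lambda>t\<in>J. U t \<omega>))"


section \<open>Integrals of the exponential kernel\<close>

text \<open>The integral of \<open>s \<mapsto> exp (- \<Lambda> (t - s))\<close> against \<open>dD\<close> over \<open>[a, t]\<close>, defined pathwise by
  integration by parts.\<close>

definition kernel_integral ::
    "real^'m^'m \<Rightarrow> (real \<Rightarrow> 'a \<Rightarrow> real^'m) \<Rightarrow> real \<Rightarrow> real \<Rightarrow> 'a \<Rightarrow> real^'m" where
  "kernel_integral \<Lambda> D a t \<omega> =
     D t \<omega> - matrix_exp (- (t - a) *\<^sub>R \<Lambda>) *v D a \<omega>
     - (LINT s:{a..t}|lborel. (\<Lambda> ** matrix_exp (- (t - s) *\<^sub>R \<Lambda>)) *v D s \<omega>)"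

text \<open>The integrals over \<open>[a, t]\<close> exist and those over \<open>(-\<infinity>, t]\<close> converge to \<open>U\<^sub>t\<close>, almost surely.
  The process \<open>U\<close> is an argument because a limit that exists only almost surely
  determines a random vector only up to a null set. Joint measurability of \<open>D\<close> makes the pathwise
  \<open>ds\<close>-integrals random vectors whose laws are determined by the finite-dimensional laws of
  \<open>D\<close>.\<close>

definition kernel_integrals_defined ::
    "'a measure \<Rightarrow> real^'m^'m \<Rightarrow> (real \<Rightarrow> 'a \<Rightarrow> real^'m) \<Rightarrow> (real \<Rightarrow> 'a \<Rightarrow> real^'m) \<Rightarrow> bool" where
  "kernel_integrals_defined M \<Lambda> D U \<longleftrightarrow>
     (\<lambda>(s, \<omega>). D s \<omega>) \<in> borel_measurable (borel \<Otimes>\<^sub>M M) \<and>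
     (\<forall>t\<ge>0. U t \<in> borel_measurable M) \<and>
     (AE \<omega> in M. \<forall>t\<ge>0.
        (\<forall>a<t. set_integrable lborel {a..t}
                 (\<lambda>s. (\<Lambda> ** matrix_exp (- (t - s) *\<^sub>R \<Lambda>)) *v D s \<omega>)) \<and>
        ((\<lambda>a. kernel_integral \<Lambda> D a t \<omega>) \<longlongrightarrow> U t \<omega>) at_bot)"


section \<open>Wasserstein distance\<close>

definition couplings ::
    "(real^'m) measure \<Rightarrow> (real^'m) measure \<Rightarrow> ((real^'m) \<times> (real^'m)) measure set" where
  "couplings \<mu>1 \<mu>2 =
     {\<nu>. sets \<nu> = sets (borel \<Otimes>\<^sub>M borel) \<and> distr \<nu> borel fst = \<mu>1 \<and> distr \<nu> borel snd = \<mu>2}"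

text \<open>Meant for random vectors with finite absolute \<open>p\<close>-th moments, possibly on different
  probability spaces; under that condition the integrand is integrable for every coupling.\<close>

definition wasserstein ::
    "real \<Rightarrow> 'a measure \<Rightarrow> ('a \<Rightarrow> real^'m) \<Rightarrow> 'b measure \<Rightarrow> ('b \<Rightarrow> real^'m) \<Rightarrow> real" where
  "wasserstein p M1 X1 M2 X2 =
     (INF \<nu>\<in>couplings (distr M1 borel X1) (distr M2 borel X2).
        (LINT u|\<nu>. norm (fst u - snd u) powr p) powr (1 / p))"


section \<open>Asymptotics of \<open>exp (- \<Lambda> t) x\<close>\<close>

definition complex_vec :: "real^'m \<Rightarrow> complex^'m" where
  "complex_vec x = (\<chi> i. complex_of_real (x $ i))"

definition oscillation ::
    "nat \<Rightarrow> (nat \<Rightarrow> real) \<Rightarrow> (nat \<Rightarrow> complex^'m) \<Rightarrow> real \<Rightarrow> complex^'m" where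
  "oscillation k \<theta> v t = (\<Sum>j=1..k. exp (\<i> * complex_of_real (\<theta> j * t)) *s v j)"

definition flow_asymptotics ::
    "real^'m^'m \<Rightarrow> real^'m \<Rightarrow> real \<Rightarrow> nat \<Rightarrow> nat \<Rightarrow> (nat \<Rightarrow> real) \<Rightarrow> (nat \<Rightarrow> complex^'m) \<Rightarrow> bool" where
  "flow_asymptotics \<Lambda> x lam ell k \<theta> v \<longleftrightarrow>
     lam > 0 \<and> ell \<in> {1..CARD('m)} \<and> k \<in> {1..CARD('m)} \<and>
     inj_on v {1..k} \<and> vec.independent (v ` {1..k}) \<and>
     ((\<lambda>t. norm (complex_vec ((exp (lam * t) / t ^ (ell - 1)) *\<^sub>R (matrix_exp (- t *\<^sub>R \<Lambda>) *v x))
               - oscillation k \<theta> v t)) \<longlongrightarrow> 0) at_top \<and>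
     0 < Liminf at_top (\<lambda>t. ereal (norm (oscillation k \<theta> v t))) \<and>
     Limsup at_top (\<lambda>t. ereal (norm (oscillation k \<theta> v t))) < \<infinity>"

definition omega_limit_set :: "(real \<Rightarrow> complex^'m) \<Rightarrow> (real^'m) set" where
  "omega_limit_set f =
     {v. \<exists>\<tau>::nat \<Rightarrow> real. filterlim \<tau> at_top sequentially \<and> (\<lambda>n. f (\<tau> n)) \<longlonglongrightarrow> complex_vec v}"

definition t_star :: "real \<Rightarrow> real \<Rightarrow> real" where
  "t_star lam \<epsilon> = (1 / lam) * ln (1 / \<epsilon>)"

definition t_cut :: "real \<Rightarrow> nat \<Rightarrow> real \<Rightarrow> real" where
  "t_cut lam ell \<epsilon> = t_star lam \<epsilon> + ((real ell - 1) / lam) * ln (lam * t_star lam \<epsilon>)"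

end

theory Submission
  imports Defs "HOL-Computational_Algebra.Fundamental_Theorem_Algebra" "HOL-Real_Asymp.Real_Asymp"
begin

text \<open>
  Splitting the integrals at \<open>0\<close> gives \<open>U\<^sub>t = S\<^sub>t + exp (- \<Lambda> t) U\<^sub>0\<close>, and \<open>exp (- \<Lambda> t) \<rightarrow> 0\<close> because
  \<open>- \<Lambda>\<close> is Hurwitz; hence \<open>S\<^sub>t - U\<^sub>t \<rightarrow> 0\<close> almost surely and in \<open>L\<^sup>p\<close>, and taking expectations yields
  \<open>E U\<^sub>0 = 0\<close>.

  Stationarity of \<open>U\<close>: the kernel integrals depend only on the increments of \<open>D\<close>, and the law of a
  pathwise \<open>ds\<close>-integral of a jointly measurable process is determined by its finite-dimensional laws,
  since after truncation the integral is an \<open>L\<^sup>2\<close>-limit of averages of the process over finitely many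
  fixed times (Monte Carlo nodes that work for two processes simultaneously).

  Cut-off: for a deterministic vector \<open>y\<close>, Jensen's inequality bounds the Wasserstein distance of
  \<open>y + S\<^sub>t\<close> and \<open>Z\<close> from below by the distance of the means, which is \<open>\<parallel>y\<parallel>\<close>, and the coupling with
  \<open>U\<^sub>t\<close> bounds it from above by \<open>\<parallel>y\<parallel> + o(1)\<close>. It remains to compute the limit points of
  \<open>\<parallel>exp (- \<Lambda> t) x\<parallel> / \<epsilon>\<close> at \<open>t = t\<^sub>c\<^sub>u\<^sub>t + r w\<^sub>\<epsilon>\<close>.
\<close>

section \<open>The matrix exponential\<close>

text \<open>The paths of \<open>D\<close> are merely measurable, so sums over a fixed grid need not
  converge to the pathwise integrals; averages over random times do, in mean square, and good times
  can then be frozen. They must serve the process and its shift together, because laws are compared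
  only at equal times. Truncating first makes all mean squares finite. An annihilating polynomial
  stands in for the Jordan form: each root costs one linear equation with an integrating factor.
  \<open>wasserstein\<close> depends on laws only, so \<open>Z\<close> can be represented by
  \<open>U t\<close> at the current time, on the space of \<open>S t\<close>. Centering turns the
  bound by the means into exactly the norm of the shift, and the upper bound has an error depending
  on \<open>t\<close> alone, which matters as the shift itself varies with the noise level. Write
  \<open>L = ln (1 / \<epsilon>)\<close> and
  \<open>T = t_cut lam ell \<epsilon> + r * w \<epsilon>\<close>. The logarithmic correction in
  \<open>t_cut\<close> is such that \<open>\<epsilon> * exp (lam * T) = L ^ (ell - 1) * exp (lam * r
  * w \<epsilon>)\<close> for small \<open>\<epsilon>\<close>, while \<open>T / L\<close> tends to
  \<open>1 / lam\<close>; hence the factor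
  \<open>lam powr (1 - real ell) * exp (- lam * r * w0)\<close>.\<close>

lemma bounded_bilinear_matrix_matrix_mult:
  "bounded_bilinear ((**) :: real^'n^'m \<Rightarrow> real^'k^'n \<Rightarrow> real^'k^'m)"
  unfolding bilinear_conv_bounded_bilinear[symmetric] bilinear_def
  by (auto intro!: linearI simp: matrix_add_ldistrib matrix_matrix_mult_def vec_eq_iff
      sum.distrib distrib_left distrib_right sum_distrib_left mult_ac)

lemma bounded_bilinear_matrix_vector_mult:
  "bounded_bilinear ((*v) :: real^'n^'m \<Rightarrow> real^'n \<Rightarrow> real^'m)"
  unfolding bilinear_conv_bounded_bilinear[symmetric] bilinear_def
  by (auto intro!: linearI simp: matrix_vector_mult_def vec_eq_iff
      sum.distrib distrib_left distrib_right sum_distrib_left mult_ac)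

lemmas tendsto_matrix_vector_mult = bounded_bilinear.tendsto[OF bounded_bilinear_matrix_vector_mult]

lemma matrix_power_commute:
  fixes A :: "real^'m^'m"
  shows "((**) A ^^ k) (mat 1) ** A = A ** ((**) A ^^ k) (mat 1)"
  by (induction k) (auto simp: matrix_mul_assoc[symmetric] matrix_mul_lid matrix_mul_rid)

lemma matrix_power_scaleR:
  fixes A :: "real^'m^'m"
  shows "((**) (t *\<^sub>R A) ^^ k) (mat 1) = t ^ k *\<^sub>R ((**) A ^^ k) (mat 1)"
  by (induction k) (auto simp: matrix_scalar_ac scalar_matrix_assoc[symmetric])

lemma summable_matrix_exp_series:
  fixes A :: "real^'m^'m"
  shows "summable (\<lambda>k. (1 / fact k) *\<^sub>R (((**) A ^^ k) (mat 1)))"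
proof -
  obtain K where K: "K > 0" "\<And>(A::real^'m^'m) (B::real^'m^'m). norm (A ** B) \<le> norm A * norm B * K"
    using bounded_bilinear.pos_bounded[OF bounded_bilinear_matrix_matrix_mult] by metis
  have bound: "norm (((**) A ^^ k) (mat 1)) \<le> (norm A * K) ^ k * norm (mat 1 :: real^'m^'m)" for k
  proof (induction k)
    case (Suc k)
    have "norm (((**) A ^^ Suc k) (mat 1)) \<le> norm A * norm (((**) A ^^ k) (mat 1)) * K"
      using K(2) by simp
    also have "\<dots> \<le> norm A * ((norm A * K) ^ k * norm (mat 1 :: real^'m^'m)) * K"
      using Suc K(1) by (intro mult_right_mono mult_left_mono) auto
    finally show ?case by (simp add: mult_ac)
  qed simp
  have "summable (\<lambda>k. inverse (fact k) * (norm A * K) ^ k * norm (mat 1 :: real^'m^'m))"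
    by (intro summable_mult2 summable_exp)
  then show ?thesis
  proof (rule summable_comparison_test'[of _ 0])
    fix k :: nat
    show "norm ((1 / fact k) *\<^sub>R (((**) A ^^ k) (mat 1)))
      \<le> inverse (fact k) * (norm A * K) ^ k * norm (mat 1 :: real^'m^'m)"
      using mult_left_mono[OF bound[of k], of "inverse (fact k)"] by (simp add: divide_simps mult_ac)
  qed
qed

text \<open>Each entry is an everywhere convergent real power series in \<open>t\<close>, which
  reduces differentiation of the flow to termwise differentiation of scalar series.\<close>

lemma matrix_exp_nth_sums:
  fixes A :: "real^'m^'m"
  shows "(\<lambda>k. (((**) A ^^ k) (mat 1) $ i $ j) / fact k * t ^ k) sums (matrix_exp (t *\<^sub>R A) $ i $ j)"
proof -
  have "bounded_linear (\<lambda>B::real^'m^'m. B $ i $ j)"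
    by (intro bounded_linear_compose[OF bounded_linear_vec_nth bounded_linear_vec_nth])
  from bounded_linear.sums[OF this summable_sums[OF summable_matrix_exp_series[of "t *\<^sub>R A"]]]
  show ?thesis
    unfolding matrix_exp_def[symmetric] by (simp add: matrix_power_scaleR mult_ac)
qed

lemma matrix_exp_0 [simp]: "matrix_exp (0 :: real^'m^'m) = mat 1"
proof -
  have "matrix_exp (0 :: real^'m^'m) $ i $ j = (mat 1 :: real^'m^'m) $ i $ j" for i j
    using sums_unique2[OF matrix_exp_nth_sums[of 0 i j 0] powser_sums_zero] by simp
  then show ?thesis by (simp add: vec_eq_iff)
qed

lemma matrix_exp_commute:
  fixes A :: "real^'m^'m"
  shows "matrix_exp (t *\<^sub>R A) ** A = A ** matrix_exp (t *\<^sub>R A)"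
proof -
  have S: "(\<lambda>k. (1 / fact k) *\<^sub>R (((**) (t *\<^sub>R A) ^^ k) (mat 1))) sums matrix_exp (t *\<^sub>R A)"
    unfolding matrix_exp_def by (rule summable_sums[OF summable_matrix_exp_series])
  show ?thesis
    using bounded_linear.sums[OF bounded_bilinear.bounded_linear_left[OF bounded_bilinear_matrix_matrix_mult, of A] S]
      bounded_linear.sums[OF bounded_bilinear.bounded_linear_right[OF bounded_bilinear_matrix_matrix_mult, of A] S]
    by (simp add: matrix_power_scaleR matrix_power_commute matrix_scalar_ac scalar_matrix_assoc[symmetric] sums_unique2)
qed

lemma has_vector_derivative_matrix_componentwise:
  fixes f :: "real \<Rightarrow> real^'n^'m"
  assumes "\<And>i j. ((\<lambda>t. f t $ i $ j) has_real_derivative f' $ i $ j) (at t)"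
  shows "(f has_vector_derivative f') (at t)"
  unfolding has_vector_derivative_def has_derivative_componentwise_within[of f]
  using assms by (auto simp: Basis_vec_def inner_axis' inner_axis has_field_derivative_def mult_commute_abs)

lemma matrix_exp_has_vector_derivative:
  fixes A :: "real^'m^'m"
  shows "((\<lambda>t. matrix_exp (t *\<^sub>R A)) has_vector_derivative A ** matrix_exp (t *\<^sub>R A)) (at t)"
proof (rule has_vector_derivative_matrix_componentwise)
  fix i j
  let ?c = "\<lambda>i j k. (((**) A ^^ k) (mat 1) $ i $ j) / fact k"
  have eq: "(\<lambda>t. matrix_exp (t *\<^sub>R A) $ i $ j) = (\<lambda>t. \<Sum>k. ?c i j k * t ^ k)"
    using matrix_exp_nth_sums[of A i j] by (simp add: sums_iff)
  have "(\<lambda>k. \<Sum>l\<in>UNIV. A $ i $ l * (?c l j k * t ^ k)) sums (\<Sum>l\<in>UNIV. A $ i $ l * matrix_exp (t *\<^sub>R A) $ l $ j)"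
    by (intro sums_sum sums_mult matrix_exp_nth_sums)
  \<comment> \<open>\<open>diffs\<close> multiplies the next coefficient by \<open>Suc k\<close>;
    this cancels against \<open>fact (Suc k)\<close> and leaves one extra \<open>A\<close> on the
    left of the k-th power.\<close>
  moreover have "(\<Sum>l\<in>UNIV. A $ i $ l * (?c l j k * t ^ k)) = diffs (?c i j) k * t ^ k" for k
  proof -
    have "diffs (?c i j) k = (A ** (((**) A ^^ k) (mat 1))) $ i $ j / fact k"
      by (simp add: diffs_def field_simps del: of_nat_Suc)
    then show ?thesis by (simp add: matrix_matrix_mult_def sum_distrib_left sum_divide_distrib mult_ac)
  qed
  ultimately have "(A ** matrix_exp (t *\<^sub>R A)) $ i $ j = (\<Sum>k. diffs (?c i j) k * t ^ k)"
    by (simp add: sums_iff matrix_matrix_mult_def)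
  moreover have "((\<lambda>x. \<Sum>n. ?c i j n * x^n) has_field_derivative (\<Sum>n. diffs (?c i j) n * t^n)) (at t)"
    using matrix_exp_nth_sums[of A i j]
    by (intro termdiffs_strong_converges_everywhere) (auto simp: sums_iff)
  ultimately show "((\<lambda>t. matrix_exp (t *\<^sub>R A) $ i $ j) has_real_derivative
      (A ** matrix_exp (t *\<^sub>R A)) $ i $ j) (at t)"
    by (simp only: eq)
qed

text \<open>Rests on \<open>E (- t) ** E (s + t)\<close> having zero derivative in \<open>t\<close>,
  hence keeping its value \<open>E s\<close> at \<open>t = 0\<close>; commutation of
  \<open>A\<close> with its exponential makes the two product-rule terms cancel. The case
  \<open>s = 0\<close> supplies the inverse of \<open>E t\<close>.\<close>

lemma matrix_exp_add:
  fixes A :: "real^'m^'m"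
  shows "matrix_exp ((s + t) *\<^sub>R A) = matrix_exp (s *\<^sub>R A) ** matrix_exp (t *\<^sub>R A)"
proof -
  define E where "E = (\<lambda>t. matrix_exp (t *\<^sub>R A))"
  have dE: "(E has_vector_derivative A ** E t) (at t)" for t
    unfolding E_def by (rule matrix_exp_has_vector_derivative)
  have comm: "E t ** A = A ** E t" for t unfolding E_def by (rule matrix_exp_commute)
  have const: "E (- t) ** E (s + t) = E s" for s t
  proof -
    have "((\<lambda>t. E (- t) ** E (s + t)) has_vector_derivative 0) (at t within UNIV)" for t
    proof -
      have 1: "((\<lambda>t. E (- t)) has_vector_derivative - (A ** E (- t))) (at t)"
        using vector_diff_chain_at[OF has_vector_derivative_minus[OF has_vector_derivative_id[of "at t"]] dE[of "- t"]]
        by (simp add: o_def)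
      have 2: "((\<lambda>t. E (s + t)) has_vector_derivative (A ** E (s + t))) (at t)"
        using vector_diff_chain_at[OF has_vector_derivative_add[OF has_vector_derivative_const has_vector_derivative_id]
            dE[of "s + t"]] by (simp add: o_def)
      have "E (- t) ** (A ** E (s + t)) + - (A ** E (- t)) ** E (s + t) = 0"
        by (simp add: matrix_mul_assoc comm bounded_bilinear.minus_left[OF bounded_bilinear_matrix_matrix_mult])
      with bounded_bilinear.has_vector_derivative[OF bounded_bilinear_matrix_matrix_mult 1 2]
      show ?thesis by simp
    qed
    from has_vector_derivative_zero_constant[OF convex_UNIV this]
    obtain c where "\<And>t. E (- t) ** E (s + t) = c" by auto
    from this[of t] this[of 0] show ?thesis by (simp add: E_def matrix_mul_lid)
  qed
  have "E (s + t) = E t ** E s" for s t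
  proof -
    have "E t ** E (- t) = mat 1"
      using const[of "- t" 0] by (simp add: E_def)
    then have "E (s + t) = E t ** (E (- t) ** E (s + t))"
      by (simp add: matrix_mul_assoc matrix_mul_lid)
    then show ?thesis by (simp add: const)
  qed
  from this[of t s] show ?thesis by (simp add: E_def add.commute)
qed

lemma continuous_on_matrix_exp:
  fixes A :: "real^'m^'m"
  shows "continuous_on S (\<lambda>t. matrix_exp (t *\<^sub>R A))"
  by (intro continuous_at_imp_continuous_on ballI has_vector_derivative_continuous[OF matrix_exp_has_vector_derivative])

section \<open>Exponential decay of Hurwitz flows\<close>

text \<open>Horner's scheme for p(A) v. The polynomial acts on a vector throughout, so that the
  matrix p(A) is never formed: the ring operations of the matrix type are entrywise.\<close>

definition poly_apply :: "complex^'m^'m \<Rightarrow> complex poly \<Rightarrow> complex^'m \<Rightarrow> complex^'m" where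
  "poly_apply A p v = fold_coeffs (\<lambda>a u. a *s v + A *v u) p 0"

lemma poly_apply_0 [simp]: "poly_apply A 0 v = 0"
  by (simp add: poly_apply_def)

lemma poly_apply_pCons [simp]: "poly_apply A (pCons a p) v = a *s v + A *v poly_apply A p v"
  by (cases "p = 0 \<and> a = 0") (auto simp: poly_apply_def fold_coeffs_pCons_not_0_0_eq
      fold_coeffs_pCons_coeff_not_0_eq)

lemma poly_apply_add: "poly_apply A (p + q) v = poly_apply A p v + poly_apply A q v"
  by (induction p q rule: poly_induct2) (auto simp: algebra_simps vec.add vec.scale_left_distrib matrix_vector_right_distrib)

lemma poly_apply_smult: "poly_apply A (smult c p) v = c *s poly_apply A p v"
  by (induction p) (auto simp: vec.scale_right_distrib vector_scalar_commute)

text \<open>p(A) commutes with A - z. Together with the factorisation below, this carries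
  annihilation of \<open>v\<close> by (X - z) q over to annihilation of (A - z) v by q.\<close>

lemma poly_apply_shift: "poly_apply A p (A *v v - z *s v) = A *v poly_apply A p v - z *s poly_apply A p v"
proof (induction p)
  case (pCons a p)
  then show ?case
    by (simp add: matrix_vector_right_distrib matrix_vector_mult_diff_distrib vector_scalar_commute)
qed simp

lemma poly_apply_linear_factor:
  "poly_apply A ([:- z, 1:] * q) v = A *v poly_apply A q v - z *s poly_apply A q v"
proof -
  have "[:- z, 1:] * q = pCons 0 q + smult (- z) q" by simp
  then show ?thesis
    by (simp only: poly_apply_add poly_apply_smult poly_apply_pCons) (simp add: vec_eq_iff)
qed

lemma poly_apply_monom: "poly_apply A (monom c n) v = c *s (((*v) A ^^ n) v)"
  by (induction n) (auto simp: monom_0 monom_Suc vector_scalar_commute)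

lemma poly_apply_sum: "poly_apply A (sum f I) v = (\<Sum>i\<in>I. poly_apply A (f i) v)"
  by (induction I rule: infinite_finite_induct) (auto simp: poly_apply_add)

text \<open>The iterates of \<open>v\<close> under \<open>A\<close> up to exponent
  \<open>CARD('m)\<close> are one too many to be linearly independent; the coefficients of a
  dependency are those of the polynomial.\<close>

lemma annihilating_poly_exists:
  fixes A :: "complex^'m^'m"
  obtains p where "p \<noteq> 0" "poly_apply A p v = 0"
proof -
  define w where "w = (\<lambda>i. ((*v) A ^^ i) v)"
  show thesis
  \<comment> \<open>Dependence is a property of the set of iterates, so a repeated iterate is
    treated apart: it gives the polynomial \<open>monom 1 i + monom (-1) j\<close>.\<close>
  proof (cases "inj_on w {..CARD('m)}")
    case False
    then obtain i j where "i \<noteq> j" "w i = w j" unfolding inj_on_def by blast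
    then show thesis
      by (intro that[of "monom 1 i + monom (-1) j"])
        (auto simp: poly_apply_add poly_apply_monom w_def poly_eq_iff dest!: spec[of _ i])
  next
    case True
    then have "card (w ` {..CARD('m)}) > vec.dim (w ` {..CARD('m)})"
      using dim_subset_UNIV_cart_gen[of "w ` {..CARD('m)}"] by (simp add: card_image)
    then have "vec.dependent (w ` {..CARD('m)})"
      using vec.independent_card_le_dim[of "w ` {..CARD('m)}" "w ` {..CARD('m)}"] by fastforce
    then obtain u i where u: "(\<Sum>x\<in>w ` {..CARD('m)}. u x *s x) = 0" "i \<le> CARD('m)" "u (w i) \<noteq> 0"
      using vec.dependent_finite[of "w ` {..CARD('m)}"] by auto
    have "poly_apply A (\<Sum>j\<le>CARD('m). monom (u (w j)) j) v = 0"
      using u(1) True by (simp add: poly_apply_sum poly_apply_monom sum.reindex o_def) (simp add: w_def)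
    moreover have "coeff (\<Sum>j\<le>CARD('m). monom (u (w j)) j) i \<noteq> 0"
      using u by (simp add: coeff_sum sum.delta)
    ultimately show thesis using that by (metis coeff_0)
  qed
qed

section \<open>Complexified flows\<close>

lemma map_matrix_of_real_mult:
  "map_matrix complex_of_real (A ** B) = map_matrix complex_of_real A ** map_matrix complex_of_real B"
  by (simp add: vec_eq_iff matrix_matrix_mult_def)

lemma bounded_linear_map_matrix_mult_vec:
  "bounded_linear (\<lambda>B::real^'n^'m. map_matrix complex_of_real B *v v)"
  unfolding linear_conv_bounded_linear[symmetric]
proof (rule linearI)
  show "map_matrix complex_of_real (r *\<^sub>R B) *v v = r *\<^sub>R (map_matrix complex_of_real B *v v)" for r and B :: "real^'n^'m"
    by (simp add: vec_eq_iff matrix_vector_mult_def scaleR_sum_right) (simp add: scaleR_conv_of_real mult_ac)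
qed (simp add: vec_eq_iff matrix_vector_mult_def distrib_right sum.distrib)

lemma bounded_bilinear_vector_scalar_mult:
  "bounded_bilinear ((*s) :: complex \<Rightarrow> complex^'m \<Rightarrow> complex^'m)"
  unfolding bilinear_conv_bounded_bilinear[symmetric] bilinear_def
  by (auto intro!: linearI simp: vec_eq_iff algebra_simps)

lemma norm_vector_scalar_mult: "norm (c *s x) = cmod c * norm (x :: complex^'m)"
  by (simp add: norm_vec_def norm_mult L2_set_right_distrib)

text \<open>Variation of constants: if \<open>(A - z) v\<close> decays exponentially under the flow of \<open>A\<close> and
  \<open>Re z < 0\<close>, so does \<open>v\<close>; an annihilating polynomial of \<open>v\<close> is peeled off root by root, and
  roots that are not eigenvalues can be cancelled.\<close>

lemma complexified_flow_decay:
  fixes A :: "real^'m^'m"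
  assumes RH: "Routh_Hurwitz A" and p: "p \<noteq> 0" "poly_apply (map_matrix complex_of_real A) p v = 0"
  shows "\<exists>C \<delta>. \<delta> > 0 \<and> (\<forall>t\<ge>0. norm (map_matrix complex_of_real (matrix_exp (t *\<^sub>R A)) *v v) \<le> C * exp (- \<delta> * t))"
  using p
\<comment> \<open>\<open>v\<close> stays arbitrary since the induction hypothesis is applied to the
  vector (A - z) v and the quotient polynomial.\<close>
proof (induction "degree p" arbitrary: p v)
  case 0
  then obtain c where "p = [:c:]" by (metis degree_eq_zeroE)
  with 0 have "v = 0" by (auto simp: vector_mul_eq_0)
  then show ?case by (intro exI[of _ 0] exI[of _ 1]) auto
next
  case (Suc n)
  let ?A = "map_matrix complex_of_real A"
  define F where "F = (\<lambda>t. map_matrix complex_of_real (matrix_exp (t *\<^sub>R A)))"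
  have "\<not> constant (poly p)" using Suc.hyps(2) by (simp add: constant_degree)
  then obtain z where "poly p z = 0" using fundamental_theorem_of_algebra by blast
  then obtain q where q: "p = [:- z, 1:] * q" by (metis poly_eq_0_iff_dvd dvdE)
  have "q \<noteq> 0" using q Suc.prems by auto
  then have dq: "n = degree q" using Suc.hyps(2) degree_mult_eq[of "[:- z, 1:]" q] q by auto
  have fac: "?A *v poly_apply ?A q v - z *s poly_apply ?A q v = 0"
    using Suc.prems(2) unfolding q poly_apply_linear_factor .
  show ?case
  proof (cases "eigenvalue ?A z")
    case False
    then have "poly_apply ?A q v = 0"
      using fac unfolding eigenvalue_def by auto
    then show ?thesis using Suc.hyps(1)[OF dq \<open>q \<noteq> 0\<close>] by blast
  next
    case True
    then have z: "Re z < 0" using RH unfolding Routh_Hurwitz_def by blast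
    define w where "w = ?A *v v - z *s v"
    have "poly_apply ?A q w = 0" using fac by (simp add: w_def poly_apply_shift)
    then obtain C \<delta>' where C': "\<delta>' > 0" "\<And>t. t \<ge> 0 \<Longrightarrow> norm (F t *v w) \<le> C * exp (- \<delta>' * t)"
      using Suc.hyps(1)[OF dq \<open>q \<noteq> 0\<close>] unfolding F_def by blast
    \<comment> \<open>Capping the rate at \<open>- Re z / 2\<close> keeps
      \<open>\<kappa> = - Re z - \<delta>\<close> positive, so the forcing term integrates to a pure
      exponential; equal rates would produce a factor \<open>t\<close>.\<close>
    define \<delta> where "\<delta> = min \<delta>' (- Re z / 2)"
    have \<delta>: "\<delta> > 0" "\<delta> \<le> \<delta>'" "- Re z - \<delta> > 0" using C' z by (auto simp: \<delta>_def min_def)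
    have C0: "C \<ge> 0" using order_trans[OF norm_ge_zero C'(2)[of 0]] by simp
    define \<kappa> where "\<kappa> = - Re z - \<delta>"
    have C: "norm (F t *v w) \<le> C * exp (- \<delta> * t)" if "t \<ge> 0" for t
    proof -
      have "C * exp (- \<delta>' * t) \<le> C * exp (- \<delta> * t)"
        using that \<delta> C0 by (intro mult_left_mono) (auto simp: mult_right_mono)
      with C'(2)[OF that] show ?thesis by linarith
    qed
    \<comment> \<open>Integrating factor: the derivative of \<open>F t *v v\<close> is
      \<open>F t *v w\<close> plus \<open>z\<close> times itself; in the derivative of
      \<open>g\<close> the terms with \<open>z\<close> cancel and only the decaying
      \<open>F t *v w\<close> remains.\<close>
    define g where "g = (\<lambda>t. exp (- z * complex_of_real t) *s (F t *v v))"
    have dg: "(g has_vector_derivative exp (- z * complex_of_real t) *s (F t *v w)) (at t)" for t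
    proof -
      have 1: "((\<lambda>t. exp (- z * complex_of_real t)) has_vector_derivative - z * exp (- z * complex_of_real t)) (at t)"
        by (rule has_vector_derivative_real_field) (auto intro!: derivative_eq_intros)
      have comm: "?A *v (F t *v v) = F t *v (?A *v v)"
        by (simp add: F_def matrix_vector_mul_assoc map_matrix_of_real_mult[symmetric] matrix_exp_commute)
      have 2: "((\<lambda>t. F t *v v) has_vector_derivative F t *v (?A *v v)) (at t)"
        using bounded_linear.has_vector_derivative[OF bounded_linear_map_matrix_mult_vec[of v]
            matrix_exp_has_vector_derivative[of A t]] comm
        by (simp add: F_def map_matrix_of_real_mult matrix_vector_mul_assoc)
      have "exp (- z * complex_of_real t) *s (F t *v (?A *v v)) + (- z * exp (- z * complex_of_real t)) *s (F t *v v)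
          = exp (- z * complex_of_real t) *s (F t *v w)"
        by (simp add: w_def matrix_vector_mult_diff_distrib vector_scalar_commute vec_eq_iff algebra_simps)
      with bounded_bilinear.has_vector_derivative[OF bounded_bilinear_vector_scalar_mult 1 2]
      show ?thesis by (simp add: g_def)
    qed
    have "norm (F t *v v) \<le> (norm v + C / \<kappa>) * exp (- \<delta> * t)" if "t \<ge> 0" for t
    proof -
      have "norm (g t - g 0) \<le> C / \<kappa> * exp (\<kappa> * t) - C / \<kappa> * exp (\<kappa> * 0)"
      proof (cases "t = 0")
        case False
        then have "0 < t" using that by simp
        then show ?thesis
        proof (rule differentiable_bound_general[where f'="\<lambda>t. exp (- z * complex_of_real t) *s (F t *v w)"
              and \<phi>' = "\<lambda>t. C * exp (\<kappa> * t)"])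
          show "continuous_on {0..t} g" 
            by (intro continuous_at_imp_continuous_on ballI has_vector_derivative_continuous[OF dg])
          show "continuous_on {0..t} (\<lambda>t. C / \<kappa> * exp (\<kappa> * t))" by (intro continuous_intros)
          show "((\<lambda>t. C / \<kappa> * exp (\<kappa> * t)) has_vector_derivative C * exp (\<kappa> * x)) (at x)" for x
            using \<delta>(3) unfolding has_real_derivative_iff_has_vector_derivative[symmetric]
            by (auto intro!: derivative_eq_intros simp: \<kappa>_def)
          show "(g has_vector_derivative exp (- z * complex_of_real x) *s (F x *v w)) (at x)" for x by (rule dg)
          show "norm (exp (- z * complex_of_real x) *s (F x *v w)) \<le> C * exp (\<kappa> * x)" if "0 < x" for x
          proof -
            have "norm (exp (- z * complex_of_real x) *s (F x *v w)) \<le> exp (- Re z * x) * (C * exp (- \<delta> * x))"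
              using C[of x] that by (simp add: norm_vector_scalar_mult)
            also have "\<dots> = C * exp (\<kappa> * x)"
              by (simp add: \<kappa>_def algebra_simps mult_exp_exp)
            finally show ?thesis .
          qed
        qed
      qed simp
      moreover have "g 0 = v" by (simp add: g_def F_def matrix_vector_mult_def mat_def vec_eq_iff if_distrib if_distribR sum.delta cong: if_cong)
      ultimately have "norm (g t) \<le> norm v + C / \<kappa> * exp (\<kappa> * t)"
        using norm_triangle_sub[of "g t" "g 0"] C0 \<delta>(3) by (simp add: \<kappa>_def)
           (smt (verit) divide_nonneg_pos)
      moreover have "norm (g t) = exp (- Re z * t) * norm (F t *v v)"
        by (simp add: g_def norm_vector_scalar_mult)
      ultimately have "exp (Re z * t) * (exp (- Re z * t) * norm (F t *v v))
          \<le> exp (Re z * t) * (norm v + C / \<kappa> * exp (\<kappa> * t))"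
        by (intro mult_left_mono) auto
      also have "exp (Re z * t) * (exp (- Re z * t) * norm (F t *v v)) = norm (F t *v v)"
        by (simp add: exp_minus)
      finally have "norm (F t *v v) \<le> exp (Re z * t) * norm v + C / \<kappa> * (exp (Re z * t) * exp (\<kappa> * t))"
        by (simp add: distrib_left mult_ac)
      also have "exp (Re z * t) * exp (\<kappa> * t) = exp (- \<delta> * t)"
        by (simp add: \<kappa>_def mult_exp_exp algebra_simps)
      also have "exp (Re z * t) * norm v \<le> exp (- \<delta> * t) * norm v"
        using \<delta>(3) that mult_right_mono[of "Re z" "- \<delta>" t] by (intro mult_right_mono) auto
      finally show ?thesis by (simp add: algebra_simps)
    qed
    then show ?thesis using \<delta>(1) unfolding F_def by blast
  qed
qed

text \<open>Entry \<open>(i, j)\<close> is coordinate \<open>i\<close> of the complexified flow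
  started at \<open>axis j 1\<close>, and every such vector has an annihilating polynomial.\<close>

lemma matrix_exp_tendsto_0:
  fixes A :: "real^'m^'m"
  assumes "Routh_Hurwitz A"
  shows "((\<lambda>t. matrix_exp (t *\<^sub>R A)) \<longlongrightarrow> 0) at_top"
proof (intro vec_tendstoI)
  fix i j :: 'm
  let ?F = "\<lambda>t. map_matrix complex_of_real (matrix_exp (t *\<^sub>R A)) *v axis j 1"
  obtain p where "p \<noteq> 0" "poly_apply (map_matrix complex_of_real A) p (axis j 1) = 0"
    using annihilating_poly_exists by blast
  from complexified_flow_decay[OF assms this]
  obtain C \<delta> where C: "\<delta> > 0" "\<And>t. t \<ge> 0 \<Longrightarrow> norm (?F t) \<le> C * exp (- \<delta> * t)" by blast
  have "?F t $ i = complex_of_real (matrix_exp (t *\<^sub>R A) $ i $ j)" for t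
    by (simp add: matrix_vector_mult_def axis_def if_distrib sum.delta cong: if_cong)
  then have "\<bar>matrix_exp (t *\<^sub>R A) $ i $ j\<bar> \<le> norm (?F t)" for t
    using Finite_Cartesian_Product.norm_nth_le[of "?F t" i] by simp
  then have "\<forall>\<^sub>F t in at_top. norm (matrix_exp (t *\<^sub>R A) $ i $ j) \<le> C * exp (- \<delta> * t)"
    using C(2) by (intro eventually_at_top_linorderI[of 0]) (simp, meson order_trans)
  moreover have "filterlim (\<lambda>t. - \<delta> * t) at_bot at_top"
    using C(1) by (intro filterlim_tendsto_neg_mult_at_bot[OF tendsto_const _ filterlim_ident]) auto
  then have "((\<lambda>t. C * exp (- \<delta> * t)) \<longlongrightarrow> 0) at_top"
    by (intro tendsto_mult_right_zero filterlim_compose[OF exp_at_bot])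
  ultimately show "((\<lambda>t. matrix_exp (t *\<^sub>R A) $ i $ j) \<longlongrightarrow> 0 $ i $ j) at_top"
    by (auto intro: Lim_null_comparison)
qed

section \<open>Laws of integrals of jointly measurable processes\<close>

text \<open>Both families live on the same space because a process is compared with its own time
  shift; the restricted functions match the form used in
  \<open>stationary_increments\<close>.\<close>

definition equal_laws ::
    "'a measure \<Rightarrow> 'i set \<Rightarrow> ('i \<Rightarrow> 'a \<Rightarrow> 'b::topological_space) \<Rightarrow> ('i \<Rightarrow> 'a \<Rightarrow> 'b) \<Rightarrow> bool" where
  "equal_laws M J X Y \<longleftrightarrow>
     distr M (\<Pi>\<^sub>M j\<in>J. borel) (\<lambda>\<omega>. \<lambda>j\<in>J. X j \<omega>) = distr M (\<Pi>\<^sub>M j\<in>J. borel) (\<lambda>\<omega>. \<lambda>j\<in>J. Y j \<omega>)"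

lemma equal_laws_map:
  assumes "equal_laws M F X Y"
    and [measurable]: "\<And>j. j \<in> F \<Longrightarrow> X j \<in> borel_measurable M" "\<And>j. j \<in> F \<Longrightarrow> Y j \<in> borel_measurable M"
    and [measurable]: "\<And>i. i \<in> J \<Longrightarrow> f i \<in> borel_measurable (\<Pi>\<^sub>M j\<in>F. borel)"
  shows "equal_laws M J (\<lambda>i \<omega>. f i (\<lambda>j\<in>F. X j \<omega>)) (\<lambda>i \<omega>. f i (\<lambda>j\<in>F. Y j \<omega>))"
proof -
  let ?f = "\<lambda>y. \<lambda>i\<in>J. f i y"
  have m: "?f \<in> measurable (\<Pi>\<^sub>M j\<in>F. borel) (\<Pi>\<^sub>M j\<in>J. borel)"
    by (intro measurable_restrict) auto
  have "distr (distr M (\<Pi>\<^sub>M j\<in>F. borel) (\<lambda>\<omega>. \<lambda>j\<in>F. Z j \<omega>)) (\<Pi>\<^sub>M j\<in>J. borel) ?f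
      = distr M (\<Pi>\<^sub>M j\<in>J. borel) (\<lambda>\<omega>. \<lambda>i\<in>J. f i (\<lambda>j\<in>F. Z j \<omega>))"
    if "\<And>j. j \<in> F \<Longrightarrow> Z j \<in> borel_measurable M" for Z
    using that by (subst distr_distr[OF m]) (auto intro!: measurable_restrict simp: o_def)
  from this[of X] this[of Y] assms show ?thesis unfolding equal_laws_def by simp
qed

text \<open>Closed boxes are an intersection-stable generator. Closed sets are singled out because
  their indicators are pointwise limits of Lipschitz functions, which is what a passage to the limit
  in the laws requires.\<close>

lemma measure_eqI_PiM_closed:
  fixes P Q :: "('i \<Rightarrow> 'b::topological_space) measure"
  assumes "finite J" "finite_measure P"
    and sets: "sets P = sets (\<Pi>\<^sub>M j\<in>J. borel)" "sets Q = sets (\<Pi>\<^sub>M j\<in>J. borel)"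
    and eq: "\<And>C. (\<And>j. j \<in> J \<Longrightarrow> closed (C j)) \<Longrightarrow> emeasure P (Pi\<^sub>E J C) = emeasure Q (Pi\<^sub>E J C)"
  shows "P = Q"
proof -
  define E :: "('i \<Rightarrow> 'b) set set" where "E = {Pi\<^sub>E J C |C. \<forall>j\<in>J. closed (C j)}"
  let ?\<Omega> = "(\<Pi>\<^sub>E j\<in>J. UNIV) :: ('i \<Rightarrow> 'b) set"
  have E: "E \<subseteq> Pow ?\<Omega>" by (auto simp: E_def PiE_iff)
  have gen: "sets (\<Pi>\<^sub>M j\<in>J. borel :: 'b measure) = sigma_sets ?\<Omega> E"
  proof -
    have "{f \<in> ?\<Omega>. \<forall>i\<in>J. f i \<in> A i} = Pi\<^sub>E J A" for A :: "'i \<Rightarrow> 'b set"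
      by (auto simp: PiE_iff extensional_def)
    then have eq: "E = {{f \<in> ?\<Omega>. \<forall>i\<in>j. f i \<in> A i} | A j. j \<in> {J} \<and> A \<in> Pi j (\<lambda>_. Collect closed)}"
      by (auto simp: E_def)
    have "sets (\<Pi>\<^sub>M i\<in>J. sigma (UNIV::'b set) (Collect closed)) = sets (sigma ?\<Omega> E)"
      unfolding eq by (rule sets_PiM_sigma) (auto simp: \<open>finite J\<close> intro!: exI[of _ "{UNIV}"])
    then show ?thesis using sets_measure_of[OF E] unfolding borel_eq_closed[symmetric] by simp
  qed
  have "Int_stable E"
  proof (rule Int_stableI)
    fix a b assume "a \<in> E" "b \<in> E"
    then obtain C D where C: "a = Pi\<^sub>E J C" "\<forall>j\<in>J. closed (C j)" and D: "b = Pi\<^sub>E J D" "\<forall>j\<in>J. closed (D j)"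
      unfolding E_def by auto
    show "a \<inter> b \<in> E"
      unfolding E_def using C D by (intro CollectI exI[of _ "\<lambda>j. C j \<inter> D j"]) (simp add: PiE_Int closed_Int)
  qed
  moreover have "emeasure P X = emeasure Q X" if "X \<in> E" for X
    using that eq unfolding E_def by auto
  moreover have "range (\<lambda>_::nat. ?\<Omega>) \<subseteq> E" "(\<Union>i::nat. ?\<Omega>) = ?\<Omega>"
    unfolding E_def by auto
  moreover have "emeasure P ?\<Omega> \<noteq> \<infinity>"
    using finite_measure.emeasure_finite[OF assms(2)] by simp
  ultimately show ?thesis
    using trans[OF sets(1) gen] trans[OF sets(2) gen] E
    by (intro measure_eqI_generator_eq[of E ?\<Omega> P Q "\<lambda>_. ?\<Omega>"])
qed

text \<open>The expectation of \<open>min 1\<close> of the distance metrises convergence in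
  probability; such limits keep expectations of bounded Lipschitz functions equal, and products of
  ramps approximate the indicator of a closed box.\<close>

lemma equal_laws_limit:
  fixes X Y :: "nat \<Rightarrow> 'i \<Rightarrow> 'a \<Rightarrow> 'b::euclidean_space"
  assumes "prob_space M" "finite J"
    and meas [measurable]: "\<And>n j. j \<in> J \<Longrightarrow> X n j \<in> borel_measurable M" "\<And>n j. j \<in> J \<Longrightarrow> Y n j \<in> borel_measurable M"
      "\<And>j. j \<in> J \<Longrightarrow> X' j \<in> borel_measurable M" "\<And>j. j \<in> J \<Longrightarrow> Y' j \<in> borel_measurable M"
    and eq: "\<And>n. equal_laws M J (X n) (Y n)"
    and limX: "\<And>j. j \<in> J \<Longrightarrow> (\<lambda>n. \<integral>\<omega>. min 1 (dist (X n j \<omega>) (X' j \<omega>)) \<partial>M) \<longlonglongrightarrow> 0"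
    and limY: "\<And>j. j \<in> J \<Longrightarrow> (\<lambda>n. \<integral>\<omega>. min 1 (dist (Y n j \<omega>) (Y' j \<omega>)) \<partial>M) \<longlonglongrightarrow> 0"
  shows "equal_laws M J X' Y'"
proof -
  interpret prob_space M by fact
  have m: "(\<lambda>\<omega>. \<lambda>j\<in>J. Z j \<omega>) \<in> measurable M (\<Pi>\<^sub>M j\<in>J. borel)"
    if "\<And>j. j \<in> J \<Longrightarrow> Z j \<in> borel_measurable M" for Z :: "'i \<Rightarrow> 'a \<Rightarrow> 'b"
    using that by (intro measurable_restrict) auto
  show ?thesis
    unfolding equal_laws_def
  proof (rule measure_eqI_PiM_closed[OF \<open>finite J\<close>])
    show "finite_measure (distr M (\<Pi>\<^sub>M j\<in>J. borel) (\<lambda>\<omega>. \<lambda>j\<in>J. X' j \<omega>))"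
      by (intro finite_measure_distr m meas)
    fix C :: "'i \<Rightarrow> 'b set"
    assume C: "\<And>j. j \<in> J \<Longrightarrow> closed (C j)"
    have CM: "Pi\<^sub>E J C \<in> sets (\<Pi>\<^sub>M j\<in>J. borel)"
      using C \<open>finite J\<close> by (intro sets_PiM_I_finite) auto
    show "emeasure (distr M (\<Pi>\<^sub>M j\<in>J. borel) (\<lambda>\<omega>. \<lambda>j\<in>J. X' j \<omega>)) (Pi\<^sub>E J C)
        = emeasure (distr M (\<Pi>\<^sub>M j\<in>J. borel) (\<lambda>\<omega>. \<lambda>j\<in>J. Y' j \<omega>)) (Pi\<^sub>E J C)"
    \<comment> \<open>\<open>infdist\<close> to the empty set is 0 by convention, so on an empty
      side the ramp below would be constantly 1 instead of vanishing.\<close>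
    proof (cases "\<exists>j\<in>J. C j = {}")
      case True
      then have "Pi\<^sub>E J C = {}" by (simp add: PiE_eq_empty_iff)
      then show ?thesis by simp
    next
      case False
      \<comment> \<open>For positive \<open>k\<close> a ramp equal to 1 on \<open>C j\<close> and to
        0 at distance \<open>1 / k\<close> or more; it decreases to the indicator as
        \<open>k\<close> grows.\<close>
      define g where "g = (\<lambda>(k::nat) j x. max 0 (1 - real k * infdist x (C j)))"
      define G where "G = (\<lambda>k y. \<Prod>j\<in>J. g k j (y j))"
      have g01: "0 \<le> g k j x" "g k j x \<le> 1" for k j x
        using infdist_nonneg[of x "C j"] by (auto simp: g_def)
      have G01: "0 \<le> G k y" "G k y \<le> 1" for k y
        using g01 by (auto simp: G_def intro!: prod_nonneg prod_le_1)
      have [measurable]: "g k j \<in> borel_measurable borel" for k j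
        unfolding g_def by (intro borel_measurable_continuous_onI continuous_intros)
      have Gm[measurable]: "G k \<in> borel_measurable (\<Pi>\<^sub>M j\<in>J. borel)" for k
        unfolding G_def by measurable
      \<comment> \<open>Covers both regimes of \<open>min 1\<close>: slope \<open>k\<close> at
        distances up to 1, values in the unit interval beyond.\<close>
      have lip: "\<bar>g k j x - g k j y\<bar> \<le> (1 + real k) * min 1 (dist x y)" for k j x y
      proof -
        have "\<bar>g k j x - g k j y\<bar> \<le> 1" using g01[of k j x] g01[of k j y] by linarith
        moreover have "\<bar>g k j x - g k j y\<bar> \<le> \<bar>real k * (infdist x (C j) - infdist y (C j))\<bar>"
          unfolding g_def by (auto simp: algebra_simps max_def abs_if)
        then have "\<bar>g k j x - g k j y\<bar> \<le> real k * dist x y"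
          using mult_left_mono[OF infdist_triangle_abs[of x "C j" y], of "real k"] by (simp add: abs_mult)
        ultimately show ?thesis
          by (cases "dist x y \<le> 1") (auto simp: min_def algebra_simps intro: order_trans)
      qed
      have Gint: "integrable M (\<lambda>\<omega>. G k (\<lambda>j\<in>J. Z j \<omega>))"
        if "\<And>j. j \<in> J \<Longrightarrow> Z j \<in> borel_measurable M" for k Z
        using G01 that by (intro integrable_const_bound[of _ 1]) (auto intro!: measurable_compose[OF m Gm])
      have lim: "(\<lambda>n. \<integral>\<omega>. G k (\<lambda>j\<in>J. Z n j \<omega>) \<partial>M) \<longlonglongrightarrow> (\<integral>\<omega>. G k (\<lambda>j\<in>J. Z' j \<omega>) \<partial>M)"
        if Z [measurable]: "\<And>n j. j \<in> J \<Longrightarrow> Z n j \<in> borel_measurable M" "\<And>j. j \<in> J \<Longrightarrow> Z' j \<in> borel_measurable M"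
          and Zlim: "\<And>j. j \<in> J \<Longrightarrow> (\<lambda>n. \<integral>\<omega>. min 1 (dist (Z n j \<omega>) (Z' j \<omega>)) \<partial>M) \<longlonglongrightarrow> 0" for Z Z' k
      proof -
        have mint: "integrable M (\<lambda>\<omega>. min 1 (dist (Z n j \<omega>) (Z' j \<omega>)))" if "j \<in> J" for n j
          using that by (intro integrable_const_bound[of _ 1]) auto
        have b: "norm ((\<integral>\<omega>. G k (\<lambda>j\<in>J. Z n j \<omega>) \<partial>M) - (\<integral>\<omega>. G k (\<lambda>j\<in>J. Z' j \<omega>) \<partial>M))
            \<le> (\<Sum>j\<in>J. (1 + real k) * (\<integral>\<omega>. min 1 (dist (Z n j \<omega>) (Z' j \<omega>)) \<partial>M))" for n
        proof -
          have "norm ((\<integral>\<omega>. G k (\<lambda>j\<in>J. Z n j \<omega>) \<partial>M) - (\<integral>\<omega>. G k (\<lambda>j\<in>J. Z' j \<omega>) \<partial>M))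
              = norm (\<integral>\<omega>. G k (\<lambda>j\<in>J. Z n j \<omega>) - G k (\<lambda>j\<in>J. Z' j \<omega>) \<partial>M)"
            using Z by (subst Bochner_Integration.integral_diff) (auto intro!: Gint)
          also have "\<dots> \<le> (\<integral>\<omega>. (\<Sum>j\<in>J. (1 + real k) * min 1 (dist (Z n j \<omega>) (Z' j \<omega>))) \<partial>M)"
          proof (rule order_trans[OF integral_norm_bound integral_mono])
            fix \<omega>
            \<comment> \<open>Telescoping: since all factors have modulus at most 1, the difference
              of the products is at most the sum of the differences.\<close>
            have "norm (G k (\<lambda>j\<in>J. Z n j \<omega>) - G k (\<lambda>j\<in>J. Z' j \<omega>)) \<le> (\<Sum>j\<in>J. norm (g k j (Z n j \<omega>) - g k j (Z' j \<omega>)))"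
              using g01 norm_prod_diff[of J "\<lambda>j. g k j (Z n j \<omega>)" "\<lambda>j. g k j (Z' j \<omega>)"] by (simp add: G_def)
            also have "\<dots> \<le> (\<Sum>j\<in>J. (1 + real k) * min 1 (dist (Z n j \<omega>) (Z' j \<omega>)))"
              using lip by (intro sum_mono) auto
            finally show "norm (G k (\<lambda>j\<in>J. Z n j \<omega>) - G k (\<lambda>j\<in>J. Z' j \<omega>)) \<le> \<dots>" .
          qed (use Z in \<open>auto intro!: integrable_abs Gint mint\<close>)
          also have "\<dots> = (\<Sum>j\<in>J. (1 + real k) * (\<integral>\<omega>. min 1 (dist (Z n j \<omega>) (Z' j \<omega>)) \<partial>M))"
            by (subst Bochner_Integration.integral_sum) (auto intro!: mint)
          finally show ?thesis .
        qed
        have "(\<lambda>n. \<Sum>j\<in>J. (1 + real k) * (\<integral>\<omega>. min 1 (dist (Z n j \<omega>) (Z' j \<omega>)) \<partial>M)) \<longlonglongrightarrow> 0"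
          by (intro tendsto_null_sum tendsto_mult_right_zero Zlim)
        from Lim_null_comparison[OF always_eventually[OF allI[OF b]] this]
        show ?thesis by (rule LIM_zero_cancel)
      qed
      have "(\<integral>\<omega>. G k (\<lambda>j\<in>J. X n j \<omega>) \<partial>M) = (\<integral>\<omega>. G k (\<lambda>j\<in>J. Y n j \<omega>) \<partial>M)" for k n
      proof -
        have "(\<integral>\<omega>. G k (\<lambda>j\<in>J. Z j \<omega>) \<partial>M) = (\<integral>y. G k y \<partial>distr M (\<Pi>\<^sub>M j\<in>J. borel) (\<lambda>\<omega>. \<lambda>j\<in>J. Z j \<omega>))"
          if "\<And>j. j \<in> J \<Longrightarrow> Z j \<in> borel_measurable M" for Z
          by (rule integral_distr[symmetric, OF m Gm]) (use that in auto)
        from this[of "X n"] this[of "Y n"] eq[of n] show ?thesis by (simp add: equal_laws_def)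
      qed
      then have XY: "(\<integral>\<omega>. G k (\<lambda>j\<in>J. X' j \<omega>) \<partial>M) = (\<integral>\<omega>. G k (\<lambda>j\<in>J. Y' j \<omega>) \<partial>M)" for k
        using LIMSEQ_unique[OF lim[of X X' k, OF meas(1,3) limX] ] lim[of Y Y' k, OF meas(2,4) limY] by simp
      have gi: "(\<lambda>k. g k j x) \<longlonglongrightarrow> indicator (C j) x" if "j \<in> J" for j x
      proof (cases "x \<in> C j")
        case True
        then show ?thesis by (simp add: g_def)
      next
        case F: False
        then have "infdist x (C j) > 0"
          using C[OF that] False that in_closed_iff_infdist_zero[of "C j" x] infdist_nonneg[of x "C j"] by force
        then obtain k0 :: nat where k0: "real k0 * infdist x (C j) > 1"
          using reals_Archimedean3 by (metis mult.commute)
        have "g k j x = 0" if "k \<ge> k0" for k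
          using that k0 mult_right_mono[of "real k0" "real k" "infdist x (C j)"] infdist_nonneg[of x "C j"]
          by (auto simp: g_def max_def)
        then have "\<forall>\<^sub>F k in sequentially. g k j x = 0" by (auto simp: eventually_sequentially)
        then show ?thesis using F by (simp add: tendsto_eventually)
      qed
      have "(\<lambda>k. \<integral>\<omega>. G k (\<lambda>j\<in>J. Z j \<omega>) \<partial>M) \<longlonglongrightarrow> measure (distr M (\<Pi>\<^sub>M j\<in>J. borel) (\<lambda>\<omega>. \<lambda>j\<in>J. Z j \<omega>)) (Pi\<^sub>E J C)"
        if Z: "\<And>j. j \<in> J \<Longrightarrow> Z j \<in> borel_measurable M" for Z
      proof -
        have "(\<lambda>k. \<integral>\<omega>. G k (\<lambda>j\<in>J. Z j \<omega>) \<partial>M) \<longlonglongrightarrow> (\<integral>\<omega>. (\<Prod>j\<in>J. indicat_real (C j) (Z j \<omega>)) \<partial>M)"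
        proof (rule integral_dominated_convergence[where w="\<lambda>_. 1"])
          show "(\<lambda>\<omega>. \<Prod>j\<in>J. indicat_real (C j) (Z j \<omega>)) \<in> borel_measurable M"
            using C by (intro borel_measurable_prod measurable_compose[OF Z borel_measurable_indicator]) auto
          show "AE \<omega> in M. (\<lambda>k. G k (\<lambda>j\<in>J. Z j \<omega>)) \<longlonglongrightarrow> (\<Prod>j\<in>J. indicat_real (C j) (Z j \<omega>))"
            by (intro AE_I2) (auto simp: G_def intro!: tendsto_prod gi)
        qed (use G01 Z in \<open>auto intro!: measurable_compose[OF m Gm]\<close>)
        also have "(\<integral>\<omega>. (\<Prod>j\<in>J. indicat_real (C j) (Z j \<omega>)) \<partial>M)
            = (\<integral>\<omega>. indicator (Pi\<^sub>E J C) (\<lambda>j\<in>J. Z j \<omega>) \<partial>M)"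
          using \<open>finite J\<close> by (intro Bochner_Integration.integral_cong)
            (auto simp: indicator_def prod_zero_iff split: if_splits intro!: prod.neutral)
        also have "\<dots> = (\<integral>y. indicator (Pi\<^sub>E J C) y \<partial>distr M (\<Pi>\<^sub>M j\<in>J. borel) (\<lambda>\<omega>. \<lambda>j\<in>J. Z j \<omega>))"
          using CM by (intro integral_distr[symmetric] m Z) auto
        also have "\<dots> = measure (distr M (\<Pi>\<^sub>M j\<in>J. borel) (\<lambda>\<omega>. \<lambda>j\<in>J. Z j \<omega>)) (Pi\<^sub>E J C)"
          using CM by simp
        finally show ?thesis .
      qed
      from LIMSEQ_unique[OF this[of X'] ] this[of Y'] meas(3,4) XY
      have "measure (distr M (\<Pi>\<^sub>M j\<in>J. borel) (\<lambda>\<omega>. \<lambda>j\<in>J. X' j \<omega>)) (Pi\<^sub>E J C)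
          = measure (distr M (\<Pi>\<^sub>M j\<in>J. borel) (\<lambda>\<omega>. \<lambda>j\<in>J. Y' j \<omega>)) (Pi\<^sub>E J C)" by simp
      then show ?thesis
        using finite_measure.emeasure_eq_measure[OF finite_measure_distr[OF m]] meas(3,4) by simp
    qed
  qed auto
qed

section \<open>Two criteria for convergence in probability\<close>

lemma (in prob_space) integral_min_dist_tendsto_0_AE:
  fixes X :: "nat \<Rightarrow> 'a \<Rightarrow> 'b::euclidean_space"
  assumes [measurable]: "\<And>n. X n \<in> borel_measurable M" "X' \<in> borel_measurable M"
    and "AE \<omega> in M. (\<lambda>n. X n \<omega>) \<longlonglongrightarrow> X' \<omega>"
  shows "(\<lambda>n. \<integral>\<omega>. min 1 (dist (X n \<omega>) (X' \<omega>)) \<partial>M) \<longlonglongrightarrow> 0"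
proof -
  have "(\<lambda>n. \<integral>\<omega>. min 1 (dist (X n \<omega>) (X' \<omega>)) \<partial>M) \<longlonglongrightarrow> (\<integral>\<omega>. 0 \<partial>M)"
  proof (rule integral_dominated_convergence[where w="\<lambda>_. 1"])
    show "AE \<omega> in M. (\<lambda>n. min 1 (dist (X n \<omega>) (X' \<omega>))) \<longlonglongrightarrow> 0"
      using assms(3)
    proof eventually_elim
      case (elim \<omega>)
      then have "(\<lambda>n. min 1 (dist (X n \<omega>) (X' \<omega>))) \<longlonglongrightarrow> min 1 0"
        by (intro tendsto_min tendsto_const) (simp add: tendsto_dist_iff[symmetric])
      then show ?case by simp
    qed
  qed auto
  then show ?thesis by simp
qed

text \<open>The elementary bound \<open>d \<le> (a + d\<^sup>2 / a) / 2\<close> takes the place of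
  Cauchy-Schwarz and loses nothing when the mean square equals \<open>a\<^sup>2\<close>.\<close>

lemma (in prob_space) integral_min_dist_le_L2:
  fixes X X' :: "'a \<Rightarrow> 'b::euclidean_space"
  assumes [measurable]: "X \<in> borel_measurable M" "X' \<in> borel_measurable M"
    and int: "integrable M (\<lambda>\<omega>. (norm (X \<omega> - X' \<omega>))\<^sup>2)" and le: "(\<integral>\<omega>. (norm (X \<omega> - X' \<omega>))\<^sup>2 \<partial>M) \<le> a\<^sup>2" and a: "a > 0"
  shows "(\<integral>\<omega>. min 1 (dist (X \<omega>) (X' \<omega>)) \<partial>M) \<le> a"
proof -
  have "(\<integral>\<omega>. min 1 (dist (X \<omega>) (X' \<omega>)) \<partial>M) \<le> (\<integral>\<omega>. (a + (norm (X \<omega> - X' \<omega>))\<^sup>2 / a) / 2 \<partial>M)"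
  proof (rule integral_mono)
    fix \<omega>
    have "0 \<le> (dist (X \<omega>) (X' \<omega>) - a)\<^sup>2" by simp
    then have "dist (X \<omega>) (X' \<omega>) \<le> (a + (norm (X \<omega> - X' \<omega>))\<^sup>2 / a) / 2"
      using a by (simp add: dist_norm field_simps power2_eq_square)
    then show "min 1 (dist (X \<omega>) (X' \<omega>)) \<le> (a + (norm (X \<omega> - X' \<omega>))\<^sup>2 / a) / 2" by linarith
  qed (use int in \<open>auto intro!: integrable_const_bound[of _ 1]\<close>)
  also have "\<dots> = (a + (\<integral>\<omega>. (norm (X \<omega> - X' \<omega>))\<^sup>2 \<partial>M) / a) / 2"
    using int by (simp add: prob_space)
  also have "\<dots> \<le> a" using le a by (simp add: field_simps power2_eq_square)
  finally show ?thesis .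
qed

text \<open>Derandomised Monte Carlo: the nodes are chosen one at a time, each no worse than a random one
  would be on average, so that all the squared errors stay of order \<open>n\<close>.\<close>

lemma quadrature_nodes_exist:
  fixes g :: "'i \<Rightarrow> 's \<Rightarrow> 'a \<Rightarrow> 'b::euclidean_space"
  assumes "prob_space P" "prob_space M" "finite I"
    and meas: "\<And>i. i \<in> I \<Longrightarrow> (\<lambda>(s, \<omega>). g i s \<omega>) \<in> borel_measurable (P \<Otimes>\<^sub>M M)"
    and bound: "\<And>i s \<omega>. i \<in> I \<Longrightarrow> norm (g i s \<omega>) \<le> B"
    and mean: "\<And>i \<omega>. i \<in> I \<Longrightarrow> \<omega> \<in> space M \<Longrightarrow> (\<integral>s. g i s \<omega> \<partial>P) = 0"
  shows "\<exists>xs. length xs = n \<and> set xs \<subseteq> space P \<and>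
    (\<Sum>i\<in>I. \<integral>\<omega>. (norm (\<Sum>s\<leftarrow>xs. g i s \<omega>))\<^sup>2 \<partial>M) \<le> real n * (real (card I) * B\<^sup>2)"
proof (induction n)
  case 0
  then show ?case by simp
next
  case (Suc n)
  interpret P: prob_space P by fact
  interpret M: prob_space M by fact
  interpret PM: pair_prob_space P M ..
  obtain xs where xs: "length xs = n" "set xs \<subseteq> space P"
    and le: "(\<Sum>i\<in>I. \<integral>\<omega>. (norm (\<Sum>s\<leftarrow>xs. g i s \<omega>))\<^sup>2 \<partial>M) \<le> real n * (real (card I) * B\<^sup>2)"
    using Suc.IH by blast
  define \<phi> where "\<phi> = (\<lambda>i \<omega>. \<Sum>s\<leftarrow>xs. g i s \<omega>)"
  have gm: "g i s \<in> borel_measurable M" if "i \<in> I" "s \<in> space P" for i s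
    using measurable_Pair2[OF meas[OF that(1)] that(2)] by simp
  have gm': "(\<lambda>s. g i s \<omega>) \<in> borel_measurable P" if "i \<in> I" "\<omega> \<in> space M" for i \<omega>
    using measurable_Pair1[OF meas[OF that(1)] that(2)] by simp
  have \<phi>m: "\<phi> i \<in> borel_measurable M" if "i \<in> I" for i
    using xs(2) unfolding \<phi>_def by (induction xs) (auto intro!: borel_measurable_add gm that)
  have \<phi>b: "norm (\<phi> i \<omega>) \<le> real n * B" if "i \<in> I" for i \<omega>
  proof -
    have "norm (\<Sum>s\<leftarrow>ys. g i s \<omega>) \<le> real (length ys) * B" for ys
    proof (induction ys)
      case (Cons s ys)
      then show ?case
        using norm_triangle_ineq[of "g i s \<omega>" "\<Sum>s\<leftarrow>ys. g i s \<omega>"] bound[OF that, of s \<omega>]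
        by (simp add: algebra_simps)
    qed simp
    from this[of xs] show ?thesis using xs by (simp add: \<phi>_def)
  qed
  define h where "h = (\<lambda>i s \<omega>. (norm (g i s \<omega> + \<phi> i \<omega>))\<^sup>2)"
  have hb: "norm (h i s \<omega>) \<le> (B + real n * B)\<^sup>2" if "i \<in> I" for i s \<omega>
    unfolding h_def using bound[OF that, of s \<omega>] \<phi>b[OF that, of \<omega>] norm_triangle_ineq[of "g i s \<omega>" "\<phi> i \<omega>"]
    by (auto intro!: power_mono)
  have hm: "(\<lambda>(s, \<omega>). h i s \<omega>) \<in> borel_measurable (P \<Otimes>\<^sub>M M)" if "i \<in> I" for i
  proof -
    have [measurable]: "(\<lambda>x. g i (fst x) (snd x)) \<in> borel_measurable (P \<Otimes>\<^sub>M M)" "\<phi> i \<in> borel_measurable M"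
      using meas[OF that] \<phi>m[OF that] by (auto simp: case_prod_beta)
    show ?thesis unfolding h_def case_prod_beta by measurable
  qed
  have hint: "integrable (P \<Otimes>\<^sub>M M) (\<lambda>(s, \<omega>). h i s \<omega>)" if "i \<in> I" for i
    using hb[OF that] by (intro PM.integrable_const_bound[of _ "(B + real n * B)\<^sup>2"] hm that) auto
  \<comment> \<open>The cross term has mean 0, so a random additional node raises the squared error
    by at most \<open>B\<^sup>2\<close> on average.\<close>
  have inner_avg: "(\<integral>s. h i s \<omega> \<partial>P) \<le> B\<^sup>2 + (norm (\<phi> i \<omega>))\<^sup>2" if "i \<in> I" "\<omega> \<in> space M" for i \<omega>
  proof -
    have gi: "integrable P (\<lambda>s. g i s \<omega>)"
      using bound[OF that(1)] by (intro P.integrable_const_bound[of _ B] gm' that) auto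
    have g2: "integrable P (\<lambda>s. (norm (g i s \<omega>))\<^sup>2)"
      using bound[OF that(1)] gm'[OF that]
      by (intro P.integrable_const_bound[of _ "B\<^sup>2"]) (auto intro!: power_mono)
    have "(\<integral>s. h i s \<omega> \<partial>P) = (\<integral>s. (norm (g i s \<omega>))\<^sup>2 + 2 * (g i s \<omega> \<bullet> \<phi> i \<omega>) + (norm (\<phi> i \<omega>))\<^sup>2 \<partial>P)"
      unfolding h_def by (intro Bochner_Integration.integral_cong)
        (auto simp: power2_norm_eq_inner inner_add_left inner_add_right inner_commute)
    also have "\<dots> = (\<integral>s. (norm (g i s \<omega>))\<^sup>2 \<partial>P) + 2 * ((\<integral>s. g i s \<omega> \<partial>P) \<bullet> \<phi> i \<omega>) + (norm (\<phi> i \<omega>))\<^sup>2"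
      using gi g2 by (simp add: P.prob_space)
    also have "\<dots> = (\<integral>s. (norm (g i s \<omega>))\<^sup>2 \<partial>P) + (norm (\<phi> i \<omega>))\<^sup>2"
      using mean[OF that] by simp
    also have "(\<integral>s. (norm (g i s \<omega>))\<^sup>2 \<partial>P) \<le> (\<integral>s. B\<^sup>2 \<partial>P)"
      using g2 bound[OF that(1)] by (intro integral_mono) (auto intro!: power_mono)
    finally show ?thesis by (simp add: P.prob_space)
  qed
  have \<phi>2: "integrable M (\<lambda>\<omega>. (norm (\<phi> i \<omega>))\<^sup>2)" if "i \<in> I" for i
    using \<phi>b[OF that] \<phi>m[OF that]
    by (intro M.integrable_const_bound[of _ "(real n * B)\<^sup>2"]) (auto intro!: power_mono)
  \<comment> \<open>All indices are added up before a node is chosen: one node has to serve every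
    \<open>i\<close> at once.\<close>
  define H where "H = (\<lambda>s. \<Sum>i\<in>I. \<integral>\<omega>. h i s \<omega> \<partial>M)"
  have Hint: "integrable P (\<lambda>s. \<integral>\<omega>. h i s \<omega> \<partial>M)" if "i \<in> I" for i
    using PM.integrable_fst[OF hint[OF that]] by simp
  have "(\<integral>s. H s \<partial>P) = (\<Sum>i\<in>I. \<integral>s. (\<integral>\<omega>. h i s \<omega> \<partial>M) \<partial>P)"
    unfolding H_def by (rule Bochner_Integration.integral_sum[OF Hint])
  also have "\<dots> = (\<Sum>i\<in>I. \<integral>\<omega>. (\<integral>s. h i s \<omega> \<partial>P) \<partial>M)"
    by (intro sum.cong refl PM.Fubini_integral[symmetric] hint)
  also have "\<dots> \<le> (\<Sum>i\<in>I. \<integral>\<omega>. B\<^sup>2 + (norm (\<phi> i \<omega>))\<^sup>2 \<partial>M)"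
    using PM.integrable_snd[OF hint] by (intro sum_mono integral_mono inner_avg) (auto intro!: \<phi>2)
  also have "\<dots> = (\<Sum>i\<in>I. B\<^sup>2 + (\<integral>\<omega>. (norm (\<phi> i \<omega>))\<^sup>2 \<partial>M))"
    by (intro sum.cong refl) (simp add: \<phi>2 M.prob_space)
  also have "\<dots> \<le> real (Suc n) * (real (card I) * B\<^sup>2)"
    using le by (simp add: sum.distrib \<phi>_def algebra_simps)
  finally have "(\<integral>s. H s \<partial>P) \<le> real (Suc n) * (real (card I) * B\<^sup>2)" .
  then obtain K where HK: "(\<integral>s. H s \<partial>P) \<le> K" and K: "K = real (Suc n) * (real (card I) * B\<^sup>2)" by blast
  \<comment> \<open>Some node does no worse than the average, since a function strictly above
    \<open>K\<close> everywhere would have integral above \<open>K\<close>.\<close>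
  have "\<exists>s\<in>space P. H s \<le> K"
  proof (rule ccontr)
    assume "\<not> ?thesis"
    then have *: "\<And>s. s \<in> space P \<Longrightarrow> K < H s" by force
    have "integrable P H" unfolding H_def by (intro Bochner_Integration.integrable_sum Hint)
    moreover have "emeasure P (space P) \<noteq> 0" by (simp add: P.emeasure_space_1)
    moreover have "AE s in P. K < H s" by (rule AE_I2) (rule *)
    ultimately have "(\<integral>s. K \<partial>P) < (\<integral>s. H s \<partial>P)"
      using P.integral_less_AE_space[of "\<lambda>_. K" H] by simp
    with HK show False by (simp add: P.prob_space)
  qed
  then obtain s where s: "s \<in> space P" "H s \<le> K" by blast
  show ?case
    using s xs unfolding K by (intro exI[of _ "s # xs"]) (simp add: H_def h_def \<phi>_def)
qed

text \<open>At nodes shared by \<open>Y\<close> and \<open>Y'\<close> the averages are functions of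
  finitely many coordinates and so have equal laws; their mean square distance to the integrals is
  of order 1/n. The terms \<open>q\<close> carry values at fixed times, such as the boundary terms
  of an integration by parts, jointly with the integrals.\<close>

lemma equal_laws_integral_bounded:
  fixes Y Y' :: "'s \<Rightarrow> 'a \<Rightarrow> 'b::euclidean_space" and f :: "'i \<Rightarrow> 's \<Rightarrow> 'b \<Rightarrow> 'c::euclidean_space"
  assumes "prob_space P" "prob_space M" "finite J" "finite F" "F \<subseteq> space P"
    and Y [measurable]: "(\<lambda>(s, \<omega>). Y s \<omega>) \<in> borel_measurable (P \<Otimes>\<^sub>M M)"
    and Y' [measurable]: "(\<lambda>(s, \<omega>). Y' s \<omega>) \<in> borel_measurable (P \<Otimes>\<^sub>M M)"
    and fidi: "\<And>G. finite G \<Longrightarrow> G \<subseteq> space P \<Longrightarrow> equal_laws M G Y Y'"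
    and f: "\<And>j. j \<in> J \<Longrightarrow> (\<lambda>(s, y). f j s y) \<in> borel_measurable (P \<Otimes>\<^sub>M borel)"
    and bound: "\<And>j s y. j \<in> J \<Longrightarrow> norm (f j s y) \<le> B"
    and q: "\<And>j. j \<in> J \<Longrightarrow> q j \<in> borel_measurable (\<Pi>\<^sub>M s\<in>F. borel)"
  shows "equal_laws M J (\<lambda>j \<omega>. q j (\<lambda>s\<in>F. Y s \<omega>) + (\<integral>s. f j s (Y s \<omega>) \<partial>P))
                        (\<lambda>j \<omega>. q j (\<lambda>s\<in>F. Y' s \<omega>) + (\<integral>s. f j s (Y' s \<omega>) \<partial>P))"
proof -
  interpret P: prob_space P by fact
  interpret M: prob_space M by fact
  define Z where "Z = (\<lambda>b::bool. if b then Y else Y')"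
  have Zm [measurable]: "(\<lambda>(s, \<omega>). Z b s \<omega>) \<in> borel_measurable (P \<Otimes>\<^sub>M M)" for b
    using Y Y' by (cases b) (auto simp: Z_def)
  have Zs: "Z b s \<in> borel_measurable M" if "s \<in> space P" for b s
    using measurable_Pair2[OF Zm[of b] that] by simp
  define A where "A = (\<lambda>b j \<omega>. \<integral>s. f j s (Z b s \<omega>) \<partial>P)"
  define g where "g = (\<lambda>(b, j) s \<omega>. f j s (Z b s \<omega>) - A b j \<omega>)"
  \<comment> \<open>The factor \<open>bool\<close> lists the two processes; it is what makes the
    quadrature nodes common to both.\<close>
  define I where "I = (UNIV :: bool set) \<times> J"
  have fZm: "(\<lambda>(s, \<omega>). f j s (Z b s \<omega>)) \<in> borel_measurable (P \<Otimes>\<^sub>M M)" if "j \<in> J" for b j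
  proof -
    have "(\<lambda>x. (fst x, Z b (fst x) (snd x))) \<in> measurable (P \<Otimes>\<^sub>M M) (P \<Otimes>\<^sub>M borel)"
      using Zm[of b] by (intro measurable_Pair) (auto simp: case_prod_beta)
    from measurable_compose[OF this f[OF that]] show ?thesis by (simp add: case_prod_beta)
  qed
  have Am: "A b j \<in> borel_measurable M" if "j \<in> J" for b j
  proof -
    have "(\<lambda>(\<omega>, s). f j s (Z b s \<omega>)) \<in> borel_measurable (M \<Otimes>\<^sub>M P)"
      using measurable_compose[OF measurable_pair_swap' fZm[OF that, of b]] by (simp add: case_prod_beta)
    then show ?thesis unfolding A_def by (rule P.borel_measurable_lebesgue_integral)
  qed
  have fZint: "integrable P (\<lambda>s. f j s (Z b s \<omega>))" if "j \<in> J" "\<omega> \<in> space M" for b j \<omega>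
    using bound[OF that(1)] measurable_Pair1[OF fZm[OF that(1)] that(2)]
    by (intro P.integrable_const_bound[of _ B]) auto
  \<comment> \<open>The bound is required for every \<open>\<omega>\<close>, also outside
    \<open>space M\<close>, where a section may fail to be integrable; its integral is then 0 by
    convention.\<close>
  have Ab: "norm (A b j \<omega>) \<le> B" if "j \<in> J" for b j \<omega>
  proof (cases "integrable P (\<lambda>s. f j s (Z b s \<omega>))")
    case True
    have "norm (A b j \<omega>) \<le> (\<integral>s. norm (f j s (Z b s \<omega>)) \<partial>P)"
      unfolding A_def by (rule integral_norm_bound)
    also have "\<dots> \<le> (\<integral>s. B \<partial>P)" using True bound[OF that] by (intro integral_mono) auto
    finally show ?thesis by (simp add: P.prob_space)
  next
    case False
    then show ?thesis using order_trans[OF norm_ge_zero bound[OF that]] by (simp add: A_def not_integrable_integral_eq)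
  qed
  have gm: "(\<lambda>(s, \<omega>). g i s \<omega>) \<in> borel_measurable (P \<Otimes>\<^sub>M M)" if iI: "i \<in> I" for i
  proof -
    obtain b j where i: "i = (b, j)" "j \<in> J" using iI unfolding I_def by (elim SigmaE)
    have [measurable]: "(\<lambda>x. f j (fst x) (Z b (fst x) (snd x))) \<in> borel_measurable (P \<Otimes>\<^sub>M M)" "A b j \<in> borel_measurable M"
      using fZm[OF i(2), of b] Am[OF i(2), of b] by (auto simp: case_prod_beta)
    show ?thesis unfolding g_def i(1) case_prod_beta fst_conv snd_conv by measurable
  qed
  have "\<exists>xs. length xs = n \<and> set xs \<subseteq> space P \<and>
    (\<Sum>i\<in>I. \<integral>\<omega>. (norm (\<Sum>s\<leftarrow>xs. g i s \<omega>))\<^sup>2 \<partial>M) \<le> real n * (real (card I) * (2 * B)\<^sup>2)" for n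
  proof (rule quadrature_nodes_exist[OF \<open>prob_space P\<close> \<open>prob_space M\<close> _ gm])
    show "finite I" using \<open>finite J\<close> by (simp add: I_def)
    fix i assume "i \<in> I"
    then obtain b j where i: "i = (b, j)" "j \<in> J" unfolding I_def by (elim SigmaE)
    show "norm (g i s \<omega>) \<le> 2 * B" for s \<omega>
      using norm_triangle_ineq4[of "f j s (Z b s \<omega>)" "A b j \<omega>"] bound[OF i(2), of s "Z b s \<omega>"] Ab[OF i(2), of b \<omega>]
      unfolding g_def i(1) by simp
    show "(\<integral>s. g i s \<omega> \<partial>P) = 0" if "\<omega> \<in> space M" for \<omega>
      using fZint[OF i(2) that, of b] unfolding g_def i(1) by (simp add: P.prob_space A_def)
  qed
  then obtain xs where len: "\<And>n. length (xs n) = n" and xsP: "\<And>n. set (xs n) \<subseteq> space P"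
    and xs: "\<And>n. (\<Sum>i\<in>I. \<integral>\<omega>. (norm (\<Sum>s\<leftarrow>xs n. g i s \<omega>))\<^sup>2 \<partial>M) \<le> real n * (real (card I) * (2 * B)\<^sup>2)"
    by metis
  \<comment> \<open>The summand 1 keeps \<open>K\<close> positive even if \<open>J\<close> is empty
    or \<open>B = 0\<close>; the mean square criterion needs a positive radius.\<close>
  define K where "K = real (card I) * (2 * B)\<^sup>2 + 1"
  have K: "K > 0" by (auto simp: K_def intro!: add_nonneg_pos)
  define Q where "Q = (\<lambda>b n j \<omega>. q j (\<lambda>s\<in>F. Z b s \<omega>) + (1 / real n) *\<^sub>R (\<Sum>s\<leftarrow>xs n. f j s (Z b s \<omega>)))"
  define Q' where "Q' = (\<lambda>b j \<omega>. q j (\<lambda>s\<in>F. Z b s \<omega>) + A b j \<omega>)"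
  have qm: "(\<lambda>\<omega>. q j (\<lambda>s\<in>F. Z b s \<omega>)) \<in> borel_measurable M" if "j \<in> J" for b j
    using q[OF that] \<open>F \<subseteq> space P\<close> by (intro measurable_compose[OF measurable_restrict q[OF that]] Zs) auto
  have sm: "(\<lambda>\<omega>. \<Sum>s\<leftarrow>ys. f j s (Z b s \<omega>)) \<in> borel_measurable M" if "j \<in> J" "set ys \<subseteq> space P" for b j ys
    using that(2) measurable_Pair2[OF fZm[OF that(1), of b]] by (induction ys) (auto intro!: borel_measurable_add)
  have Qm: "Q b n j \<in> borel_measurable M" if "j \<in> J" for b n j
    unfolding Q_def using qm[OF that] sm[OF that xsP] by (intro borel_measurable_add borel_measurable_scaleR) auto
  have Q'm: "Q' b j \<in> borel_measurable M" if "j \<in> J" for b j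
    unfolding Q'_def using qm[OF that] Am[OF that] by (intro borel_measurable_add) auto
  \<comment> \<open>The sequence runs over \<open>Suc n\<close> nodes, so that the weight is never
    \<open>1 / 0\<close>.\<close>
  have lim: "(\<lambda>n. \<integral>\<omega>. min 1 (dist (Q b (Suc n) j \<omega>) (Q' b j \<omega>)) \<partial>M) \<longlonglongrightarrow> 0" if "j \<in> J" for b j
  proof (rule tendsto_sandwich[OF _ _ tendsto_const])
    have "(\<integral>\<omega>. min 1 (dist (Q b (Suc n) j \<omega>) (Q' b j \<omega>)) \<partial>M) \<le> sqrt (K / real (Suc n))" for n
    proof (rule M.integral_min_dist_le_L2[OF Qm[OF that] Q'm[OF that]])
      have i: "(b, j) \<in> I" using that by (simp add: I_def)
      have diff: "Q b (Suc n) j \<omega> - Q' b j \<omega> = (1 / real (Suc n)) *\<^sub>R (\<Sum>s\<leftarrow>xs (Suc n). g (b, j) s \<omega>)" for \<omega>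
      proof -
        have "(\<Sum>s\<leftarrow>ys. g (b, j) s \<omega>) = (\<Sum>s\<leftarrow>ys. f j s (Z b s \<omega>)) - real (length ys) *\<^sub>R A b j \<omega>" for ys
          by (induction ys) (auto simp: g_def algebra_simps)
        from this[of "xs (Suc n)"] show ?thesis
          by (simp add: Q_def Q'_def len scaleR_right_diff_distrib del: of_nat_Suc)
      qed
      have gsm: "(\<lambda>\<omega>. \<Sum>s\<leftarrow>ys. g (b, j) s \<omega>) \<in> borel_measurable M" if "set ys \<subseteq> space P" for ys
        using that measurable_Pair2[OF gm[OF i]] by (induction ys) (auto intro!: borel_measurable_add)
      have eq: "(\<lambda>\<omega>. (norm (Q b (Suc n) j \<omega> - Q' b j \<omega>))\<^sup>2)
          = (\<lambda>\<omega>. (1 / real (Suc n))\<^sup>2 * (norm (\<Sum>s\<leftarrow>xs (Suc n). g (b, j) s \<omega>))\<^sup>2)"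
        unfolding diff by (simp add: power_mult_distrib power_divide)
      have gsb: "norm (\<Sum>s\<leftarrow>ys. g (b, j) s \<omega>) \<le> real (length ys) * (2 * B)" for ys \<omega>
      proof (induction ys)
        case (Cons s ys)
        have "norm (g (b, j) s \<omega>) \<le> 2 * B"
          using norm_triangle_ineq4[of "f j s (Z b s \<omega>)" "A b j \<omega>"] bound[OF that, of s "Z b s \<omega>"] Ab[OF that, of b \<omega>]
          unfolding g_def by simp
        then show ?case using Cons norm_triangle_ineq[of "g (b, j) s \<omega>" "\<Sum>s\<leftarrow>ys. g (b, j) s \<omega>"]
          by (simp add: algebra_simps)
      qed simp
      have "integrable M (\<lambda>\<omega>. (norm (\<Sum>s\<leftarrow>xs (Suc n). g (b, j) s \<omega>))\<^sup>2)"
        using gsb gsm[OF xsP]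
        by (intro M.integrable_const_bound[of _ "(real (length (xs (Suc n))) * (2 * B))\<^sup>2"])
          (auto simp del: of_nat_Suc intro!: power_mono)
      then show "integrable M (\<lambda>\<omega>. (norm (Q b (Suc n) j \<omega> - Q' b j \<omega>))\<^sup>2)"
        unfolding eq by (rule integrable_mult_right)
      have "(\<integral>\<omega>. (norm (Q b (Suc n) j \<omega> - Q' b j \<omega>))\<^sup>2 \<partial>M)
          = (1 / real (Suc n))\<^sup>2 * (\<integral>\<omega>. (norm (\<Sum>s\<leftarrow>xs (Suc n). g (b, j) s \<omega>))\<^sup>2 \<partial>M)"
        unfolding eq by simp
      also have "(\<integral>\<omega>. (norm (\<Sum>s\<leftarrow>xs (Suc n). g (b, j) s \<omega>))\<^sup>2 \<partial>M)
          \<le> (\<Sum>i\<in>I. \<integral>\<omega>. (norm (\<Sum>s\<leftarrow>xs (Suc n). g i s \<omega>))\<^sup>2 \<partial>M)"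
        using \<open>finite J\<close> by (intro member_le_sum[OF i]) (auto simp: I_def)
      also have "\<dots> \<le> real (Suc n) * K"
        by (rule order_trans[OF xs]) (auto simp: K_def algebra_simps simp del: of_nat_Suc)
      finally have "(\<integral>\<omega>. (norm (Q b (Suc n) j \<omega> - Q' b j \<omega>))\<^sup>2 \<partial>M) \<le> (1 / real (Suc n))\<^sup>2 * (real (Suc n) * K)"
        by (auto simp: mult_left_mono)
      also have "\<dots> = K / real (Suc n)" by (simp add: power2_eq_square)
      finally show "(\<integral>\<omega>. (norm (Q b (Suc n) j \<omega> - Q' b j \<omega>))\<^sup>2 \<partial>M) \<le> (sqrt (K / real (Suc n)))\<^sup>2"
        using K by simp
      show "sqrt (K / real (Suc n)) > 0" using K by simp
    qed
    then show "\<forall>\<^sub>F n in sequentially. (\<integral>\<omega>. min 1 (dist (Q b (Suc n) j \<omega>) (Q' b j \<omega>)) \<partial>M) \<le> sqrt (K / real (Suc n))"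
      by simp
    show "(\<lambda>n. sqrt (K / real (Suc n))) \<longlonglongrightarrow> 0"
      using tendsto_real_sqrt[OF tendsto_mult_right_zero[OF LIMSEQ_inverse_real_of_nat, of K]] by (simp add: divide_inverse)
  qed auto
  have eqn: "equal_laws M J (Q True n) (Q False n)" for n
  proof -
    define G where "G = F \<union> set (xs n)"
    have G: "finite G" "G \<subseteq> space P" "F \<subseteq> G" "set (xs n) \<subseteq> G"
      using \<open>finite F\<close> \<open>F \<subseteq> space P\<close> xsP by (auto simp: G_def)
    define r where "r = (\<lambda>j y. q j (restrict y F) + (1 / real n) *\<^sub>R (\<Sum>s\<leftarrow>xs n. f j s (y s)))"
    have rm: "r j \<in> borel_measurable (\<Pi>\<^sub>M s\<in>G. borel)" if "j \<in> J" for j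
    proof -
      have "(\<lambda>y. \<Sum>s\<leftarrow>ys. f j s (y s)) \<in> borel_measurable (\<Pi>\<^sub>M s\<in>G. borel)" if "set ys \<subseteq> G" for ys
        using that
      proof (induction ys)
        case (Cons s ys)
        have "(\<lambda>y. f j s (y s)) \<in> borel_measurable (\<Pi>\<^sub>M s\<in>G. borel)"
        proof (rule measurable_compose[of "\<lambda>y. y s" _ borel "f j s"])
          show "(\<lambda>y. y s) \<in> measurable (\<Pi>\<^sub>M s\<in>G. borel) borel"
            using Cons.prems by (intro measurable_component_singleton) auto
          have "s \<in> G" using Cons.prems by simp
          then have "s \<in> space P" by (rule subsetD[OF G(2)])
          from measurable_Pair2[OF f[OF \<open>j \<in> J\<close>] this] show "f j s \<in> borel_measurable borel" by simp
        qed
        then show ?case using Cons by (auto intro!: borel_measurable_add)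
      qed simp
      moreover have "(\<lambda>y. q j (restrict y F)) \<in> borel_measurable (\<Pi>\<^sub>M s\<in>G. borel)"
        by (rule measurable_compose[OF measurable_restrict_subset[OF G(3)] q[OF that]])
      ultimately show ?thesis using G(4) unfolding r_def
        by (intro borel_measurable_add borel_measurable_scaleR) auto
    qed
    have Qr: "Q b n = (\<lambda>j \<omega>. r j (\<lambda>s\<in>G. Z b s \<omega>))" for b
    proof (intro ext)
      fix j \<omega>
      have 1: "restrict (\<lambda>s\<in>G. Z b s \<omega>) F = (\<lambda>s\<in>F. Z b s \<omega>)" using G(3) by (auto simp: restrict_def fun_eq_iff)
      have 2: "map (\<lambda>s. f j s ((\<lambda>s\<in>G. Z b s \<omega>) s)) (xs n) = map (\<lambda>s. f j s (Z b s \<omega>)) (xs n)"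
        using G(4) by auto
      show "Q b n j \<omega> = r j (\<lambda>s\<in>G. Z b s \<omega>)" unfolding Q_def r_def 1 2 by (rule refl)
    qed
    have "equal_laws M G (Z True) (Z False)" using fidi[OF G(1,2)] by (simp add: Z_def)
    from equal_laws_map[OF this, where f=r and J=J] show ?thesis
      unfolding Qr using Zs[OF subsetD[OF G(2)]] rm by blast
  qed
  have "equal_laws M J (Q' True) (Q' False)"
    by (rule equal_laws_limit[OF \<open>prob_space M\<close> \<open>finite J\<close>, where X="\<lambda>n. Q True (Suc n)"
          and Y="\<lambda>n. Q False (Suc n)" and X'="Q' True" and Y'="Q' False"])
      (simp_all only: Qm Q'm lim eqn)
  then show ?thesis by (simp add: Q'_def A_def Z_def)
qed

section \<open>Integrals over compact time intervals\<close>

lemma integral_uniform_measure_Icc: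
  fixes f :: "real \<Rightarrow> 'b::{banach, second_countable_topology}"
  assumes "a < T" and [measurable]: "f \<in> borel_measurable borel"
  shows "(\<integral>s. f s \<partial>uniform_measure lborel {a..T}) = (1 / (T - a)) *\<^sub>R (\<integral>s. indicator {a..T} s *\<^sub>R f s \<partial>lborel)"
proof -
  have "indicator {a..T} s / emeasure lborel {a..T} = ennreal (indicator {a..T} s / (T - a))" for s
    using assms(1) by (auto simp: indicator_def ennreal_1[symmetric] divide_ennreal simp del: ennreal_1)
  then have "uniform_measure lborel {a..T} = density lborel (\<lambda>s. ennreal (indicator {a..T} s / (T - a)))"
    unfolding uniform_measure_def by simp
  then have "(\<integral>s. f s \<partial>uniform_measure lborel {a..T}) = (\<integral>s. (indicator {a..T} s / (T - a)) *\<^sub>R f s \<partial>lborel)"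
    using assms(1) by (simp only:) (subst integral_density, auto)
  also have "\<dots> = (\<integral>s. (1 / (T - a)) *\<^sub>R (indicator {a..T} s *\<^sub>R f s) \<partial>lborel)"
    by (intro Bochner_Integration.integral_cong) auto
  also have "\<dots> = (1 / (T - a)) *\<^sub>R (\<integral>s. indicator {a..T} s *\<^sub>R f s \<partial>lborel)"
    by (rule integral_scaleR_right)
  finally show ?thesis .
qed

lemma borel_measurable_set_integral_process:
  fixes Y :: "real \<Rightarrow> 'a \<Rightarrow> 'b::euclidean_space" and f :: "real \<Rightarrow> 'b \<Rightarrow> 'c::euclidean_space"
  assumes Y: "(\<lambda>(s, \<omega>). Y s \<omega>) \<in> borel_measurable (borel \<Otimes>\<^sub>M M)"
    and f: "(\<lambda>(s, y). f s y) \<in> borel_measurable (borel \<Otimes>\<^sub>M borel)"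
  shows "(\<lambda>\<omega>. LINT s:{a..b}|lborel. f s (Y s \<omega>)) \<in> borel_measurable M"
proof -
  have 1: "(\<lambda>x. Y (snd x) (fst x)) \<in> borel_measurable (M \<Otimes>\<^sub>M lborel)"
  proof -
    have "(\<lambda>x. (snd x, fst x)) \<in> measurable (M \<Otimes>\<^sub>M lborel) (borel \<Otimes>\<^sub>M M)"
      by measurable
    from measurable_compose[OF this Y] show ?thesis by simp
  qed
  have "(\<lambda>x. (snd x, Y (snd x) (fst x))) \<in> measurable (M \<Otimes>\<^sub>M lborel) (borel \<Otimes>\<^sub>M borel)"
    using 1 by measurable
  from measurable_compose[OF this f]
  have [measurable]: "(\<lambda>x. f (snd x) (Y (snd x) (fst x))) \<in> borel_measurable (M \<Otimes>\<^sub>M lborel)" by simp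
  have "(\<lambda>(\<omega>, s). indicator {a..b} s *\<^sub>R f s (Y s \<omega>)) \<in> borel_measurable (M \<Otimes>\<^sub>M lborel)"
    unfolding case_prod_beta by measurable
  then show ?thesis
    unfolding set_lebesgue_integral_def by (rule lborel.borel_measurable_lebesgue_integral)
qed

text \<open>Truncation removes the boundedness condition, and only pathwise integrability is asked
  for, since the limit is taken path by path and then in probability. Indicators bring the different
  upper limits \<open>b j\<close> into one interval.\<close>

lemma equal_laws_set_integral:
  fixes Y Y' :: "real \<Rightarrow> 'a \<Rightarrow> 'b::euclidean_space" and f :: "'i \<Rightarrow> real \<Rightarrow> 'b \<Rightarrow> 'c::euclidean_space"
  assumes "prob_space M" "finite J" "finite F"
    and Y: "(\<lambda>(s, \<omega>). Y s \<omega>) \<in> borel_measurable (borel \<Otimes>\<^sub>M M)"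
    and Y': "(\<lambda>(s, \<omega>). Y' s \<omega>) \<in> borel_measurable (borel \<Otimes>\<^sub>M M)"
    and fidi: "\<And>G. finite G \<Longrightarrow> equal_laws M G Y Y'"
    and f: "\<And>j. j \<in> J \<Longrightarrow> (\<lambda>(s, y). f j s y) \<in> borel_measurable (borel \<Otimes>\<^sub>M borel)"
    and "a < T" and bT: "\<And>j. j \<in> J \<Longrightarrow> b j \<le> T"
    and int: "\<And>j. j \<in> J \<Longrightarrow> AE \<omega> in M. set_integrable lborel {a..b j} (\<lambda>s. f j s (Y s \<omega>))"
      "\<And>j. j \<in> J \<Longrightarrow> AE \<omega> in M. set_integrable lborel {a..b j} (\<lambda>s. f j s (Y' s \<omega>))"
    and q: "\<And>j. j \<in> J \<Longrightarrow> q j \<in> borel_measurable (\<Pi>\<^sub>M s\<in>F. borel)"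
  shows "equal_laws M J (\<lambda>j \<omega>. q j (\<lambda>s\<in>F. Y s \<omega>) - (LINT s:{a..b j}|lborel. f j s (Y s \<omega>)))
                        (\<lambda>j \<omega>. q j (\<lambda>s\<in>F. Y' s \<omega>) - (LINT s:{a..b j}|lborel. f j s (Y' s \<omega>)))"
proof -
  interpret prob_space M by fact
  define P where "P = uniform_measure lborel {a..T}"
  have P: "prob_space P" unfolding P_def using \<open>a < T\<close> by (intro prob_space_uniform_measure) auto
  have spP: "sets P = sets borel" "space P = UNIV" by (simp_all add: P_def)
  have PN: "borel_measurable (P \<Otimes>\<^sub>M N) = borel_measurable (borel \<Otimes>\<^sub>M N)" for N :: "'x measure"
    by (intro measurable_cong_sets sets_pair_measure_cong spP refl)
  \<comment> \<open>Values of large norm are set to 0, so \<open>norm (tr n z) \<le> norm z\<close>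
    and the untruncated integrand itself dominates.\<close>
  define tr where "tr = (\<lambda>(n::nat) z::'c. if norm z \<le> real n then z else 0)"
  have [measurable]: "tr n \<in> borel_measurable borel" for n unfolding tr_def by measurable
  have tr: "norm (tr n z) \<le> norm z" "norm (tr n z) \<le> real n" for n z by (auto simp: tr_def)
  have trlim: "(\<lambda>n. tr n z) \<longlonglongrightarrow> z" for z
  proof (rule tendsto_eventually)
    show "\<forall>\<^sub>F n in sequentially. tr n z = z"
      using eventually_ge_at_top[of "nat \<lceil>norm z\<rceil>"] by eventually_elim (auto simp: tr_def nat_ceiling_le_eq)
  qed
  \<comment> \<open>The factor \<open>- (T - a)\<close> undoes the normalisation of the uniform law
    and supplies the minus sign of the integration by parts.\<close>
  define g where "g = (\<lambda>n j s y. (- (T - a) * indicator {a..b j} s) *\<^sub>R tr n (f j s y))"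
  have gm: "(\<lambda>(s, y). g n j s y) \<in> borel_measurable (borel \<Otimes>\<^sub>M borel)" if "j \<in> J" for n j
  proof -
    have [measurable]: "(\<lambda>x. f j (fst x) (snd x)) \<in> borel_measurable (borel \<Otimes>\<^sub>M borel)"
      using f[OF that] by (simp add: case_prod_beta)
    show ?thesis unfolding g_def case_prod_beta by measurable
  qed
  have gb: "norm (g n j s y) \<le> (T - a) * real n" for n j s y
  proof -
    have "norm (g n j s y) = (T - a) * indicator {a..b j} s * norm (tr n (f j s y))"
      using \<open>a < T\<close> by (simp add: g_def abs_mult)
    also have "\<dots> \<le> (T - a) * 1 * real n"
      using \<open>a < T\<close> tr(2)[of n "f j s y"] by (intro mult_mono) (auto simp: indicator_def)
    finally show ?thesis by simp
  qed
  define W where "W = (\<lambda>(Z :: real \<Rightarrow> 'a \<Rightarrow> 'b) n j \<omega>. q j (\<lambda>s\<in>F. Z s \<omega>) + (\<integral>s. g n j s (Z s \<omega>) \<partial>P))"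
  define W' where "W' = (\<lambda>(Z :: real \<Rightarrow> 'a \<Rightarrow> 'b) j \<omega>. q j (\<lambda>s\<in>F. Z s \<omega>) - (LINT s:{a..b j}|lborel. f j s (Z s \<omega>)))"
  have eqn: "equal_laws M J (W Y n) (W Y' n)" for n
    unfolding W_def
    by (rule equal_laws_integral_bounded[OF P \<open>prob_space M\<close> \<open>finite J\<close> \<open>finite F\<close>, where Y=Y and Y'=Y'
          and f="g n" and q=q and B="(T - a) * real n"])
      (simp_all only: spP PN Y Y' fidi q gb gm subset_UNIV)
  have Zs: "Z s \<in> borel_measurable M" if "(\<lambda>(s, \<omega>). Z s \<omega>) \<in> borel_measurable (borel \<Otimes>\<^sub>M M)" for s and Z :: "real \<Rightarrow> 'a \<Rightarrow> 'b"
    using measurable_Pair2[OF that, of s] by simp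
  have Fm: "(\<lambda>\<omega>. \<lambda>s\<in>F. Z s \<omega>) \<in> measurable M (\<Pi>\<^sub>M s\<in>F. borel)"
    if "(\<lambda>(s, \<omega>). Z s \<omega>) \<in> borel_measurable (borel \<Otimes>\<^sub>M M)" for Z :: "real \<Rightarrow> 'a \<Rightarrow> 'b"
    by (intro measurable_restrict Zs[OF that])
  have W'm: "W' Z j \<in> borel_measurable M"
    if "j \<in> J" "(\<lambda>(s, \<omega>). Z s \<omega>) \<in> borel_measurable (borel \<Otimes>\<^sub>M M)" for Z j
    unfolding W'_def
    by (intro borel_measurable_diff measurable_compose[OF Fm[OF that(2)] q[OF that(1)]]
        borel_measurable_set_integral_process[OF that(2) f[OF that(1)]])
  have fs: "(\<lambda>s. f j s (Z s \<omega>)) \<in> borel_measurable borel"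
    if "j \<in> J" "(\<lambda>(s, \<omega>). Z s \<omega>) \<in> borel_measurable (borel \<Otimes>\<^sub>M M)" "\<omega> \<in> space M" for Z j \<omega>
  proof -
    have "(\<lambda>s. Z s \<omega>) \<in> borel_measurable borel"
      using measurable_Pair1[OF that(2,3)] by simp
    then have "(\<lambda>s. (s, Z s \<omega>)) \<in> measurable borel (borel \<Otimes>\<^sub>M borel)" by measurable
    from measurable_compose[OF this f[OF that(1)]] show ?thesis by simp
  qed
  have Weq: "W Z n j \<omega> = q j (\<lambda>s\<in>F. Z s \<omega>) - (LINT s:{a..b j}|lborel. tr n (f j s (Z s \<omega>)))"
    if "j \<in> J" "(\<lambda>(s, \<omega>). Z s \<omega>) \<in> borel_measurable (borel \<Otimes>\<^sub>M M)" "\<omega> \<in> space M" for Z n j \<omega>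
  proof -
    have [measurable]: "(\<lambda>s. f j s (Z s \<omega>)) \<in> borel_measurable borel" by (rule fs[OF that])
    have "(\<integral>s. g n j s (Z s \<omega>) \<partial>P) = (1 / (T - a)) *\<^sub>R (\<integral>s. indicator {a..T} s *\<^sub>R g n j s (Z s \<omega>) \<partial>lborel)"
      unfolding P_def by (rule integral_uniform_measure_Icc[OF \<open>a < T\<close>]) (unfold g_def, measurable)
    also have "(\<integral>s. indicator {a..T} s *\<^sub>R g n j s (Z s \<omega>) \<partial>lborel)
        = (\<integral>s. (- (T - a)) *\<^sub>R (indicator {a..b j} s *\<^sub>R tr n (f j s (Z s \<omega>))) \<partial>lborel)"
      using bT[OF that(1)] by (intro Bochner_Integration.integral_cong) (auto simp: g_def indicator_def)
    also have "\<dots> = (- (T - a)) *\<^sub>R (LINT s:{a..b j}|lborel. tr n (f j s (Z s \<omega>)))"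
      unfolding set_lebesgue_integral_def by (rule integral_scaleR_right)
    also have "(1 / (T - a)) *\<^sub>R (- (T - a)) *\<^sub>R (LINT s:{a..b j}|lborel. tr n (f j s (Z s \<omega>)))
        = - (LINT s:{a..b j}|lborel. tr n (f j s (Z s \<omega>)))"
    proof -
      have "(1 / (T - a)) * (- (T - a)) = - 1" using \<open>a < T\<close> by (simp add: field_simps)
      then show ?thesis by (simp only: scaleR_scaleR scaleR_minus1_left)
    qed
    finally have eq: "(\<integral>s. g n j s (Z s \<omega>) \<partial>P) = - (LINT s:{a..b j}|lborel. tr n (f j s (Z s \<omega>)))" .
    show ?thesis unfolding W_def eq by (rule add_uminus_conv_diff)
  qed
  have Wm: "W Z n j \<in> borel_measurable M"
    if "j \<in> J" "(\<lambda>(s, \<omega>). Z s \<omega>) \<in> borel_measurable (borel \<Otimes>\<^sub>M M)" for Z n j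
  proof -
    have [measurable]: "(\<lambda>x. f j (fst x) (snd x)) \<in> borel_measurable (borel \<Otimes>\<^sub>M borel)"
      using f[OF that(1)] by (simp add: case_prod_beta)
    have "(\<lambda>(s, y). tr n (f j s y)) \<in> borel_measurable (borel \<Otimes>\<^sub>M borel)"
      unfolding case_prod_beta by measurable
    then have "(\<lambda>\<omega>. q j (\<lambda>s\<in>F. Z s \<omega>) - (LINT s:{a..b j}|lborel. tr n (f j s (Z s \<omega>)))) \<in> borel_measurable M"
      by (intro borel_measurable_diff measurable_compose[OF Fm[OF that(2)] q[OF that(1)]]
          borel_measurable_set_integral_process[OF that(2)])
    then show ?thesis
      by (rule measurable_cong[THEN iffD1, rotated]) (simp add: Weq[OF that])
  qed
  have lim: "(\<lambda>n. \<integral>\<omega>. min 1 (dist (W Z n j \<omega>) (W' Z j \<omega>)) \<partial>M) \<longlonglongrightarrow> 0"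
    if j: "j \<in> J" and Z: "(\<lambda>(s, \<omega>). Z s \<omega>) \<in> borel_measurable (borel \<Otimes>\<^sub>M M)"
      and int: "AE \<omega> in M. set_integrable lborel {a..b j} (\<lambda>s. f j s (Z s \<omega>))" for Z j
  proof (rule integral_min_dist_tendsto_0_AE[OF Wm[OF j Z] W'm[OF j Z]])
    show "AE \<omega> in M. (\<lambda>n. W Z n j \<omega>) \<longlonglongrightarrow> W' Z j \<omega>"
      using int AE_space
    proof eventually_elim
      case (elim \<omega>)
      have [measurable]: "(\<lambda>s. f j s (Z s \<omega>)) \<in> borel_measurable borel" by (rule fs[OF j Z elim(2)])
      have "(\<lambda>n. LINT s:{a..b j}|lborel. tr n (f j s (Z s \<omega>))) \<longlonglongrightarrow> (LINT s:{a..b j}|lborel. f j s (Z s \<omega>))"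
        unfolding set_lebesgue_integral_def
      proof (rule integral_dominated_convergence[where w="\<lambda>s. norm (indicator {a..b j} s *\<^sub>R f j s (Z s \<omega>))"])
        show "integrable lborel (\<lambda>s. norm (indicator {a..b j} s *\<^sub>R f j s (Z s \<omega>)))"
          using elim(1) unfolding set_integrable_def by (rule integrable_norm)
        show "AE s in lborel. (\<lambda>n. indicator {a..b j} s *\<^sub>R tr n (f j s (Z s \<omega>))) \<longlonglongrightarrow> indicator {a..b j} s *\<^sub>R f j s (Z s \<omega>)"
          by (intro AE_I2 tendsto_scaleR tendsto_const trlim)
        show "AE s in lborel. norm (indicator {a..b j} s *\<^sub>R tr n (f j s (Z s \<omega>)))
            \<le> norm (indicator {a..b j} s *\<^sub>R f j s (Z s \<omega>))" for n
          using tr(1) by (intro AE_I2) (auto simp: indicator_def)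
      qed measurable
      then show ?case
        unfolding Weq[OF j Z elim(2)] W'_def by (intro tendsto_diff tendsto_const)
    qed
  qed
  have "equal_laws M J (W' Y) (W' Y')"
    by (rule equal_laws_limit[OF \<open>prob_space M\<close> \<open>finite J\<close>, where X="W Y" and Y="W Y'" and X'="W' Y" and Y'="W' Y'"])
      (simp_all only: Wm W'm Y Y' eqn lim int)
  then show ?thesis unfolding W'_def .
qed

section \<open>The stationary solution\<close>

lemma matrix_exp_kernel_shift:
  fixes \<Lambda> :: "real^'m^'m"
  shows "matrix_exp (u *\<^sub>R \<Lambda>) *v ((\<Lambda> ** matrix_exp (v *\<^sub>R \<Lambda>)) *v x) = (\<Lambda> ** matrix_exp ((u + v) *\<^sub>R \<Lambda>)) *v x"
  by (simp add: matrix_vector_mul_assoc matrix_mul_assoc matrix_exp_commute matrix_exp_add)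

lemma continuous_on_kernel:
  fixes \<Lambda> :: "real^'m^'m"
  shows "continuous_on S (\<lambda>s. \<Lambda> ** matrix_exp (- (t - s) *\<^sub>R \<Lambda>))"
  by (intro bounded_bilinear.continuous_on[OF bounded_bilinear_matrix_matrix_mult] continuous_on_const
      continuous_on_compose2[OF continuous_on_matrix_exp[of UNIV]] continuous_intros) auto

text \<open>The kernel is the derivative in \<open>s\<close> of
  \<open>matrix_exp (- (t - s) *\<^sub>R \<Lambda>)\<close>, so a constant integrator has kernel
  integral 0. This permits subtracting \<open>D h\<close> from the process.\<close>

lemma kernel_integral_const:
  fixes \<Lambda> :: "real^'m^'m" and x :: "real^'m"
  shows "set_integrable lborel {a..t} (\<lambda>s. (\<Lambda> ** matrix_exp (- (t - s) *\<^sub>R \<Lambda>)) *v x)"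
    and "a \<le> t \<Longrightarrow> (LINT s:{a..t}|lborel. (\<Lambda> ** matrix_exp (- (t - s) *\<^sub>R \<Lambda>)) *v x) = x - matrix_exp (- (t - a) *\<^sub>R \<Lambda>) *v x"
proof -
  have cont: "continuous_on {a..t} (\<lambda>s. (\<Lambda> ** matrix_exp (- (t - s) *\<^sub>R \<Lambda>)) *v x)"
    by (intro bounded_bilinear.continuous_on[OF bounded_bilinear_matrix_vector_mult] continuous_on_const continuous_on_kernel)
  show "set_integrable lborel {a..t} (\<lambda>s. (\<Lambda> ** matrix_exp (- (t - s) *\<^sub>R \<Lambda>)) *v x)"
    by (rule borel_integrable_atLeastAtMost'[OF cont])
  assume "a \<le> t"
  have d: "((\<lambda>s. matrix_exp (- (t - s) *\<^sub>R \<Lambda>) *v x) has_vector_derivative (\<Lambda> ** matrix_exp (- (t - s) *\<^sub>R \<Lambda>)) *v x)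
      (at s within {a..t})" for s
  proof -
    have "((\<lambda>s. - (t - s)) has_vector_derivative 1) (at s)"
      by (auto intro!: derivative_eq_intros simp: has_real_derivative_iff_has_vector_derivative[symmetric])
    from vector_diff_chain_at[OF this matrix_exp_has_vector_derivative[of \<Lambda>]]
    have "((\<lambda>s. matrix_exp (- (t - s) *\<^sub>R \<Lambda>)) has_vector_derivative \<Lambda> ** matrix_exp (- (t - s) *\<^sub>R \<Lambda>)) (at s)"
      by (simp add: o_def)
    from bounded_linear.has_vector_derivative[OF
        bounded_bilinear.bounded_linear_left[OF bounded_bilinear_matrix_vector_mult, of x] this]
    show ?thesis by (rule has_vector_derivative_at_within)
  qed
  from integral_FTC_atLeastAtMost[OF \<open>a \<le> t\<close> d cont]
  show "(LINT s:{a..t}|lborel. (\<Lambda> ** matrix_exp (- (t - s) *\<^sub>R \<Lambda>)) *v x) = x - matrix_exp (- (t - a) *\<^sub>R \<Lambda>) *v x"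
    by (simp add: set_lebesgue_integral_def)
qed

text \<open>Stationarity is assumed for increments only, so the integral over the shifted window is
  rewritten in terms of \<open>D (s + h) - D h\<close>: substitute \<open>s + h\<close> and subtract
  the constant \<open>D h\<close>.\<close>

lemma kernel_integral_increments:
  fixes \<Lambda> :: "real^'m^'m"
  assumes "a \<le> t"
    and int: "set_integrable lborel {a + h..t + h} (\<lambda>s. (\<Lambda> ** matrix_exp (- (t + h - s) *\<^sub>R \<Lambda>)) *v D s \<omega>)"
  shows "set_integrable lborel {a..t} (\<lambda>s. (\<Lambda> ** matrix_exp (- (t - s) *\<^sub>R \<Lambda>)) *v (D (s + h) \<omega> - D h \<omega>))"
    and "kernel_integral \<Lambda> D (a + h) (t + h) \<omega> =
      (D (t + h) \<omega> - D h \<omega>) - matrix_exp (- (t - a) *\<^sub>R \<Lambda>) *v (D (a + h) \<omega> - D h \<omega>)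
      - (LINT s:{a..t}|lborel. (\<Lambda> ** matrix_exp (- (t - s) *\<^sub>R \<Lambda>)) *v (D (s + h) \<omega> - D h \<omega>))"
proof -
  define k where "k = (\<lambda>s. (\<Lambda> ** matrix_exp (- (t + h - s) *\<^sub>R \<Lambda>)) *v D s \<omega>)"
  \<comment> \<open>The shape \<open>h + 1 * s\<close> is the one in which the affine change of
    variables delivers the argument.\<close>
  have ind: "indicat_real {a + h..t + h} (h + 1 * s) *\<^sub>R k (h + 1 * s)
      = indicator {a..t} s *\<^sub>R ((\<Lambda> ** matrix_exp (- (t - s) *\<^sub>R \<Lambda>)) *v D (s + h) \<omega>)" for s
    by (auto simp: indicator_def k_def add.commute)
  have i1: "set_integrable lborel {a..t} (\<lambda>s. (\<Lambda> ** matrix_exp (- (t - s) *\<^sub>R \<Lambda>)) *v D (s + h) \<omega>)"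
    using lborel_integrable_real_affine[of "\<lambda>s. indicator {a + h..t + h} s *\<^sub>R k s" 1 h] int
    unfolding set_integrable_def ind k_def[symmetric] by simp
  have e1: "(LINT s:{a + h..t + h}|lborel. k s) = (LINT s:{a..t}|lborel. (\<Lambda> ** matrix_exp (- (t - s) *\<^sub>R \<Lambda>)) *v D (s + h) \<omega>)"
    using lborel_integral_real_affine[of 1 "\<lambda>s. indicator {a + h..t + h} s *\<^sub>R k s" h]
    unfolding set_lebesgue_integral_def ind by simp
  note i2 = kernel_integral_const(1)[of a t \<Lambda> "D h \<omega>"]
  show "set_integrable lborel {a..t} (\<lambda>s. (\<Lambda> ** matrix_exp (- (t - s) *\<^sub>R \<Lambda>)) *v (D (s + h) \<omega> - D h \<omega>))"
    using set_integral_diff(1)[OF i1 i2] by (simp only: matrix_vector_mult_diff_distrib)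
  have "(LINT s:{a..t}|lborel. (\<Lambda> ** matrix_exp (- (t - s) *\<^sub>R \<Lambda>)) *v (D (s + h) \<omega> - D h \<omega>))
      = (LINT s:{a + h..t + h}|lborel. k s) - (D h \<omega> - matrix_exp (- (t - a) *\<^sub>R \<Lambda>) *v D h \<omega>)"
    using set_integral_diff(2)[OF i1 i2] kernel_integral_const(2)[OF \<open>a \<le> t\<close>, of \<Lambda> "D h \<omega>"]
    by (simp only: matrix_vector_mult_diff_distrib e1)
  then show "kernel_integral \<Lambda> D (a + h) (t + h) \<omega> =
      (D (t + h) \<omega> - D h \<omega>) - matrix_exp (- (t - a) *\<^sub>R \<Lambda>) *v (D (a + h) \<omega> - D h \<omega>)
      - (LINT s:{a..t}|lborel. (\<Lambda> ** matrix_exp (- (t - s) *\<^sub>R \<Lambda>)) *v (D (s + h) \<omega> - D h \<omega>))"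
    by (simp add: kernel_integral_def k_def matrix_vector_mult_diff_distrib)
qed

text \<open>The semigroup law pulls \<open>matrix_exp (- t *\<^sub>R \<Lambda>)\<close> out of the
  integral over \<open>{a..0}\<close>; the boundary terms at time 0 cancel.\<close>

lemma kernel_integral_split:
  fixes \<Lambda> :: "real^'m^'m"
  assumes "a \<le> 0" "0 \<le> t"
    and int: "set_integrable lborel {a..t} (\<lambda>s. (\<Lambda> ** matrix_exp (- (t - s) *\<^sub>R \<Lambda>)) *v D s \<omega>)"
    and int0: "set_integrable lborel {a..0} (\<lambda>s. (\<Lambda> ** matrix_exp (- (0 - s) *\<^sub>R \<Lambda>)) *v D s \<omega>)"
  shows "kernel_integral \<Lambda> D a t \<omega> = kernel_integral \<Lambda> D 0 t \<omega> + matrix_exp (- t *\<^sub>R \<Lambda>) *v kernel_integral \<Lambda> D a 0 \<omega>"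
proof -
  let ?k = "\<lambda>t s. (\<Lambda> ** matrix_exp (- (t - s) *\<^sub>R \<Lambda>)) *v D s \<omega>"
  have bl: "bounded_linear (\<lambda>x. matrix_exp (- t *\<^sub>R \<Lambda>) *v x)" by (rule matrix_vector_mul_bounded_linear)
  have split: "{a..t} = {a..0} \<union> {0..t}" using assms(1,2) by auto
  have "(LINT s:{a..t}|lborel. ?k t s) = (LINT s:{a..0}|lborel. ?k t s) + (LINT s:{0..t}|lborel. ?k t s)"
    unfolding split
  proof (rule set_integral_Un_AE)
    \<comment> \<open>The two closed intervals share the point 0, a null set.\<close>
    show "AE x in lborel. \<not> (x \<in> {a..0} \<and> x \<in> {0..t})"
      using AE_lborel_singleton[of "0::real"] by eventually_elim auto
    show "set_integrable lborel {a..0} (?k t)" "set_integrable lborel {0..t} (?k t)"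
      using set_integrable_subset[OF int] assms(1,2) by auto
  qed auto
  also have "(LINT s:{a..0}|lborel. ?k t s) = (LINT s:{a..0}|lborel. matrix_exp (- t *\<^sub>R \<Lambda>) *v ?k 0 s)"
    by (simp only: matrix_exp_kernel_shift) simp
  also have "\<dots> = matrix_exp (- t *\<^sub>R \<Lambda>) *v (LINT s:{a..0}|lborel. ?k 0 s)"
    unfolding set_lebesgue_integral_def
    using integral_bounded_linear[OF bl int0[unfolded set_integrable_def]]
    by (simp only: matrix_vector_mult_scaleR)
  finally have "(LINT s:{a..t}|lborel. ?k t s) = matrix_exp (- t *\<^sub>R \<Lambda>) *v (LINT s:{a..0}|lborel. ?k 0 s) + (LINT s:{0..t}|lborel. ?k t s)" .
  moreover have "matrix_exp (- (t - a) *\<^sub>R \<Lambda>) *v D a \<omega> = matrix_exp (- t *\<^sub>R \<Lambda>) *v (matrix_exp (- (0 - a) *\<^sub>R \<Lambda>) *v D a \<omega>)"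
    by (simp only: matrix_vector_mul_assoc matrix_exp_add[symmetric]) simp
  ultimately show ?thesis
    unfolding kernel_integral_def by (simp add: matrix_vector_mult_diff_distrib)
qed

lemma equal_laws_cong:
  assumes "equal_laws M J X Y" "\<And>j. j \<in> J \<Longrightarrow> X j = X' j" "\<And>j. j \<in> J \<Longrightarrow> Y j = Y' j"
  shows "equal_laws M J X' Y'"
proof -
  have "(\<lambda>\<omega>. \<lambda>j\<in>J. X j \<omega>) = (\<lambda>\<omega>. \<lambda>j\<in>J. X' j \<omega>)" "(\<lambda>\<omega>. \<lambda>j\<in>J. Y j \<omega>) = (\<lambda>\<omega>. \<lambda>j\<in>J. Y' j \<omega>)"
    using assms(2,3) by (auto simp: fun_eq_iff)
  with assms(1) show ?thesis unfolding equal_laws_def by (simp only:)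
qed

text \<open>Over a finite window the integrals are one and the same functional of the increments
  relative to time 0 and to time \<open>h\<close>; equality of their joint laws survives sending the
  left end point to minus infinity.\<close>

lemma stationary_kernel_process:
  fixes \<Lambda> :: "real^'m^'m"
  assumes "prob_space M" and inc: "stationary_increments M D" and def: "kernel_integrals_defined M \<Lambda> D U"
  shows "stationary_process M U"
  unfolding stationary_process_def
proof (intro allI impI)
  fix J :: "real set" and h :: real
  assume J: "finite J" "J \<subseteq> {0..}" and h: "0 \<le> h"
  interpret prob_space M by fact
  have D: "(\<lambda>(s, \<omega>). D s \<omega>) \<in> borel_measurable (borel \<Otimes>\<^sub>M M)"
    and Um: "\<And>t. t \<ge> 0 \<Longrightarrow> U t \<in> borel_measurable M"
    and ae: "AE \<omega> in M. \<forall>t\<ge>0. (\<forall>a<t. set_integrable lborel {a..t}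
                 (\<lambda>s. (\<Lambda> ** matrix_exp (- (t - s) *\<^sub>R \<Lambda>)) *v D s \<omega>)) \<and>
        ((\<lambda>a. kernel_integral \<Lambda> D a t \<omega>) \<longlongrightarrow> U t \<omega>) at_bot"
    using def unfolding kernel_integrals_defined_def by auto
  define Y where "Y = (\<lambda>h s \<omega>. D (s + h) \<omega> - D h \<omega>)"
  define K where "K = (\<lambda>t s. \<Lambda> ** matrix_exp (- (t - s) *\<^sub>R \<Lambda>))"
  \<comment> \<open>\<open>V h a t\<close> is that functional. It is measurable as it stands, while
    its identity with the integral from \<open>a + h\<close> to \<open>t + h\<close> is available
    only almost surely.\<close>
  define V where "V = (\<lambda>h a t \<omega>. (Y h t \<omega> - matrix_exp (- (t - a) *\<^sub>R \<Lambda>) *v Y h a \<omega>) - (LINT s:{a..t}|lborel. K t s *v Y h s \<omega>))"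
  have Ym: "(\<lambda>(s, \<omega>). Y g s \<omega>) \<in> borel_measurable (borel \<Otimes>\<^sub>M M)" for g
  proof -
    have "(\<lambda>x. (fst x + g, snd x)) \<in> measurable (borel \<Otimes>\<^sub>M M) (borel \<Otimes>\<^sub>M M)" by measurable
    from measurable_compose[OF this D]
    have 1: "(\<lambda>x. D (fst x + g) (snd x)) \<in> borel_measurable (borel \<Otimes>\<^sub>M M)" by simp
    have "D g \<in> borel_measurable M" using measurable_Pair2[OF D, of g] by simp
    from measurable_compose[OF measurable_snd this]
    have 2: "(\<lambda>x. D g (snd x)) \<in> borel_measurable (borel \<Otimes>\<^sub>M M)" .
    show ?thesis unfolding Y_def case_prod_beta by (rule borel_measurable_diff[OF 1 2])
  qed
  have Ys: "Y g s \<in> borel_measurable M" for g s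
    using measurable_Pair2[OF Ym[of g], of s] by simp
  have Km: "(\<lambda>(s, y). K t s *v y) \<in> borel_measurable (borel \<Otimes>\<^sub>M borel)" for t
    unfolding borel_prod case_prod_beta K_def
    by (intro borel_measurable_continuous_onI bounded_bilinear.continuous_on[OF bounded_bilinear_matrix_vector_mult]
        continuous_on_compose2[OF continuous_on_kernel[of UNIV]] continuous_intros) auto
  have Vm: "V g a t \<in> borel_measurable M" for g a t
    unfolding V_def
    by (intro borel_measurable_diff Ys borel_measurable_set_integral_process[OF Ym Km]
        measurable_compose[OF Ys] borel_measurable_continuous_onI linear_continuous_on matrix_vector_mul_bounded_linear)
  have aeV: "AE \<omega> in M. \<forall>t\<ge>0. (\<forall>a<t. set_integrable lborel {a..t} (\<lambda>s. K t s *v Y g s \<omega>) \<and>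
      V g a t \<omega> = kernel_integral \<Lambda> D (a + g) (t + g) \<omega>)" if "g \<ge> 0" for g
    using ae
  proof eventually_elim
    case (elim \<omega>)
    show ?case
    proof (intro allI impI)
      fix t a :: real assume t: "0 \<le> t" "a < t"
      have i: "set_integrable lborel {a + g..t + g} (\<lambda>s. (\<Lambda> ** matrix_exp (- (t + g - s) *\<^sub>R \<Lambda>)) *v D s \<omega>)"
        using elim t that by auto
      note kk = kernel_integral_increments[where a=a and t=t and h=g and \<Lambda>=\<Lambda> and D=D and \<omega>=\<omega>,
          OF less_imp_le[OF t(2)] i]
      show "set_integrable lborel {a..t} (\<lambda>s. K t s *v Y g s \<omega>) \<and> V g a t \<omega> = kernel_integral \<Lambda> D (a + g) (t + g) \<omega>"
        unfolding V_def K_def Y_def by (rule conjI[OF kk(1) kk(2)[symmetric]])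
    qed
  qed
  have fidi: "equal_laws M G (Y 0) (Y h)" if "finite G" for G
    using inc that unfolding stationary_increments_def equal_laws_def Y_def by simp
  have eqV: "equal_laws M J (V 0 a) (V h a)" if a: "a < 0" for a
  proof -
    define q where "q = (\<lambda>t y. y t - matrix_exp (- (t - a) *\<^sub>R \<Lambda>) *v y a)"
    have int: "AE \<omega> in M. set_integrable lborel {a..t} (\<lambda>s. K t s *v Y g s \<omega>)" if "t \<in> J" "g \<ge> 0" for t g
      using aeV[OF that(2)]
    proof eventually_elim
      case (elim \<omega>)
      have "0 \<le> t" "a < t" using that(1) J a by auto
      with elim show ?case by blast
    qed
    have "equal_laws M J (\<lambda>t \<omega>. q t (\<lambda>s\<in>insert a J. Y 0 s \<omega>) - (LINT s:{a..t}|lborel. K t s *v Y 0 s \<omega>))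
        (\<lambda>t \<omega>. q t (\<lambda>s\<in>insert a J. Y h s \<omega>) - (LINT s:{a..t}|lborel. K t s *v Y h s \<omega>))"
    \<comment> \<open>\<open>insert a J\<close> collects the times of the boundary terms;
      \<open>Max (insert 0 J)\<close> is a common upper limit that exceeds \<open>a\<close> even
      when \<open>J\<close> is empty.\<close>
    proof (rule equal_laws_set_integral[OF \<open>prob_space M\<close> J(1), where F="insert a J" and Y="Y 0" and Y'="Y h"
          and q=q and f="\<lambda>t s y. K t s *v y" and b="\<lambda>t. t" and T="Max (insert 0 J)"])
      show "a < Max (insert 0 J)" using a J(1) by (simp add: less_le_trans[OF _ Max_ge])
      show "t \<le> Max (insert 0 J)" if "t \<in> J" for t using that J(1) by simp
      show "q t \<in> borel_measurable (\<Pi>\<^sub>M s\<in>insert a J. borel)" if "t \<in> J" for t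
        unfolding q_def
      proof (rule borel_measurable_diff)
        show "(\<lambda>y. y t) \<in> borel_measurable (\<Pi>\<^sub>M s\<in>insert a J. borel)"
          using that by (intro measurable_component_singleton) auto
        have 1: "(\<lambda>y. y a) \<in> measurable (\<Pi>\<^sub>M s\<in>insert a J. borel) (borel :: (real^'m) measure)"
          by (intro measurable_component_singleton) auto
        have 2: "(\<lambda>x::real^'m. matrix_exp (- (t - a) *\<^sub>R \<Lambda>) *v x) \<in> borel_measurable borel"
          by (intro borel_measurable_continuous_onI linear_continuous_on matrix_vector_mul_bounded_linear)
        show "(\<lambda>y. matrix_exp (- (t - a) *\<^sub>R \<Lambda>) *v y a) \<in> borel_measurable (\<Pi>\<^sub>M s\<in>insert a J. borel)"
          by (rule measurable_compose[OF 1 2])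
      qed
    qed (use J(1) h in \<open>simp_all only: finite_insert Ym fidi Km int order_refl\<close>)
    then show ?thesis
      by (rule equal_laws_cong) (simp_all add: q_def V_def fun_eq_iff)
  qed
  \<comment> \<open>\<open>- (real n + 1)\<close> is negative already at \<open>n = 0\<close>, as
    the window needs \<open>a < 0\<close>.\<close>
  have lim: "(\<lambda>n. \<integral>\<omega>. min 1 (dist (V g (- (real n + 1)) t \<omega>) (U (t + g) \<omega>)) \<partial>M) \<longlonglongrightarrow> 0"
    if t: "t \<in> J" and g: "g \<ge> 0" for g t
  proof (rule integral_min_dist_tendsto_0_AE[OF Vm])
    have t0: "t \<ge> 0" using t J by auto
    then show "U (t + g) \<in> borel_measurable M" using g by (intro Um) auto
    show "AE \<omega> in M. (\<lambda>n. V g (- (real n + 1)) t \<omega>) \<longlonglongrightarrow> U (t + g) \<omega>"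
      using ae aeV[OF g]
    proof eventually_elim
      case (elim \<omega>)
      have "filterlim (\<lambda>n. - (real n + 1) + g) at_bot sequentially"
        by real_asymp
      moreover have "((\<lambda>a. kernel_integral \<Lambda> D a (t + g) \<omega>) \<longlongrightarrow> U (t + g) \<omega>) at_bot"
        using elim(1) t0 g by auto
      ultimately have "(\<lambda>n. kernel_integral \<Lambda> D (- (real n + 1) + g) (t + g) \<omega>) \<longlonglongrightarrow> U (t + g) \<omega>"
        by (rule filterlim_compose[rotated])
      moreover have "V g (- (real n + 1)) t \<omega> = kernel_integral \<Lambda> D (- (real n + 1) + g) (t + g) \<omega>" for n
        using elim(2) t0 by (auto simp: less_eq_real_def)
      ultimately show ?case by (simp only:)
    qed
  qed
  have "equal_laws M J (\<lambda>t. U (t + 0)) (\<lambda>t. U (t + h))"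
  proof (rule equal_laws_limit[OF \<open>prob_space M\<close> J(1), where X="\<lambda>n. V 0 (- (real n + 1))" and Y="\<lambda>n. V h (- (real n + 1))"])
    show "U (t + 0) \<in> borel_measurable M" "U (t + h) \<in> borel_measurable M" if "t \<in> J" for t
      using that J h by (auto intro!: Um)
    show "equal_laws M J (V 0 (- (real n + 1))) (V h (- (real n + 1)))" for n by (rule eqV) simp
  qed (use h in \<open>simp_all only: Vm lim order_refl\<close>)
  then show "distr M (\<Pi>\<^sub>M t\<in>J. borel) (\<lambda>\<omega>. \<lambda>t\<in>J. U (t + h) \<omega>) = distr M (\<Pi>\<^sub>M t\<in>J. borel) (\<lambda>\<omega>. \<lambda>t\<in>J. U t \<omega>)"
    unfolding equal_laws_def by (simp only: add_0_right)
qed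

text \<open>Limit \<open>a\<close> to minus infinity in the splitting at 0. The quantifier over
  \<open>t\<close> stands inside the almost sure statement: one null set serves all times, as
  pathwise convergence requires.\<close>

lemma kernel_process_flow:
  fixes \<Lambda> :: "real^'m^'m"
  assumes "kernel_integrals_defined M \<Lambda> D U"
  shows "AE \<omega> in M. \<forall>t\<ge>0. U t \<omega> = kernel_integral \<Lambda> D 0 t \<omega> + matrix_exp (- t *\<^sub>R \<Lambda>) *v U 0 \<omega>"
proof -
  have ae: "AE \<omega> in M. \<forall>t\<ge>0. (\<forall>a<t. set_integrable lborel {a..t}
                 (\<lambda>s. (\<Lambda> ** matrix_exp (- (t - s) *\<^sub>R \<Lambda>)) *v D s \<omega>)) \<and>
        ((\<lambda>a. kernel_integral \<Lambda> D a t \<omega>) \<longlongrightarrow> U t \<omega>) at_bot"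
    using assms unfolding kernel_integrals_defined_def by auto
  then show ?thesis
  proof eventually_elim
    case (elim \<omega>)
    show ?case
    proof (intro allI impI)
      fix t :: real assume t: "t \<ge> 0"
      have "\<forall>\<^sub>F a in at_bot. kernel_integral \<Lambda> D a t \<omega>
          = kernel_integral \<Lambda> D 0 t \<omega> + matrix_exp (- t *\<^sub>R \<Lambda>) *v kernel_integral \<Lambda> D a 0 \<omega>"
        using eventually_gt_at_bot[of 0]
      proof eventually_elim
        case (elim a)
        then show ?case using \<open>\<forall>t\<ge>0. _ t\<close> t by (intro kernel_integral_split[where D=D and \<omega>=\<omega>]) auto
      qed
      moreover have "((\<lambda>a. kernel_integral \<Lambda> D 0 t \<omega> + matrix_exp (- t *\<^sub>R \<Lambda>) *v kernel_integral \<Lambda> D a 0 \<omega>)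
          \<longlongrightarrow> kernel_integral \<Lambda> D 0 t \<omega> + matrix_exp (- t *\<^sub>R \<Lambda>) *v U 0 \<omega>) at_bot"
        using elim by (intro tendsto_add tendsto_const bounded_linear.tendsto[OF matrix_vector_mul_bounded_linear]) auto
      ultimately have "((\<lambda>a. kernel_integral \<Lambda> D a t \<omega>) \<longlongrightarrow> kernel_integral \<Lambda> D 0 t \<omega> + matrix_exp (- t *\<^sub>R \<Lambda>) *v U 0 \<omega>) at_bot"
        by (rule tendsto_cong[THEN iffD2])
      moreover have "((\<lambda>a. kernel_integral \<Lambda> D a t \<omega>) \<longlongrightarrow> U t \<omega>) at_bot" using elim t by blast
      ultimately show "U t \<omega> = kernel_integral \<Lambda> D 0 t \<omega> + matrix_exp (- t *\<^sub>R \<Lambda>) *v U 0 \<omega>"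
        by (intro tendsto_unique[OF trivial_limit_at_bot_linorder])
    qed
  qed
qed

section \<open>Moment inequalities and the Wasserstein distance\<close>

text \<open>Bernoulli's inequality, obtained from Young's inequality for the pair
  \<open>t powr p\<close> and 1. Being the tangent of the power at 1, it is the source of the
  convexity and Jensen bounds below.\<close>

lemma powr_ge_tangent:
  fixes t p :: real
  assumes "p \<ge> 1" "t \<ge> 0"
  shows "1 + p * (t - 1) \<le> t powr p"
proof (cases "t = 0")
  case False
  then have "(t powr p) powr (1 / p) * 1 powr (1 - 1 / p) \<le> (1 / p) * t powr p + (1 - 1 / p) * 1"
    using assms by (intro Youngs_inequality_0) auto
  moreover have "(t powr p) powr (1 / p) = t"
    using assms False by (simp add: powr_powr)
  ultimately have "t \<le> (1 / p) * t powr p + (1 - 1 / p)" by simp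
  then have "p * t \<le> p * ((1 / p) * t powr p + (1 - 1 / p))" using assms by (intro mult_left_mono) auto
  also have "\<dots> = t powr p + (p - 1)" using assms by (simp add: distrib_left right_diff_distrib)
  finally show ?thesis by (simp add: algebra_simps)
qed (use assms in simp)

lemma powr_convex_combination:
  fixes u v p :: real
  assumes "p \<ge> 1" "\<alpha> \<ge> 0" "\<beta> \<ge> 0" "\<alpha> + \<beta> = 1" "u \<ge> 0" "v \<ge> 0"
  shows "(\<alpha> * u + \<beta> * v) powr p \<le> \<alpha> * u powr p + \<beta> * v powr p"
proof -
  \<comment> \<open>\<open>s\<close> is the point of tangency: the tangent bounds at
    \<open>u / s\<close> and \<open>v / s\<close> have weighted mean 1.\<close>
  define s where "s = \<alpha> * u + \<beta> * v"
  show ?thesis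
  proof (cases "s = 0")
    case False
    then have s: "s > 0" using assms by (simp add: s_def less_le)
    have "\<alpha> * (1 + p * (u / s - 1)) + \<beta> * (1 + p * (v / s - 1)) \<le> \<alpha> * (u / s) powr p + \<beta> * (v / s) powr p"
      using assms s by (intro add_mono mult_left_mono powr_ge_tangent) auto
    moreover have "\<alpha> * (1 + p * (u / s - 1)) + \<beta> * (1 + p * (v / s - 1)) = (\<alpha> + \<beta>) + p * ((\<alpha> * u + \<beta> * v) / s - (\<alpha> + \<beta>))"
      by (simp add: algebra_simps add_divide_distrib)
    moreover have "\<dots> = 1" using assms(4) s by (simp add: s_def[symmetric])
    ultimately have "1 * s powr p \<le> (\<alpha> * (u / s) powr p + \<beta> * (v / s) powr p) * s powr p"
      by (intro mult_right_mono) auto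
    also have "\<dots> = \<alpha> * u powr p + \<beta> * v powr p"
      using s assms by (simp add: powr_divide distrib_right)
    finally show ?thesis by (simp add: s_def)
  next
    case True
    then show ?thesis using assms by (simp add: s_def[symmetric])
  qed
qed

lemma integrable_norm_powr_add:
  fixes f g :: "'a \<Rightarrow> 'b::euclidean_space"
  assumes "p \<ge> 1" and [measurable]: "f \<in> borel_measurable M" "g \<in> borel_measurable M"
    and int: "integrable M (\<lambda>x. norm (f x) powr p)" "integrable M (\<lambda>x. norm (g x) powr p)"
  shows "integrable M (\<lambda>x. norm (f x + g x) powr p)"
proof (rule Bochner_Integration.integrable_bound)
  \<comment> \<open>\<open>2 powr p\<close> compensates for the halving that turns the sum into a
    convex combination.\<close>
  show "integrable M (\<lambda>x. 2 powr p * (1/2 * norm (f x) powr p + 1/2 * norm (g x) powr p))"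
    using int by (intro integrable_mult_right Bochner_Integration.integrable_add)
  show "AE x in M. norm (norm (f x + g x) powr p) \<le> norm (2 powr p * (1/2 * norm (f x) powr p + 1/2 * norm (g x) powr p))"
  proof (rule AE_I2)
    fix x
    have "norm (f x + g x) powr p \<le> (2 * (1/2 * norm (f x) + 1/2 * norm (g x))) powr p"
      using assms(1) norm_triangle_ineq[of "f x" "g x"] by (intro powr_mono2) auto
    also have "\<dots> = 2 powr p * (1/2 * norm (f x) + 1/2 * norm (g x)) powr p"
      by (rule powr_mult)
    also have "\<dots> \<le> 2 powr p * (1/2 * norm (f x) powr p + 1/2 * norm (g x) powr p)"
      using assms(1) by (intro mult_left_mono powr_convex_combination) auto
    finally show "norm (norm (f x + g x) powr p) \<le> norm (2 powr p * (1/2 * norm (f x) powr p + 1/2 * norm (g x) powr p))"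
      by simp
  qed
qed measurable

lemma (in prob_space) integrable_of_norm_powr:
  fixes f :: "'a \<Rightarrow> 'b::euclidean_space"
  assumes "p \<ge> 1" and [measurable]: "f \<in> borel_measurable M" and int: "integrable M (\<lambda>x. norm (f x) powr p)"
  shows "integrable M f"
proof (rule Bochner_Integration.integrable_bound)
  show "integrable M (\<lambda>x. 1 + norm (f x) powr p)" using int by auto
  show "AE x in M. norm (f x) \<le> norm (1 + norm (f x) powr p)"
  proof (rule AE_I2)
    fix x
    have "norm (f x) \<le> 1 + norm (f x) powr p"
    proof (cases "norm (f x) \<le> 1")
      case True
      then show ?thesis using powr_ge_zero[of "norm (f x)" p] by linarith
    next
      case False
      then have "norm (f x) powr 1 \<le> norm (f x) powr p" using assms(1) by (intro powr_mono) auto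
      then show ?thesis using False by simp
    qed
    then show "norm (f x) \<le> norm (1 + norm (f x) powr p)" by simp
  qed
qed measurable

text \<open>Jensen by the tangent at \<open>b\<close>: any positive \<open>b\<close> with
  \<open>I \<le> b powr p\<close> bounds the expectation. The choice
  \<open>b = I powr (1 / p)\<close> is positive only for \<open>I \<noteq> 0\<close>; for
  \<open>I = 0\<close> every positive \<open>b\<close> qualifies.\<close>

lemma (in prob_space) expectation_le_powr_norm:
  assumes "p \<ge> 1" and [measurable]: "f \<in> borel_measurable M" and nonneg: "\<And>x. f x \<ge> (0::real)"
    and int: "integrable M (\<lambda>x. f x powr p)"
  shows "expectation f \<le> (expectation (\<lambda>x. f x powr p)) powr (1 / p)"
proof -
  define I where "I = expectation (\<lambda>x. f x powr p)"
  have I0: "I \<ge> 0" unfolding I_def by (intro integral_nonneg_AE) auto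
  have fint: "integrable M f" using integrable_of_norm_powr[OF assms(1,2)] int nonneg by simp
  have key: "expectation f \<le> b" if b: "b > 0" "I \<le> b powr p" for b
  proof -
    have "expectation f \<le> expectation (\<lambda>x. (b / p) * ((1 / b powr p) * f x powr p) + b * (1 - 1 / p))"
    proof (rule integral_mono[OF fint])
      show "integrable M (\<lambda>x. (b / p) * ((1 / b powr p) * f x powr p) + b * (1 - 1 / p))"
        using int by auto
      fix x
      have "1 + p * (f x / b - 1) \<le> (f x / b) powr p"
        using b nonneg[of x] assms(1) by (intro powr_ge_tangent) auto
      then have "(b / p) * (1 + p * (f x / b - 1)) \<le> (b / p) * (f x / b) powr p"
        using b assms(1) by (intro mult_left_mono) auto
      moreover have "(b / p) * (1 + p * (f x / b - 1)) = f x - b * (1 - 1 / p)"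
        using b assms(1) by (simp add: field_simps)
      ultimately show "f x \<le> (b / p) * ((1 / b powr p) * f x powr p) + b * (1 - 1 / p)"
        using b nonneg[of x] by (simp add: powr_divide)
    qed
    also have "\<dots> = (b / p) * (I / b powr p) + b * (1 - 1 / p)"
      using int by (simp add: prob_space I_def)
    also have "\<dots> \<le> (b / p) * 1 + b * (1 - 1 / p)"
      using b assms(1) by (intro add_right_mono mult_left_mono) auto
    also have "\<dots> = b" using assms(1) by (simp add: field_simps)
    finally show ?thesis .
  qed
  show ?thesis
  proof (cases "I = 0")
    case True
    have "expectation f \<le> b" if "b > 0" for b using key[OF that] True by simp
    then have "expectation f \<le> 0" by (rule field_le_epsilon) simp
    then show ?thesis using True by (simp add: I_def[symmetric])
  next
    case False
    then have "I powr (1 / p) > 0" "I \<le> (I powr (1 / p)) powr p"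
      using I0 assms(1) by (auto simp: powr_powr)
    from key[OF this] show ?thesis by (simp add: I_def)
  qed
qed

text \<open>From the convexity of \<open>x \<mapsto> x\<^sup>p\<close> at the
  point \<open>(a * 1 + b * (x / b)) / (a + b)\<close> with \<open>a = \<parallel>y\<parallel>\<close>.\<close>

lemma (in prob_space) Lp_norm_translate_le:
  fixes V :: "'a \<Rightarrow> 'b::euclidean_space"
  assumes "p \<ge> 1" and [measurable]: "V \<in> borel_measurable M" and int: "integrable M (\<lambda>x. norm (V x) powr p)"
    and b: "b > 0" "expectation (\<lambda>x. norm (V x) powr p) \<le> b powr p"
  shows "(expectation (\<lambda>x. norm (y + V x) powr p)) powr (1 / p) \<le> norm y + b"
proof -
  define a where "a = norm y"
  have ab: "a \<ge> 0" "a + b > 0" using b by (auto simp: a_def add_nonneg_pos)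
  have "expectation (\<lambda>x. norm (y + V x) powr p)
      \<le> expectation (\<lambda>x. (a + b) powr p * (a / (a + b) + b / (a + b) * ((1 / b powr p) * norm (V x) powr p)))"
  proof (rule integral_mono)
    show "integrable M (\<lambda>x. norm (y + V x) powr p)"
      using int assms(1) by (intro integrable_norm_powr_add) auto
    show "integrable M (\<lambda>x. (a + b) powr p * (a / (a + b) + b / (a + b) * ((1 / b powr p) * norm (V x) powr p)))"
      using int by (intro integrable_mult_right Bochner_Integration.integrable_add integrable_const)
    fix x
    have "norm (y + V x) \<le> (a + b) * (a / (a + b) * 1 + b / (a + b) * (norm (V x) / b))"
      using ab b norm_triangle_ineq[of y "V x"] by (simp add: a_def divide_simps)
    then have "norm (y + V x) powr p \<le> ((a + b) * (a / (a + b) * 1 + b / (a + b) * (norm (V x) / b))) powr p"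
      using assms(1) by (intro powr_mono2) auto
    also have "\<dots> = (a + b) powr p * (a / (a + b) * 1 + b / (a + b) * (norm (V x) / b)) powr p"
      by (rule powr_mult)
    also have "\<dots> \<le> (a + b) powr p * (a / (a + b) * 1 powr p + b / (a + b) * (norm (V x) / b) powr p)"
      using ab b assms(1) by (intro mult_left_mono powr_convex_combination) (auto simp: add_divide_distrib[symmetric])
    also have "(norm (V x) / b) powr p = (1 / b powr p) * norm (V x) powr p"
      using b by (simp add: powr_divide)
    finally show "norm (y + V x) powr p
        \<le> (a + b) powr p * (a / (a + b) + b / (a + b) * ((1 / b powr p) * norm (V x) powr p))" by simp
  qed
  also have "\<dots> = (a + b) powr p * (a / (a + b) + b / (a + b) * ((1 / b powr p) * expectation (\<lambda>x. norm (V x) powr p)))"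
    using int by (simp add: prob_space)
  also have "\<dots> \<le> (a + b) powr p * (a / (a + b) + b / (a + b) * 1)"
    using b ab by (intro mult_left_mono add_left_mono) auto
  also have "\<dots> = (a + b) powr p" using ab by (simp add: add_divide_distrib[symmetric])
  finally have "(expectation (\<lambda>x. norm (y + V x) powr p)) powr (1 / p) \<le> ((a + b) powr p) powr (1 / p)"
    using assms(1) by (intro powr_mono2) (auto intro!: integral_nonneg_AE)
  also have "\<dots> = a + b" using ab assms(1) by (simp add: powr_powr)
  finally show ?thesis by (simp add: a_def)
qed

text \<open>\<open>X\<close> and \<open>Y\<close> represent on one space two laws that may come from
  elsewhere. Their joint law is the coupling behind the upper bound; the lower bound holds for each
  coupling, as its marginal means are those of \<open>X\<close> and \<open>Y\<close>.\<close>

lemma (in prob_space) wasserstein_bounds: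
  fixes X Y :: "'a \<Rightarrow> real^'m"
  assumes p: "p \<ge> 1" and X [measurable]: "X \<in> borel_measurable M" and Y [measurable]: "Y \<in> borel_measurable M"
    and intX: "integrable M (\<lambda>\<omega>. norm (X \<omega>) powr p)" and intY: "integrable M (\<lambda>\<omega>. norm (Y \<omega>) powr p)"
    and law: "distr M1 borel X1 = distr M borel X" "distr M2 borel X2 = distr M borel Y"
  shows "norm (expectation X - expectation Y) \<le> wasserstein p M1 X1 M2 X2"
    and "wasserstein p M1 X1 M2 X2 \<le> (expectation (\<lambda>\<omega>. norm (X \<omega> - Y \<omega>) powr p)) powr (1 / p)"
proof -
  define c where "c = (\<lambda>\<nu>::((real^'m) \<times> (real^'m)) measure. (LINT u|\<nu>. norm (fst u - snd u) powr p) powr (1 / p))"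
  define \<nu>0 where "\<nu>0 = distr M (borel \<Otimes>\<^sub>M borel) (\<lambda>\<omega>. (X \<omega>, Y \<omega>))"
  have \<nu>0: "\<nu>0 \<in> couplings (distr M borel X) (distr M borel Y)"
    unfolding couplings_def \<nu>0_def by (auto simp: distr_distr o_def)
  have W: "wasserstein p M1 X1 M2 X2 = (INF \<nu>\<in>couplings (distr M borel X) (distr M borel Y). c \<nu>)"
    unfolding wasserstein_def law c_def ..
  have "c \<nu>0 = (expectation (\<lambda>\<omega>. norm (X \<omega> - Y \<omega>) powr p)) powr (1 / p)"
    unfolding c_def \<nu>0_def by (subst integral_distr) auto
  moreover have "(INF \<nu>\<in>couplings (distr M borel X) (distr M borel Y). c \<nu>) \<le> c \<nu>0"
    by (rule cINF_lower[OF _ \<nu>0]) (auto intro!: bdd_belowI[of _ 0] simp: c_def)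
  ultimately show "wasserstein p M1 X1 M2 X2 \<le> (expectation (\<lambda>\<omega>. norm (X \<omega> - Y \<omega>) powr p)) powr (1 / p)"
    using W by simp
  show "norm (expectation X - expectation Y) \<le> wasserstein p M1 X1 M2 X2"
    unfolding W
  proof (rule cINF_greatest)
    show "couplings (distr M borel X) (distr M borel Y) \<noteq> {}" using \<nu>0 by auto
    fix \<nu> assume "\<nu> \<in> couplings (distr M borel X) (distr M borel Y)"
    then have sets: "sets \<nu> = sets (borel \<Otimes>\<^sub>M borel)"
      and fst: "distr \<nu> borel fst = distr M borel X" and snd: "distr \<nu> borel snd = distr M borel Y"
      by (auto simp: couplings_def)
    have [measurable]: "fst \<in> borel_measurable \<nu>" "snd \<in> borel_measurable \<nu>"
      unfolding measurable_cong_sets[OF sets refl] by simp_all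
    \<comment> \<open>\<open>couplings\<close> fixes only the sigma-algebra and the marginals; total
      mass 1 is inherited from a marginal.\<close>
    interpret D: prob_space "distr \<nu> borel fst" unfolding fst by (rule prob_space_distr[OF X])
    interpret \<nu>: prob_space \<nu> by (rule prob_space_distrD[OF _ D.prob_space_axioms]) simp
    have i1: "integrable \<nu> (\<lambda>u. norm (fst u) powr p)"
      using intX integrable_distr_eq[of fst \<nu> borel "\<lambda>x. norm x powr p"]
        integrable_distr_eq[of X M borel "\<lambda>x. norm x powr p"] by (simp add: fst)
    have i2: "integrable \<nu> (\<lambda>u. norm (snd u) powr p)"
      using intY integrable_distr_eq[of snd \<nu> borel "\<lambda>x. norm x powr p"]
        integrable_distr_eq[of Y M borel "\<lambda>x. norm x powr p"] by (simp add: snd)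
    have i12: "integrable \<nu> (\<lambda>u. norm (fst u - snd u) powr p)"
      using integrable_norm_powr_add[OF p _ _ i1, of "\<lambda>u. - snd u"] i2 by simp
    have e1: "(LINT u|\<nu>. fst u) = expectation X"
    proof -
      have "(LINT u|\<nu>. fst u) = (LINT x|distr \<nu> borel fst. x)"
        by (rule integral_distr[symmetric]) simp_all
      also have "\<dots> = expectation X" unfolding fst by (rule integral_distr) simp_all
      finally show ?thesis .
    qed
    have e2: "(LINT u|\<nu>. snd u) = expectation Y"
    proof -
      have "(LINT u|\<nu>. snd u) = (LINT x|distr \<nu> borel snd. x)"
        by (rule integral_distr[symmetric]) simp_all
      also have "\<dots> = expectation Y" unfolding snd by (rule integral_distr) simp_all
      finally show ?thesis .
    qed
    have "norm (expectation X - expectation Y) = norm (LINT u|\<nu>. fst u - snd u)"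
      using \<nu>.integrable_of_norm_powr[OF p _ i1] \<nu>.integrable_of_norm_powr[OF p _ i2]
      by (subst Bochner_Integration.integral_diff) (simp_all add: e1 e2)
    also have "\<dots> \<le> (LINT u|\<nu>. norm (fst u - snd u))" by (rule integral_norm_bound)
    also have "\<dots> \<le> c \<nu>"
      unfolding c_def using i12 by (intro \<nu>.expectation_le_powr_norm p) auto
    finally show "norm (expectation X - expectation Y) \<le> c \<nu>" .
  qed
qed

text \<open>Both bounds meet: the coupling of \<open>u + Z\<close> with the same \<open>Z\<close>
  has constant cost \<open>norm u\<close>, and the means differ by \<open>u\<close>.\<close>

lemma wasserstein_translate:
  fixes Z :: "'b \<Rightarrow> real^'m"
  assumes "prob_space N" "p \<ge> 1" and [measurable]: "Z \<in> borel_measurable N"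
    and int: "integrable N (\<lambda>\<omega>. norm (Z \<omega>) powr p)"
  shows "wasserstein p N (\<lambda>\<omega>. u + Z \<omega>) N Z = norm u"
proof -
  interpret prob_space N by fact
  have iu: "integrable N (\<lambda>\<omega>. norm (u + Z \<omega>) powr p)"
    using int assms(2) by (intro integrable_norm_powr_add) auto
  have "integrable N Z" by (rule integrable_of_norm_powr[OF assms(2,3) int])
  then have "expectation (\<lambda>\<omega>. u + Z \<omega>) - expectation Z = u" by (simp add: prob_space)
  moreover have "(expectation (\<lambda>\<omega>. norm (u + Z \<omega> - Z \<omega>) powr p)) powr (1 / p) = norm u"
    using assms(2) by (simp add: prob_space powr_powr)
  ultimately show ?thesis
    using wasserstein_bounds[OF assms(2) _ assms(3) iu int refl refl] by (intro antisym) simp_all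
qed

section \<open>Comparison of \<open>S\<close> and \<open>U\<close>\<close>

text \<open>\<open>has_bochner_integral\<close> with value 0 states integrability along with the
  zero mean; measurability of \<open>S t\<close> is read off from it.\<close>

locale kernel_process = prob_space M
  for M :: "'a measure" +
  fixes \<Lambda> :: "real^'m^'m" and D S U :: "real \<Rightarrow> 'a \<Rightarrow> real^'m"
  assumes hurwitz: "Routh_Hurwitz (- \<Lambda>)"
    and increments: "stationary_increments M D"
    and S_eq: "S = (\<lambda>t. kernel_integral \<Lambda> D 0 t)"
    and integrals: "kernel_integrals_defined M \<Lambda> D U"
    and mean: "\<And>t. t \<ge> 0 \<Longrightarrow> has_bochner_integral M (S t) 0"
begin

lemma flow_tendsto_0: "((\<lambda>t. matrix_exp (- t *\<^sub>R \<Lambda>)) \<longlongrightarrow> 0) at_top"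
  using matrix_exp_tendsto_0[OF hurwitz] by simp

lemma U_measurable: "t \<ge> 0 \<Longrightarrow> U t \<in> borel_measurable M"
  using integrals by (simp add: kernel_integrals_defined_def)

lemma S_measurable: "t \<ge> 0 \<Longrightarrow> S t \<in> borel_measurable M"
  using mean by (auto dest: integrable.intros borel_measurable_integrable)

lemma U_eq: "AE \<omega> in M. \<forall>t\<ge>0. U t \<omega> = S t \<omega> + matrix_exp (- t *\<^sub>R \<Lambda>) *v U 0 \<omega>"
  using kernel_process_flow[OF integrals] unfolding S_eq .

lemma distr_U:
  assumes "t \<ge> 0"
  shows "distr M borel (U t) = distr M borel (U 0)"
proof -
  have st: "distr M (\<Pi>\<^sub>M s\<in>{0}. borel) (\<lambda>\<omega>. \<lambda>s\<in>{0}. U (s + t) \<omega>) = distr M (\<Pi>\<^sub>M s\<in>{0}. borel) (\<lambda>\<omega>. \<lambda>s\<in>{0}. U s \<omega>)"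
    using stationary_kernel_process[OF prob_space_axioms increments integrals] assms
    unfolding stationary_process_def by (elim allE[of _ "{0}"] allE[of _ t] impE) auto
  have c: "(\<lambda>y. y 0) \<in> measurable (\<Pi>\<^sub>M s\<in>{0::real}. borel) (borel :: (real^'m) measure)"
    by (rule measurable_component_singleton) simp
  have "distr M borel (U g) = distr (distr M (\<Pi>\<^sub>M s\<in>{0}. borel) (\<lambda>\<omega>. \<lambda>s\<in>{0}. U (s + g) \<omega>)) borel (\<lambda>y. y 0)"
    if "g \<ge> 0" for g
  proof -
    have m: "(\<lambda>\<omega>. \<lambda>s\<in>{0}. U (s + g) \<omega>) \<in> measurable M (\<Pi>\<^sub>M s\<in>{0::real}. borel)"
      using that by (intro measurable_restrict U_measurable) auto
    show ?thesis unfolding distr_distr[OF c m] by (simp add: o_def)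
  qed
  from this[OF assms] this[of 0] show ?thesis unfolding st by simp
qed

lemma S_minus_U_tendsto_0: "AE \<omega> in M. ((\<lambda>t. S t \<omega> - U t \<omega>) \<longlongrightarrow> 0) at_top"
  using U_eq
proof eventually_elim
  case (elim \<omega>)
  have "((\<lambda>t. - (matrix_exp (- t *\<^sub>R \<Lambda>) *v U 0 \<omega>)) \<longlongrightarrow> - (0 *v U 0 \<omega>)) at_top"
    by (intro tendsto_minus tendsto_matrix_vector_mult tendsto_const flow_tendsto_0)
  moreover have "\<forall>\<^sub>F t in at_top. - (matrix_exp (- t *\<^sub>R \<Lambda>) *v U 0 \<omega>) = S t \<omega> - U t \<omega>"
  proof (rule eventually_mono[OF eventually_ge_at_top[of 0]])
    fix t :: real assume "0 \<le> t"
    with elim have "U t \<omega> = S t \<omega> + matrix_exp (- t *\<^sub>R \<Lambda>) *v U 0 \<omega>" by blast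
    then show "- (matrix_exp (- t *\<^sub>R \<Lambda>) *v U 0 \<omega>) = S t \<omega> - U t \<omega>" by (metis add_diff_cancel_left' minus_diff_eq)
  qed
  ultimately have "((\<lambda>t. S t \<omega> - U t \<omega>) \<longlongrightarrow> - (0 *v U 0 \<omega>)) at_top"
    by (rule Lim_transform_eventually)
  then show ?case by simp
qed

text \<open>A deterministic rate times one random variable: the same rate gives convergence in p-th
  mean and the error term of the coupling.\<close>

lemma S_minus_U_bound:
  "\<exists>\<eta>. (\<eta> \<longlongrightarrow> 0) at_top \<and> (\<forall>t. \<eta> t > 0) \<and>
    (AE \<omega> in M. \<forall>t\<ge>0. norm (S t \<omega> - U t \<omega>) \<le> \<eta> t * norm (U 0 \<omega>))"
proof -
  obtain K where K: "\<And>(A::real^'m^'m) (x::real^'m). norm (A *v x) \<le> norm A * norm x * K"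
    using bounded_bilinear.pos_bounded[OF bounded_bilinear_matrix_vector_mult] by metis
  \<comment> \<open>\<open>exp (- t)\<close> makes \<open>\<eta>\<close> visibly positive;
    \<open>\<bar>K\<bar>\<close> appears because no sign of \<open>K\<close> is retained.\<close>
  define \<eta> where "\<eta> = (\<lambda>t. norm (matrix_exp (- t *\<^sub>R \<Lambda>)) * \<bar>K\<bar> + exp (- t))"
  have exp0: "((\<lambda>t::real. exp (- t)) \<longlongrightarrow> 0) at_top"
    by (rule filterlim_compose[OF exp_at_bot filterlim_uminus_at_bot_at_top])
  have "(\<eta> \<longlongrightarrow> norm (0 :: real^'m^'m) * \<bar>K\<bar> + 0) at_top"
    unfolding \<eta>_def by (intro tendsto_intros flow_tendsto_0 exp0)
  then have "(\<eta> \<longlongrightarrow> 0) at_top" by simp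
  moreover have "\<eta> t > 0" for t by (auto simp: \<eta>_def intro!: add_nonneg_pos)
  moreover have "AE \<omega> in M. \<forall>t\<ge>0. norm (S t \<omega> - U t \<omega>) \<le> \<eta> t * norm (U 0 \<omega>)"
    using U_eq
  proof eventually_elim
    case (elim \<omega>)
    show ?case
    proof (intro allI impI)
      fix t :: real assume "t \<ge> 0"
      with elim have "U t \<omega> = S t \<omega> + matrix_exp (- t *\<^sub>R \<Lambda>) *v U 0 \<omega>" by blast
      then have "norm (S t \<omega> - U t \<omega>) = norm (matrix_exp (- t *\<^sub>R \<Lambda>) *v U 0 \<omega>)"
        by (metis add_diff_cancel_left' norm_minus_commute)
      also have "\<dots> \<le> norm (matrix_exp (- t *\<^sub>R \<Lambda>)) * norm (U 0 \<omega>) * K" by (rule K)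
      also have "\<dots> \<le> norm (matrix_exp (- t *\<^sub>R \<Lambda>)) * norm (U 0 \<omega>) * \<bar>K\<bar>"
        by (intro mult_left_mono) auto
      also have "\<dots> \<le> \<eta> t * norm (U 0 \<omega>)" by (simp add: \<eta>_def algebra_simps)
      finally show "norm (S t \<omega> - U t \<omega>) \<le> \<eta> t * norm (U 0 \<omega>)" .
    qed
  qed
  ultimately show ?thesis by (intro exI[of _ \<eta>] conjI allI)
qed

text \<open>The nonnegative integral excludes the default value 0 that a Bochner integral takes for
  non-integrable functions.\<close>

lemma S_minus_U_tendsto_0_Lp:
  assumes "p \<ge> 1" "integrable M (\<lambda>\<omega>. norm (U 0 \<omega>) powr p)"
  shows "((\<lambda>t. \<integral>\<^sup>+\<omega>. ennreal (norm (S t \<omega> - U t \<omega>) powr p) \<partial>M) \<longlongrightarrow> 0) at_top"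
proof -
  from S_minus_U_bound obtain \<eta> where "(\<eta> \<longlongrightarrow> 0) at_top \<and> (\<forall>t. \<eta> t > 0) \<and>
    (AE \<omega> in M. \<forall>t\<ge>0. norm (S t \<omega> - U t \<omega>) \<le> \<eta> t * norm (U 0 \<omega>))" ..
  then have \<eta>: "(\<eta> \<longlongrightarrow> 0) at_top" "\<And>t. \<eta> t > 0"
    "AE \<omega> in M. \<forall>t\<ge>0. norm (S t \<omega> - U t \<omega>) \<le> \<eta> t * norm (U 0 \<omega>)"
    by simp_all
  define C where "C = expectation (\<lambda>\<omega>. norm (U 0 \<omega>) powr p)"
  have "((\<lambda>t. \<eta> t powr p * C) \<longlongrightarrow> 0 powr p * C) at_top"
    using assms(1) \<eta> by (intro tendsto_mult tendsto_const tendsto_powr2) (auto intro: always_eventually less_imp_le)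
  then have "((\<lambda>t. ennreal (\<eta> t powr p * C)) \<longlongrightarrow> ennreal 0) at_top" by (intro tendsto_ennrealI) simp
  then have up: "((\<lambda>t. ennreal (\<eta> t powr p * C)) \<longlongrightarrow> 0) at_top" by simp
  have le: "(\<integral>\<^sup>+\<omega>. ennreal (norm (S t \<omega> - U t \<omega>) powr p) \<partial>M) \<le> ennreal (\<eta> t powr p * C)" if "t \<ge> 0" for t
  proof -
    have "(\<integral>\<^sup>+\<omega>. ennreal (norm (S t \<omega> - U t \<omega>) powr p) \<partial>M) \<le> (\<integral>\<^sup>+\<omega>. ennreal (\<eta> t powr p * norm (U 0 \<omega>) powr p) \<partial>M)"
    proof (rule nn_integral_mono_AE)
      show "AE \<omega> in M. ennreal (norm (S t \<omega> - U t \<omega>) powr p) \<le> ennreal (\<eta> t powr p * norm (U 0 \<omega>) powr p)"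
        using \<eta>(3)
      proof eventually_elim
        case (elim \<omega>)
        then have "norm (S t \<omega> - U t \<omega>) powr p \<le> (\<eta> t * norm (U 0 \<omega>)) powr p"
          using that assms(1) by (intro powr_mono2) auto
        then show ?case by (intro ennreal_leI) (simp add: powr_mult)
      qed
    qed
    also have "\<dots> = ennreal (\<eta> t powr p * C)"
      unfolding C_def using assms(2) by (subst nn_integral_eq_integral) auto
    finally show ?thesis .
  qed
  show ?thesis
  proof (rule tendsto_sandwich[OF _ _ tendsto_const up])
    show "\<forall>\<^sub>F t in at_top. (\<integral>\<^sup>+\<omega>. ennreal (norm (S t \<omega> - U t \<omega>) powr p) \<partial>M) \<le> ennreal (\<eta> t powr p * C)"
      by (rule eventually_mono[OF eventually_ge_at_top[of 0]]) (rule le)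
  qed simp
qed

text \<open>Stationarity makes \<open>expectation (U 0)\<close> a fixed vector of every
  \<open>matrix_exp (- t *\<^sub>R \<Lambda>)\<close> with \<open>t \<ge> 0\<close>, and these
  matrices tend to 0.\<close>

lemma expectation_U_0:
  assumes int: "integrable M (U 0)"
  shows "expectation (U 0) = 0"
proof -
  have "expectation (U 0) = matrix_exp (- t *\<^sub>R \<Lambda>) *v expectation (U 0)" if t: "t \<ge> 0" for t
  proof -
    have bl: "bounded_linear (\<lambda>x. matrix_exp (- t *\<^sub>R \<Lambda>) *v x)" by (rule matrix_vector_mul_bounded_linear)
    have "expectation (U 0) = (\<integral>x. x \<partial>distr M borel (U t))"
      unfolding distr_U[OF t] by (rule integral_distr[symmetric]) (auto intro: U_measurable)
    also have "\<dots> = expectation (U t)" using t by (intro integral_distr) (auto intro: U_measurable)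
    also have "\<dots> = expectation (\<lambda>\<omega>. S t \<omega> + matrix_exp (- t *\<^sub>R \<Lambda>) *v U 0 \<omega>)"
    proof (rule integral_cong_AE)
      show "AE \<omega> in M. U t \<omega> = S t \<omega> + matrix_exp (- t *\<^sub>R \<Lambda>) *v U 0 \<omega>"
        using U_eq by eventually_elim (use t in blast)
      show "(\<lambda>\<omega>. S t \<omega> + matrix_exp (- t *\<^sub>R \<Lambda>) *v U 0 \<omega>) \<in> borel_measurable M"
        using integrable_bounded_linear[OF bl int] S_measurable[OF t] by auto
    qed (rule U_measurable[OF t])
    also have "\<dots> = expectation (S t) + expectation (\<lambda>\<omega>. matrix_exp (- t *\<^sub>R \<Lambda>) *v U 0 \<omega>)"
      using integrable.intros[OF mean[OF t]] integrable_bounded_linear[OF bl int]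
      by (rule Bochner_Integration.integral_add)
    also have "\<dots> = matrix_exp (- t *\<^sub>R \<Lambda>) *v expectation (U 0)"
      using has_bochner_integral_integral_eq[OF mean[OF t]] integral_bounded_linear[OF bl int] by simp
    finally show ?thesis .
  qed
  then have "\<forall>\<^sub>F t in at_top. matrix_exp (- t *\<^sub>R \<Lambda>) *v expectation (U 0) = expectation (U 0)"
    by (intro eventually_mono[OF eventually_ge_at_top[of 0]]) simp
  then have "((\<lambda>t. matrix_exp (- t *\<^sub>R \<Lambda>) *v expectation (U 0)) \<longlongrightarrow> expectation (U 0)) at_top"
    by (rule tendsto_eventually)
  moreover have "((\<lambda>t. matrix_exp (- t *\<^sub>R \<Lambda>) *v expectation (U 0)) \<longlongrightarrow> 0 *v expectation (U 0)) at_top"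
    by (intro tendsto_matrix_vector_mult tendsto_const flow_tendsto_0)
  ultimately show ?thesis using tendsto_unique[OF trivial_limit_at_top_linorder] by fastforce
qed

text \<open>Collects what \<open>wasserstein_bounds\<close> needs for \<open>y + S t\<close> against
  \<open>U t\<close>. The error \<open>b\<close> must not depend on \<open>y\<close>, since the
  rescaled displacement varies together with time along the cut-off window.\<close>

lemma translated_S_Lp_bounds:
  assumes p: "p \<ge> 1" and int: "integrable M (\<lambda>\<omega>. norm (U 0 \<omega>) powr p)"
  shows "\<exists>b. (b \<longlongrightarrow> 0) at_top \<and> (\<forall>t\<ge>0. \<forall>y.
    (\<lambda>\<omega>. y + S t \<omega>) \<in> borel_measurable M \<and>
    integrable M (\<lambda>\<omega>. norm (y + S t \<omega>) powr p) \<and>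
    integrable M (\<lambda>\<omega>. norm (U t \<omega>) powr p) \<and>
    expectation (\<lambda>\<omega>. y + S t \<omega>) - expectation (U t) = y \<and>
    (expectation (\<lambda>\<omega>. norm (y + S t \<omega> - U t \<omega>) powr p)) powr (1 / p) \<le> norm y + b t)"
proof -
  from S_minus_U_bound obtain \<eta> where "(\<eta> \<longlongrightarrow> 0) at_top \<and> (\<forall>t. \<eta> t > 0) \<and>
    (AE \<omega> in M. \<forall>t\<ge>0. norm (S t \<omega> - U t \<omega>) \<le> \<eta> t * norm (U 0 \<omega>))" ..
  then have \<eta>: "(\<eta> \<longlongrightarrow> 0) at_top" "\<And>t. \<eta> t > 0"
    "AE \<omega> in M. \<forall>t\<ge>0. norm (S t \<omega> - U t \<omega>) \<le> \<eta> t * norm (U 0 \<omega>)"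
    by simp_all
  define C where "C = expectation (\<lambda>\<omega>. norm (U 0 \<omega>) powr p)"
  have C: "C \<ge> 0" unfolding C_def by (intro integral_nonneg_AE) auto
  \<comment> \<open>\<open>C + 1\<close> instead of \<open>C\<close> keeps \<open>b t\<close>
    positive when \<open>U 0\<close> vanishes almost surely.\<close>
  define b where "b = (\<lambda>t. \<eta> t * (C + 1) powr (1 / p))"
  have intU: "integrable M (\<lambda>\<omega>. norm (U t \<omega>) powr p)" if t: "t \<ge> 0" for t
  proof -
    have m: "(\<lambda>x::real^'m. norm x powr p) \<in> borel_measurable borel" by measurable
    have "integrable (distr M borel (U 0)) (\<lambda>x. norm x powr p)"
      using int integrable_distr_eq[OF U_measurable[OF order_refl] m] by simp
    then show ?thesis
      unfolding distr_U[OF t, symmetric] using integrable_distr_eq[OF U_measurable[OF t] m] by simp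
  qed
  have V: "integrable M (\<lambda>\<omega>. norm (S t \<omega> - U t \<omega>) powr p)"
      "expectation (\<lambda>\<omega>. norm (S t \<omega> - U t \<omega>) powr p) \<le> b t powr p" if t: "t \<ge> 0" for t
  proof -
    have [measurable]: "S t \<in> borel_measurable M" "U t \<in> borel_measurable M" using t S_measurable U_measurable by auto
    have ae: "AE \<omega> in M. norm (S t \<omega> - U t \<omega>) powr p \<le> \<eta> t powr p * norm (U 0 \<omega>) powr p"
      using \<eta>(3)
    proof eventually_elim
      case (elim \<omega>)
      then have "norm (S t \<omega> - U t \<omega>) powr p \<le> (\<eta> t * norm (U 0 \<omega>)) powr p"
        using t p by (intro powr_mono2) auto
      then show ?case by (simp add: powr_mult)
    qed
    have i: "integrable M (\<lambda>\<omega>. \<eta> t powr p * norm (U 0 \<omega>) powr p)" using int by (rule integrable_mult_right)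
    show V1: "integrable M (\<lambda>\<omega>. norm (S t \<omega> - U t \<omega>) powr p)"
      by (rule Bochner_Integration.integrable_bound[OF i]) (use ae in auto)
    have "expectation (\<lambda>\<omega>. norm (S t \<omega> - U t \<omega>) powr p) \<le> expectation (\<lambda>\<omega>. \<eta> t powr p * norm (U 0 \<omega>) powr p)"
      by (rule integral_mono_AE[OF V1 i ae])
    also have "\<dots> = \<eta> t powr p * C" unfolding C_def by (rule integral_mult_right_zero)
    also have "\<eta> t powr p * C \<le> \<eta> t powr p * (C + 1)" by (intro mult_left_mono) auto
    also have "\<dots> = b t powr p"
      using p C by (simp add: b_def powr_mult powr_powr)
    finally show "expectation (\<lambda>\<omega>. norm (S t \<omega> - U t \<omega>) powr p) \<le> b t powr p" .
  qed
  have intS: "integrable M (\<lambda>\<omega>. norm (y + S t \<omega>) powr p)" if t: "t \<ge> 0" for t y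
  proof -
    have [measurable]: "S t \<in> borel_measurable M" "U t \<in> borel_measurable M" using t S_measurable U_measurable by auto
    have "integrable M (\<lambda>\<omega>. norm ((S t \<omega> - U t \<omega>) + U t \<omega>) powr p)"
      by (rule integrable_norm_powr_add[OF p _ _ V(1)[OF t] intU[OF t]]) auto
    then have "integrable M (\<lambda>\<omega>. norm (S t \<omega>) powr p)" by simp
    then show ?thesis by (intro integrable_norm_powr_add p) auto
  qed
  show ?thesis
  proof (intro exI[of _ b] conjI allI impI)
    have "(b \<longlongrightarrow> 0 * (C + 1) powr (1 / p)) at_top" unfolding b_def by (intro tendsto_mult tendsto_const \<eta>)
    then show "(b \<longlongrightarrow> 0) at_top" by simp
    fix t :: real assume t: "t \<ge> 0"
    have [measurable]: "S t \<in> borel_measurable M" "U t \<in> borel_measurable M" using t S_measurable U_measurable by auto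
    fix y
    show "(\<lambda>\<omega>. y + S t \<omega>) \<in> borel_measurable M" by measurable
    have "expectation (U t) = (\<integral>x. x \<partial>distr M borel (U t))" by (rule integral_distr[symmetric]) auto
    also have "\<dots> = expectation (U 0)" unfolding distr_U[OF t] by (rule integral_distr) (auto intro: U_measurable)
    also have "\<dots> = 0" using integrable_of_norm_powr[OF p U_measurable int] by (intro expectation_U_0) auto
    finally show "expectation (\<lambda>\<omega>. y + S t \<omega>) - expectation (U t) = y"
      using integrable.intros[OF mean[OF t]] has_bochner_integral_integral_eq[OF mean[OF t]]
      by (simp add: prob_space)
    have "b t > 0" using \<eta>(2)[of t] C by (simp add: b_def)
    then have "(expectation (\<lambda>\<omega>. norm (y + (S t \<omega> - U t \<omega>)) powr p)) powr (1 / p) \<le> norm y + b t"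
      by (intro Lp_norm_translate_le p V t) auto
    then show "(expectation (\<lambda>\<omega>. norm (y + S t \<omega> - U t \<omega>) powr p)) powr (1 / p) \<le> norm y + b t"
      by (simp add: add_diff_eq)
    show "integrable M (\<lambda>\<omega>. norm (y + S t \<omega>) powr p)" "integrable M (\<lambda>\<omega>. norm (U t \<omega>) powr p)"
      by (fact intS[OF t], fact intU[OF t])
  qed
qed

end

section \<open>Asymptotics along the cut-off window\<close>

lemma complex_vec_nth [simp]: "complex_vec x $ i = complex_of_real (x $ i)"
  by (simp add: complex_vec_def)

lemma norm_complex_vec [simp]: "norm (complex_vec x) = norm x"
  by (simp add: norm_vec_def)

lemma complex_vec_scaleR: "complex_vec (c *\<^sub>R x) = c *\<^sub>R complex_vec x"
  by (simp add: vec_eq_iff complex_eq_iff)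

lemma norm_oscillation_le: "norm (oscillation k \<theta> v t) \<le> (\<Sum>j=1..k. norm (v j))"
  unfolding oscillation_def by (rule sum_norm_le) (simp add: norm_vector_scalar_mult)

text \<open>The oscillation is complex-valued but asymptotic to real vectors, so its limit points
  are real; hence \<open>omega_limit_set\<close> can be a set of real vectors without losing
  any.\<close>

lemma limit_of_complex_vec:
  assumes "(\<lambda>n. norm (complex_vec (a n) - f n)) \<longlonglongrightarrow> 0" "f \<longlonglongrightarrow> l"
  obtains v where "l = complex_vec v"
proof -
  have "(\<lambda>n. complex_vec (a n) - f n) \<longlonglongrightarrow> 0" using assms(1) by (rule tendsto_norm_zero_cancel)
  from tendsto_add[OF this assms(2)] have "(\<lambda>n. complex_vec (a n)) \<longlonglongrightarrow> l" by simp
  then have "(\<lambda>n. Im (complex_vec (a n) $ i)) \<longlonglongrightarrow> Im (l $ i)" for i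
    by (intro tendsto_Im tendsto_vec_nth)
  then have "Im (l $ i) = 0" for i by (simp add: LIMSEQ_const_iff)
  then have "l = complex_vec (\<chi> i. Re (l $ i))" by (simp add: vec_eq_iff complex_eq_iff)
  then show thesis by (rule that)
qed

text \<open>Boundedness makes the lower limit a real number \<open>l\<close>; near 0 the function is
  eventually above \<open>l - d\<close> and frequently below \<open>l + d\<close>, and points chosen
  for \<open>d = inverse (real (Suc n))\<close> form the sequence.\<close>

lemma Liminf_at_right_0_attained:
  fixes f :: "real \<Rightarrow> real"
  assumes "\<forall>\<^sub>F x in at_right 0. \<bar>f x\<bar> \<le> B"
  obtains e l where "filterlim e (at_right 0) sequentially" "(\<lambda>n. f (e n)) \<longlonglongrightarrow> l"
    "Liminf (at_right 0) (\<lambda>x. ereal (f x)) = ereal l"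
proof -
  define L where "L = Liminf (at_right 0) (\<lambda>x. ereal (f x))"
  have "ereal (- B) \<le> L" unfolding L_def
    by (rule Liminf_bounded, rule eventually_mono[OF assms]) auto
  moreover have "L \<le> ereal B" unfolding L_def
    by (rule order_trans[OF Liminf_le_Limsup Limsup_bounded], simp, rule eventually_mono[OF assms]) auto
  ultimately obtain l where l: "L = ereal l" by (cases L) auto
  have "\<exists>x. 0 < x \<and> x < inverse (real (Suc n)) \<and> \<bar>f x - l\<bar> < inverse (real (Suc n))" for n
  proof -
    define d where "d = inverse (real (Suc n))"
    have d: "d > 0" by (simp add: d_def)
    have "\<not> (\<forall>\<^sub>F x in at_right 0. ereal (l + d) \<le> ereal (f x))"
    proof
      assume "\<forall>\<^sub>F x in at_right 0. ereal (l + d) \<le> ereal (f x)"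
      then have "ereal (l + d) \<le> L" unfolding L_def by (rule Liminf_bounded)
      with l d show False by simp
    qed
    then have 1: "\<exists>\<^sub>F x in at_right 0. f x < l + d"
      by (simp add: frequently_def not_less)
    have "ereal (l - d) < L" using l d by simp
    then have 2: "\<forall>\<^sub>F x in at_right 0. ereal (l - d) < ereal (f x)"
      unfolding L_def by (rule less_LiminfD)
    have 3: "\<forall>\<^sub>F x in at_right 0. 0 < x \<and> x < d"
      using eventually_at_right_real[OF d] by (rule eventually_mono) auto
    from frequently_ex[OF frequently_eventually_frequently[OF 1 eventually_conj[OF 2 3]]]
    show ?thesis unfolding d_def[symmetric] by auto
  qed
  then obtain e where e: "\<And>n. 0 < e n" "\<And>n. e n < inverse (real (Suc n))" "\<And>n. \<bar>f (e n) - l\<bar> < inverse (real (Suc n))"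
    by metis
  have e0: "e \<longlonglongrightarrow> 0"
    by (rule tendsto_sandwich[OF _ _ tendsto_const LIMSEQ_inverse_real_of_nat])
      (use e(1,2) in \<open>auto intro!: always_eventually less_imp_le\<close>)
  have "filterlim e (at_right 0) sequentially"
    using e0 e(1) by (intro filterlim_at_withinI) (auto intro!: always_eventually)
  moreover have "(\<lambda>n. f (e n) - l) \<longlonglongrightarrow> 0"
    by (rule Lim_null_comparison[OF _ LIMSEQ_inverse_real_of_nat])
      (use e(3) in \<open>auto intro!: always_eventually less_imp_le\<close>)
  then have "(\<lambda>n. f (e n)) \<longlonglongrightarrow> l" by (rule LIM_zero_cancel)
  ultimately show thesis using l that unfolding L_def by blast
qed

lemma Limsup_at_right_0_attained:
  fixes f :: "real \<Rightarrow> real"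
  assumes "\<forall>\<^sub>F x in at_right 0. \<bar>f x\<bar> \<le> B"
  obtains e l where "filterlim e (at_right 0) sequentially" "(\<lambda>n. f (e n)) \<longlonglongrightarrow> l"
    "Limsup (at_right 0) (\<lambda>x. ereal (f x)) = ereal l"
proof -
  have "\<forall>\<^sub>F x in at_right 0. \<bar>- f x\<bar> \<le> B" using assms by simp
  then obtain e l where e: "filterlim e (at_right 0) sequentially" "(\<lambda>n. - f (e n)) \<longlonglongrightarrow> l"
    and l: "Liminf (at_right 0) (\<lambda>x. ereal (- f x)) = ereal l"
    by (rule Liminf_at_right_0_attained)
  have "Limsup (at_right 0) (\<lambda>x. ereal (f x)) = - Liminf (at_right 0) (\<lambda>x. ereal (- f x))"
    using ereal_Liminf_uminus[of "at_right 0" "\<lambda>x. ereal (f x)"] by simp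
  then show thesis using that[OF e(1), of "- l"] tendsto_minus[OF e(2)] l by simp
qed

locale asymptotic_flow =
  fixes \<Lambda> :: "real^'m^'m" and x :: "real^'m" and lam :: real and ell k :: nat
    and \<theta> :: "nat \<Rightarrow> real" and vs :: "nat \<Rightarrow> complex^'m"
  assumes asym: "flow_asymptotics \<Lambda> x lam ell k \<theta> vs"
begin

abbreviation "osc \<equiv> oscillation k \<theta> vs"
abbreviation "\<omega>x \<equiv> omega_limit_set osc"

definition "sup_osc = (\<Sum>j=1..k. norm (vs j))"

lemma lam_pos: "lam > 0" and ell_ge: "ell \<ge> 1"
  and flow_limit: "((\<lambda>t. norm (complex_vec ((exp (lam * t) / t ^ (ell - 1)) *\<^sub>R (matrix_exp (- t *\<^sub>R \<Lambda>) *v x)) - osc t)) \<longlongrightarrow> 0) at_top"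
  and osc_liminf: "0 < Liminf at_top (\<lambda>t. ereal (norm (osc t)))"
  using asym by (auto simp: flow_asymptotics_def)

lemma norm_osc_le: "norm (osc t) \<le> sup_osc"
  unfolding sup_osc_def by (rule norm_oscillation_le)

lemma omega_subsequence:
  assumes \<tau>: "filterlim \<tau> at_top sequentially"
  obtains r v where "strict_mono (r :: nat \<Rightarrow> nat)" "v \<in> \<omega>x" "(\<lambda>n. osc (\<tau> (r n))) \<longlonglongrightarrow> complex_vec v"
proof -
  have "bounded (range (\<lambda>n. osc (\<tau> n)))" using norm_osc_le by (auto simp: bounded_iff)
  from bounded_imp_convergent_subsequence[OF this]
  obtain l r where r: "strict_mono (r :: nat \<Rightarrow> nat)" and l: "((\<lambda>n. osc (\<tau> n)) \<circ> r) \<longlonglongrightarrow> l" by blast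
  have \<tau>r: "filterlim (\<lambda>n. \<tau> (r n)) at_top sequentially"
    using filterlim_compose[OF \<tau> filterlim_subseq[OF r]] .
  have l': "(\<lambda>n. osc (\<tau> (r n))) \<longlonglongrightarrow> l" using l by (simp add: o_def)
  obtain v where "l = complex_vec v"
    by (rule limit_of_complex_vec[OF filterlim_compose[OF flow_limit \<tau>r] l'])
  with l' \<tau>r have "v \<in> \<omega>x" unfolding omega_limit_set_def by blast
  with r l' \<open>l = complex_vec v\<close> show thesis using that by blast
qed

lemma omega_norm_bounds:
  obtains \<mu> where "\<mu> > 0" "\<And>v. v \<in> \<omega>x \<Longrightarrow> \<mu> \<le> norm v" "\<And>v. v \<in> \<omega>x \<Longrightarrow> norm v \<le> sup_osc"
proof -
  \<comment> \<open>A positive lower limit leaves room for a real \<open>\<mu>\<close> below it, and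
    the bound by \<open>\<mu>\<close> passes to all limit points at once.\<close>
  obtain \<mu>' where "0 < \<mu>'" "\<mu>' < Liminf at_top (\<lambda>t. ereal (norm (osc t)))"
    using dense[OF osc_liminf] by blast
  then obtain \<mu> where \<mu>: "\<mu> > 0" "ereal \<mu> < Liminf at_top (\<lambda>t. ereal (norm (osc t)))"
    by (cases \<mu>') auto
  then have ev: "\<forall>\<^sub>F t in at_top. \<mu> < norm (osc t)"
    using less_LiminfD[OF \<mu>(2)] by simp
  have "\<mu> \<le> norm v \<and> norm v \<le> sup_osc" if "v \<in> \<omega>x" for v
  proof -
    from that obtain \<tau> where \<tau>: "filterlim \<tau> at_top sequentially" "(\<lambda>n. osc (\<tau> n)) \<longlonglongrightarrow> complex_vec v"
      unfolding omega_limit_set_def by blast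
    have n: "(\<lambda>n. norm (osc (\<tau> n))) \<longlonglongrightarrow> norm v" using tendsto_norm[OF \<tau>(2)] by simp
    have "\<forall>\<^sub>F n in sequentially. \<mu> \<le> norm (osc (\<tau> n))"
      using eventually_compose_filterlim[OF ev \<tau>(1)] by (rule eventually_mono) simp
    from tendsto_lowerbound[OF n this] tendsto_upperbound[OF n always_eventually] norm_osc_le
    show ?thesis by simp
  qed
  with \<mu>(1) show thesis using that by blast
qed

lemma omega_nonempty: "\<omega>x \<noteq> {}"
  using omega_subsequence[OF filterlim_real_sequentially] by blast

text \<open>Along a sequence realising the lower or upper limit, a further subsequence lets the
  oscillation converge to some \<open>v\<close> in \<open>\<omega>x\<close>, and the limit value
  must be \<open>c * norm v\<close>.\<close>

lemma limits_along_osc: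
  assumes T: "filterlim T at_top (at_right (0::real))"
    and f: "((\<lambda>e. f e - c * norm (osc (T e))) \<longlongrightarrow> 0) (at_right 0)" and c: "c \<ge> 0"
  shows "\<exists>v\<in>\<omega>x. Liminf (at_right 0) (\<lambda>e. ereal (f e)) = ereal (c * norm v)"
    and "\<exists>v\<in>\<omega>x. Limsup (at_right 0) (\<lambda>e. ereal (f e)) = ereal (c * norm v)"
proof -
  have "\<forall>\<^sub>F e in at_right 0. \<bar>f e - c * norm (osc (T e))\<bar> < 1"
    using tendstoD[OF f, of 1] by (simp add: dist_real_def)
  then have bd: "\<forall>\<^sub>F e in at_right 0. \<bar>f e\<bar> \<le> 1 + c * sup_osc"
  proof (rule eventually_mono)
    fix e assume "\<bar>f e - c * norm (osc (T e))\<bar> < 1"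
    moreover have "c * norm (osc (T e)) \<le> c * sup_osc" "0 \<le> c * norm (osc (T e))"
      using c norm_osc_le by (auto intro: mult_left_mono)
    ultimately show "\<bar>f e\<bar> \<le> 1 + c * sup_osc" by linarith
  qed
  have key: "\<exists>v\<in>\<omega>x. l = c * norm v"
    if e: "filterlim e (at_right 0) sequentially" "(\<lambda>n. f (e n)) \<longlonglongrightarrow> l" for e l
  proof -
    obtain r v where r: "strict_mono (r :: nat \<Rightarrow> nat)" "v \<in> \<omega>x" "(\<lambda>n. osc (T (e (r n)))) \<longlonglongrightarrow> complex_vec v"
      using omega_subsequence[OF filterlim_compose[OF T e(1)]] by blast
    have er: "filterlim (\<lambda>n. e (r n)) (at_right 0) sequentially"
      using filterlim_compose[OF e(1) filterlim_subseq[OF r(1)]] .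
    have "(\<lambda>n. f (e (r n)) - c * norm (osc (T (e (r n))))) \<longlonglongrightarrow> 0"
      using filterlim_compose[OF f er] .
    from tendsto_add[OF this tendsto_mult[OF tendsto_const tendsto_norm[OF r(3)], of c]]
    have "(\<lambda>n. f (e (r n))) \<longlonglongrightarrow> c * norm v" by simp
    moreover have "(\<lambda>n. f (e (r n))) \<longlonglongrightarrow> l"
      using LIMSEQ_subseq_LIMSEQ[OF e(2) r(1)] by (simp add: o_def)
    ultimately have "l = c * norm v" using LIMSEQ_unique by blast
    with r(2) show ?thesis by blast
  qed
  show "\<exists>v\<in>\<omega>x. Liminf (at_right 0) (\<lambda>e. ereal (f e)) = ereal (c * norm v)"
  proof -
    obtain e l where "filterlim e (at_right 0) sequentially" "(\<lambda>n. f (e n)) \<longlonglongrightarrow> l"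
      "Liminf (at_right 0) (\<lambda>x. ereal (f x)) = ereal l" by (rule Liminf_at_right_0_attained[OF bd])
    with key show ?thesis by blast
  qed
  show "\<exists>v\<in>\<omega>x. Limsup (at_right 0) (\<lambda>e. ereal (f e)) = ereal (c * norm v)"
  proof -
    obtain e l where "filterlim e (at_right 0) sequentially" "(\<lambda>n. f (e n)) \<longlonglongrightarrow> l"
      "Limsup (at_right 0) (\<lambda>x. ereal (f x)) = ereal l" by (rule Limsup_at_right_0_attained[OF bd])
    with key show ?thesis by blast
  qed
qed

section \<open>Time scale of the cut-off window\<close>

context
  fixes w :: "real \<Rightarrow> real" and w0 r :: real
  assumes w: "(w \<longlongrightarrow> w0) (at_right 0)"
begin

definition "cut_time e = t_cut lam ell e + r * w e"

lemma ln_inverse_at_top: "filterlim (\<lambda>e::real. ln (1 / e)) at_top (at_right 0)"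
  by real_asymp

lemma cut_time_eq: "cut_time e = 1 / lam * ln (1 / e) + (real ell - 1) / lam * ln (ln (1 / e)) + r * w e"
  using lam_pos by (simp add: cut_time_def t_cut_def t_star_def)

text \<open>Only the leading term of the cut-off time survives; the ratio later enters with the
  power \<open>ell - 1\<close>.\<close>

lemma cut_time_ratio: "((\<lambda>e. cut_time e / ln (1 / e)) \<longlongrightarrow> 1 / lam) (at_right 0)"
proof -
  have 1: "((\<lambda>e. ln (ln (1 / e)) / ln (1 / e)) \<longlongrightarrow> 0) (at_right (0::real))" by real_asymp
  have 2: "((\<lambda>e. w e / ln (1 / e)) \<longlongrightarrow> 0) (at_right 0)"
    by (rule tendsto_divide_0[OF w filterlim_at_top_imp_at_infinity[OF ln_inverse_at_top]])
  have "((\<lambda>e. 1 / lam + (real ell - 1) / lam * (ln (ln (1 / e)) / ln (1 / e)) + r * (w e / ln (1 / e)))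
      \<longlongrightarrow> 1 / lam + (real ell - 1) / lam * 0 + r * 0) (at_right 0)"
    by (intro tendsto_intros 1 2)
  moreover have "\<forall>\<^sub>F e in at_right 0. 1 / lam + (real ell - 1) / lam * (ln (ln (1 / e)) / ln (1 / e)) + r * (w e / ln (1 / e))
      = cut_time e / ln (1 / e)"
    using filterlim_at_top_dense[THEN iffD1, OF ln_inverse_at_top, rule_format, of 0]
  proof (rule eventually_mono)
    fix e :: real assume e: "0 < ln (1 / e)"
    have "cut_time e / ln (1 / e) = (1 / lam * ln (1 / e)) / ln (1 / e) + (real ell - 1) / lam * ln (ln (1 / e)) / ln (1 / e) + r * w e / ln (1 / e)"
      by (simp only: cut_time_eq add_divide_distrib)
    then show "1 / lam + (real ell - 1) / lam * (ln (ln (1 / e)) / ln (1 / e)) + r * (w e / ln (1 / e)) = cut_time e / ln (1 / e)"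
      using e by simp
  qed
  ultimately have "((\<lambda>e. cut_time e / ln (1 / e)) \<longlongrightarrow> 1 / lam + (real ell - 1) / lam * 0 + r * 0) (at_right 0)"
    by (rule Lim_transform_eventually)
  then show ?thesis by simp
qed

lemma cut_time_at_top: "filterlim cut_time at_top (at_right 0)"
proof -
  have "filterlim (\<lambda>e. cut_time e / ln (1 / e) * ln (1 / e)) at_top (at_right 0)"
    by (rule filterlim_tendsto_pos_mult_at_top[OF cut_time_ratio _ ln_inverse_at_top]) (use lam_pos in simp)
  moreover have "\<forall>\<^sub>F e in at_right 0. cut_time e / ln (1 / e) * ln (1 / e) = cut_time e"
    using filterlim_at_top_dense[THEN iffD1, OF ln_inverse_at_top, rule_format, of 0]
    by (rule eventually_mono) simp
  ultimately show ?thesis by (rule filterlim_mono_eventually[OF _ order_refl order_refl])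
qed

text \<open>The double logarithm in \<open>t_cut\<close>, once exponentiated, becomes the power
  \<open>ln (1 / e) ^ (ell - 1)\<close>, which balances the polynomial factor of the flow.\<close>

lemma scaling_factor:
  assumes "0 < e" "0 < ln (1 / e)" "0 < cut_time e"
  shows "cut_time e ^ (ell - 1) / (exp (lam * cut_time e) * e) = (cut_time e / ln (1 / e)) ^ (ell - 1) * exp (- lam * r * w e)"
proof -
  define L where "L = ln (1 / e)"
  have eL: "e = exp (- L)" using assms(1) by (simp add: L_def ln_div)
  have "lam * cut_time e = L + (real ell - 1) * ln L + lam * r * w e"
    unfolding cut_time_eq L_def[symmetric] distrib_left using lam_pos by simp
  then have "exp (lam * cut_time e) * e = exp L * exp ((real ell - 1) * ln L) * exp (lam * r * w e) * exp (- L)"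
    by (simp only: exp_add) (simp only: eL)
  also have "\<dots> = exp ((real ell - 1) * ln L) * exp (lam * r * w e)"
    by (simp add: exp_minus)
  also have "exp ((real ell - 1) * ln L) = L ^ (ell - 1)"
  proof -
    \<comment> \<open>Natural subtraction: \<open>ell \<ge> 1\<close> makes it agree with the real
      exponent.\<close>
    have "real ell - 1 = real (ell - 1)" using ell_ge by simp
    moreover have "exp (ln L) = L" using assms(2) by (intro exp_ln) (simp only: L_def)
    ultimately show ?thesis by (simp only: exp_of_nat_mult)
  qed
  finally have eq: "exp (lam * cut_time e) * e = L ^ (ell - 1) * exp (lam * r * w e)" .
  have "exp (- lam * r * w e) = 1 / exp (lam * r * w e)" by (simp add: exp_minus inverse_eq_divide)
  then show ?thesis by (simp only: eq L_def[symmetric] power_divide times_divide_times_eq mult_1_right)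
qed

lemma rescaled_flow_limit:
  defines "c \<equiv> lam powr (1 - real ell) * exp (- lam * r * w0)"
  shows "((\<lambda>e. norm ((1 / e) *\<^sub>R (matrix_exp (- cut_time e *\<^sub>R \<Lambda>) *v x)) - c * norm (osc (cut_time e))) \<longlongrightarrow> 0) (at_right 0)"
proof -
  \<comment> \<open>For small \<open>e\<close>, \<open>\<phi> e\<close> is the ratio of
    \<open>1 / e\<close> to the normalisation \<open>exp (lam * t) / t ^ (ell - 1)\<close> at
    \<open>t = cut_time e\<close>; it converges even where the oscillation does not.\<close>
  define \<phi> where "\<phi> = (\<lambda>e. (cut_time e / ln (1 / e)) ^ (ell - 1) * exp (- lam * r * w e))"
  define a where "a = (\<lambda>t. complex_vec ((exp (lam * t) / t ^ (ell - 1)) *\<^sub>R (matrix_exp (- t *\<^sub>R \<Lambda>) *v x)))"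
  have "(\<phi> \<longlongrightarrow> (1 / lam) ^ (ell - 1) * exp (- lam * r * w0)) (at_right 0)"
    unfolding \<phi>_def by (intro tendsto_intros cut_time_ratio w)
  moreover have "(1 / lam) ^ (ell - 1) = lam powr (1 - real ell)"
  proof -
    have "1 - real ell = - real (ell - 1)" using ell_ge by simp
    then show ?thesis
      by (simp only: powr_minus powr_realpow[OF lam_pos] power_one_over inverse_eq_divide)
  qed
  ultimately have \<phi>: "(\<phi> \<longlongrightarrow> c) (at_right 0)" unfolding c_def by (simp only:)
  have a: "((\<lambda>e. a (cut_time e) - osc (cut_time e)) \<longlongrightarrow> 0) (at_right 0)"
    using filterlim_compose[OF tendsto_norm_zero_cancel[OF flow_limit] cut_time_at_top] unfolding a_def .
  have "((\<lambda>e. \<phi> e *\<^sub>R (a (cut_time e) - osc (cut_time e))) \<longlongrightarrow> c *\<^sub>R 0) (at_right 0)"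
    by (intro tendsto_scaleR \<phi> a)
  \<comment> \<open>The oscillation need not have a limit, so its boundedness has to carry this
    term.\<close>
  moreover have "((\<lambda>e. (\<phi> e - c) *\<^sub>R osc (cut_time e)) \<longlongrightarrow> 0) (at_right 0)"
  proof (rule Lim_null_comparison)
    show "\<forall>\<^sub>F e in at_right 0. norm ((\<phi> e - c) *\<^sub>R osc (cut_time e)) \<le> \<bar>\<phi> e - c\<bar> * sup_osc"
      by (intro always_eventually allI) (simp add: mult_left_mono norm_osc_le)
    have "((\<lambda>e. \<bar>\<phi> e - c\<bar> * sup_osc) \<longlongrightarrow> \<bar>c - c\<bar> * sup_osc) (at_right 0)"
      by (intro tendsto_intros \<phi>)
    then show "((\<lambda>e. \<bar>\<phi> e - c\<bar> * sup_osc) \<longlongrightarrow> 0) (at_right 0)" by simp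
  qed
  ultimately have "((\<lambda>e. \<phi> e *\<^sub>R (a (cut_time e) - osc (cut_time e)) + (\<phi> e - c) *\<^sub>R osc (cut_time e)) \<longlongrightarrow> c *\<^sub>R 0 + 0) (at_right 0)"
    by (rule tendsto_add)
  then have lim: "((\<lambda>e. norm (\<phi> e *\<^sub>R a (cut_time e) - c *\<^sub>R osc (cut_time e))) \<longlongrightarrow> 0) (at_right 0)"
    by (intro tendsto_norm_zero) (simp add: algebra_simps)
  have c0: "c \<ge> 0" by (simp add: c_def)
  have pos: "\<forall>\<^sub>F e in at_right 0. 0 < e \<and> 0 < ln (1 / e) \<and> 0 < cut_time e"
    using eventually_at_right_less[of 0] filterlim_at_top_dense[THEN iffD1, OF ln_inverse_at_top, rule_format, of 0]
      filterlim_at_top_dense[THEN iffD1, OF cut_time_at_top, rule_format, of 0]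
    by eventually_elim simp
  show ?thesis
  proof (rule Lim_null_comparison[OF _ lim])
    show "\<forall>\<^sub>F e in at_right 0. norm (norm ((1 / e) *\<^sub>R (matrix_exp (- cut_time e *\<^sub>R \<Lambda>) *v x)) - c * norm (osc (cut_time e)))
        \<le> norm (\<phi> e *\<^sub>R a (cut_time e) - c *\<^sub>R osc (cut_time e))"
      using pos
    proof (rule eventually_mono)
      fix e assume e: "0 < e \<and> 0 < ln (1 / e) \<and> 0 < cut_time e"
      have "\<phi> e = cut_time e ^ (ell - 1) / (exp (lam * cut_time e) * e)" using scaling_factor[of e] e by (simp add: \<phi>_def)
      then have "\<phi> e * (exp (lam * cut_time e) / cut_time e ^ (ell - 1)) = 1 / e" using e by simp
      then have "\<phi> e *\<^sub>R a (cut_time e) = complex_vec ((1 / e) *\<^sub>R (matrix_exp (- cut_time e *\<^sub>R \<Lambda>) *v x))"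
        unfolding a_def complex_vec_scaleR by (simp only: scaleR_scaleR)
      then have "norm ((1 / e) *\<^sub>R (matrix_exp (- cut_time e *\<^sub>R \<Lambda>) *v x)) = norm (\<phi> e *\<^sub>R a (cut_time e))"
        by (metis norm_complex_vec)
      moreover have "c * norm (osc (cut_time e)) = norm (c *\<^sub>R osc (cut_time e))" using c0 by simp
      ultimately show "norm (norm ((1 / e) *\<^sub>R (matrix_exp (- cut_time e *\<^sub>R \<Lambda>) *v x)) - c * norm (osc (cut_time e)))
          \<le> norm (\<phi> e *\<^sub>R a (cut_time e) - c *\<^sub>R osc (cut_time e))"
        by (simp only: real_norm_def) (rule norm_triangle_ineq3)
    qed
  qed
qed

end

end

theorem proposition4p1:
  fixes M :: "'a measure" and \<Lambda> :: "real^'m^'m"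
    and D S U :: "real \<Rightarrow> 'a \<Rightarrow> real^'m"
  assumes "prob_space M"
    and "Routh_Hurwitz (- \<Lambda>)"
    and "square_integrable_process M D"
    and "stationary_increments M D"
    and "S = (\<lambda>t. kernel_integral \<Lambda> D 0 t)"
    and "kernel_integrals_defined M \<Lambda> D U"
    and "\<And>t. t \<ge> 0 \<Longrightarrow> has_bochner_integral M (S t) 0"
  shows
    "stationary_process M U \<and>
     (AE \<omega> in M. ((\<lambda>t. S t \<omega> - U t \<omega>) \<longlongrightarrow> 0) at_top) \<and>
     (\<forall>p\<ge>1. integrable M (\<lambda>\<omega>. norm (U 0 \<omega>) powr p) \<longrightarrow>
        ((\<lambda>t. \<integral>\<^sup>+\<omega>. ennreal (norm (S t \<omega> - U t \<omega>) powr p) \<partial>M) \<longlongrightarrow> 0) at_top) \<and>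
     (\<forall>(p::real) (x::real^'m)
        (N::'b measure) (Z::'b \<Rightarrow> real^'m)
        (Q::'c measure) (X::real \<Rightarrow> real \<Rightarrow> 'c \<Rightarrow> real^'m)
        (lam::real) (ell::nat) (k::nat) (\<theta>::nat \<Rightarrow> real) (vs::nat \<Rightarrow> complex^'m)
        (\<omega>x::(real^'m) set) (w::real \<Rightarrow> real) (w0::real).
        p \<ge> 1 \<longrightarrow> integrable M (\<lambda>\<omega>. norm (U 0 \<omega>) powr p) \<longrightarrow>
        x \<noteq> 0 \<longrightarrow>
        prob_space N \<longrightarrow> Z \<in> borel_measurable N \<longrightarrow>
        distr N borel Z = distr M borel (U 0) \<longrightarrow>
        prob_space Q \<longrightarrow>
        (\<forall>\<epsilon>>0. \<forall>t\<ge>0. X \<epsilon> t \<in> borel_measurable Q \<and>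
           distr Q borel (X \<epsilon> t)
             = distr M borel (\<lambda>\<omega>. matrix_exp (- t *\<^sub>R \<Lambda>) *v x + \<epsilon> *\<^sub>R S t \<omega>)) \<longrightarrow>
        flow_asymptotics \<Lambda> x lam ell k \<theta> vs \<longrightarrow>
        \<omega>x = omega_limit_set (oscillation k \<theta> vs) \<longrightarrow>
        w0 > 0 \<longrightarrow> (w \<longlongrightarrow> w0) (at_right 0) \<longrightarrow>
        (let c = (\<lambda>r. lam powr (1 - real ell) * exp (- lam * r * w0));
             W = (\<lambda>r \<epsilon>. wasserstein p Q (\<lambda>\<omega>. (1 / \<epsilon>) *\<^sub>R X \<epsilon> (t_cut lam ell \<epsilon> + r * w \<epsilon>) \<omega>) N Z);
             W_shift = (\<lambda>u. wasserstein p N (\<lambda>\<omega>. u + Z \<omega>) N Z);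
             W_inf = (\<lambda>r. Liminf (at_right 0) (\<lambda>\<epsilon>. ereal (W r \<epsilon>)));
             W_sup = (\<lambda>r. Limsup (at_right 0) (\<lambda>\<epsilon>. ereal (W r \<epsilon>)))
         in
           ((\<lambda>t. wasserstein p M (S t) N Z) \<longlongrightarrow> 0) at_top \<and>
           (\<forall>r. \<exists>v1\<in>\<omega>x. \<exists>v2\<in>\<omega>x.
              W_inf r = ereal (W_shift (c r *\<^sub>R v1)) \<and> W_shift (c r *\<^sub>R v1) = c r * norm v1 \<and>
              W_sup r = ereal (W_shift (c r *\<^sub>R v2)) \<and> W_shift (c r *\<^sub>R v2) = c r * norm v2) \<and>
           (W_inf \<longlongrightarrow> \<infinity>) at_bot \<and>
           (W_sup \<longlongrightarrow> 0) at_top \<and>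
           (\<forall>\<rho>>0. \<forall>v\<in>\<omega>x. W_shift (\<rho> *\<^sub>R v) = \<rho> * norm v) \<and>
           ((\<forall>r. \<forall>v\<in>\<omega>x. (W r \<longlongrightarrow> W_shift (c r *\<^sub>R v)) (at_right 0)) \<longleftrightarrow>
            (\<forall>\<rho>>0. (\<lambda>v. W_shift (\<rho> *\<^sub>R v)) constant_on \<omega>x))))"
proof -
  interpret kernel_process M \<Lambda> D S U
    by (intro kernel_process.intro kernel_process_axioms.intro assms)
  show ?thesis
  proof (intro conjI allI impI, goal_cases)
    case 1
    show ?case by (rule stationary_kernel_process[OF assms(1,4,6)])
  next
    case 2
    show ?case by (rule S_minus_U_tendsto_0)
  next
    case (3 p)
    then show ?case by (rule S_minus_U_tendsto_0_Lp)
  next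
    case (4 p x N Z Q X lam ell k \<theta> vs \<omega>x w w0)
    note p = 4(1) and int = 4(2) and N = 4(4) and Z = 4(5) and lawZ = 4(6) and X = 4(8)
      and flow = 4(9) and \<omega>x = 4(10) and w0 = 4(11) and w = 4(12)
    interpret A: asymptotic_flow \<Lambda> x lam ell k \<theta> vs by (rule asymptotic_flow.intro[OF flow])
    define c where "c = (\<lambda>r. lam powr (1 - real ell) * exp (- lam * r * w0))"
    define W where "W = (\<lambda>r \<epsilon>. wasserstein p Q (\<lambda>\<omega>. (1 / \<epsilon>) *\<^sub>R X \<epsilon> (t_cut lam ell \<epsilon> + r * w \<epsilon>) \<omega>) N Z)"
    define W_shift where "W_shift = (\<lambda>u. wasserstein p N (\<lambda>\<omega>. u + Z \<omega>) N Z)"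
    define W_inf where "W_inf = (\<lambda>r. Liminf (at_right 0) (\<lambda>\<epsilon>. ereal (W r \<epsilon>)))"
    define W_sup where "W_sup = (\<lambda>r. Limsup (at_right 0) (\<lambda>\<epsilon>. ereal (W r \<epsilon>)))"
    have c_pos: "c r > 0" for r using A.lam_pos by (simp add: c_def)
    from translated_S_Lp_bounds[OF p int] obtain b where b: "(b \<longlongrightarrow> 0) at_top \<and> (\<forall>t\<ge>0. \<forall>y.
        (\<lambda>\<omega>. y + S t \<omega>) \<in> borel_measurable M \<and>
        integrable M (\<lambda>\<omega>. norm (y + S t \<omega>) powr p) \<and>
        integrable M (\<lambda>\<omega>. norm (U t \<omega>) powr p) \<and>
        expectation (\<lambda>\<omega>. y + S t \<omega>) - expectation (U t) = y \<and>
        (expectation (\<lambda>\<omega>. norm (y + S t \<omega> - U t \<omega>) powr p)) powr (1 / p) \<le> norm y + b t)" ..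
    then have b0: "(b \<longlongrightarrow> 0) at_top" by (rule conjunct1)
    have bS: "(\<lambda>\<omega>. y + S t \<omega>) \<in> borel_measurable M"
        "integrable M (\<lambda>\<omega>. norm (y + S t \<omega>) powr p)"
        "integrable M (\<lambda>\<omega>. norm (U t \<omega>) powr p)"
        "expectation (\<lambda>\<omega>. y + S t \<omega>) - expectation (U t) = y"
        "(expectation (\<lambda>\<omega>. norm (y + S t \<omega> - U t \<omega>) powr p)) powr (1 / p) \<le> norm y + b t" if "t \<ge> 0" for t y
    proof -
      note bb = conjunct2[OF b, THEN spec[of _ t], THEN mp, OF that, THEN spec[of _ y]]
      show "(\<lambda>\<omega>. y + S t \<omega>) \<in> borel_measurable M"
        "integrable M (\<lambda>\<omega>. norm (y + S t \<omega>) powr p)"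
        "integrable M (\<lambda>\<omega>. norm (U t \<omega>) powr p)"
        "expectation (\<lambda>\<omega>. y + S t \<omega>) - expectation (U t) = y"
        "(expectation (\<lambda>\<omega>. norm (y + S t \<omega> - U t \<omega>) powr p)) powr (1 / p) \<le> norm y + b t"
        by (fact bb[THEN conjunct1] bb[THEN conjunct2, THEN conjunct1] bb[THEN conjunct2, THEN conjunct2, THEN conjunct1]
            bb[THEN conjunct2, THEN conjunct2, THEN conjunct2, THEN conjunct1]
            bb[THEN conjunct2, THEN conjunct2, THEN conjunct2, THEN conjunct2])+
    qed
    \<comment> \<open>\<open>Z\<close> has the law of \<open>U t\<close> at every time, so at time
      \<open>t\<close> it is coupled through \<open>U t\<close>, which is close to
      \<open>S t\<close>; \<open>U 0\<close> need not be.\<close>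
    have lawZt: "distr N borel Z = distr M borel (U t)" if "t \<ge> 0" for t
      using lawZ distr_U[OF that] by simp
    have intZ: "integrable N (\<lambda>\<omega>. norm (Z \<omega>) powr p)"
    proof -
      have m: "(\<lambda>z::real^'m. norm z powr p) \<in> borel_measurable borel" by measurable
      have "integrable (distr M borel (U 0)) (\<lambda>z. norm z powr p)"
        using int integrable_distr_eq[OF U_measurable[OF order_refl] m] by simp
      then show ?thesis
        unfolding lawZ[symmetric] using integrable_distr_eq[OF Z m] by simp
    qed
    have shift: "W_shift u = norm u" for u
      unfolding W_shift_def by (rule wasserstein_translate[OF N p Z intZ])
    have part1: "((\<lambda>t. wasserstein p M (S t) N Z) \<longlongrightarrow> 0) at_top"
    proof (rule tendsto_sandwich[OF _ _ tendsto_const b0])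
      have bnds: "0 \<le> wasserstein p M (S t) N Z \<and> wasserstein p M (S t) N Z \<le> b t" if t: "t \<ge> 0" for t
      proof -
        have "distr M borel (S t) = distr M borel (\<lambda>\<omega>. 0 + S t \<omega>)" by simp
        note wb = wasserstein_bounds[OF p bS(1)[OF t] U_measurable[OF t] bS(2)[OF t] bS(3)[OF t] this lawZt[OF t]]
        show ?thesis
          using order_trans[OF norm_ge_zero wb(1)] order_trans[OF wb(2) bS(5)[OF t]] by simp
      qed
      show "\<forall>\<^sub>F t in at_top. 0 \<le> wasserstein p M (S t) N Z"
        by (rule eventually_mono[OF eventually_ge_at_top[of 0]]) (use bnds in blast)
      show "\<forall>\<^sub>F t in at_top. wasserstein p M (S t) N Z \<le> b t"
        by (rule eventually_mono[OF eventually_ge_at_top[of 0]]) (use bnds in blast)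
    qed
    define T where "T = (\<lambda>r. A.cut_time w r)"
    have T_top: "filterlim (T r) at_top (at_right 0)" for r
      unfolding T_def by (rule A.cut_time_at_top[OF w])
    \<comment> \<open>Dividing by \<open>\<epsilon>\<close> leaves unit noise \<open>S\<close> and a
      deterministic shift, the rescaled flow, whose norm is the difference of the means.\<close>
    have Wb: "norm ((1 / \<epsilon>) *\<^sub>R (matrix_exp (- T r \<epsilon> *\<^sub>R \<Lambda>) *v x)) \<le> W r \<epsilon> \<and>
        W r \<epsilon> \<le> norm ((1 / \<epsilon>) *\<^sub>R (matrix_exp (- T r \<epsilon> *\<^sub>R \<Lambda>) *v x)) + b (T r \<epsilon>)"
      if e: "\<epsilon> > 0" and t: "T r \<epsilon> \<ge> 0" for r \<epsilon>
    proof -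
      define y where "y = matrix_exp (- T r \<epsilon> *\<^sub>R \<Lambda>) *v x"
      have XT [measurable]: "X \<epsilon> (T r \<epsilon>) \<in> borel_measurable Q"
        and lawX: "distr Q borel (X \<epsilon> (T r \<epsilon>)) = distr M borel (\<lambda>\<omega>. y + \<epsilon> *\<^sub>R S (T r \<epsilon>) \<omega>)"
        using X e t unfolding y_def by blast+
      have [measurable]: "S (T r \<epsilon>) \<in> borel_measurable M" by (rule S_measurable[OF t])
      have "distr Q borel (\<lambda>\<omega>. (1 / \<epsilon>) *\<^sub>R X \<epsilon> (T r \<epsilon>) \<omega>) = distr (distr Q borel (X \<epsilon> (T r \<epsilon>))) borel (\<lambda>z. (1 / \<epsilon>) *\<^sub>R z)"
        by (subst distr_distr) (simp_all add: o_def)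
      also have "\<dots> = distr M borel (\<lambda>\<omega>. (1 / \<epsilon>) *\<^sub>R (y + \<epsilon> *\<^sub>R S (T r \<epsilon>) \<omega>))"
        unfolding lawX by (subst distr_distr) (simp_all add: o_def)
      also have "(\<lambda>\<omega>. (1 / \<epsilon>) *\<^sub>R (y + \<epsilon> *\<^sub>R S (T r \<epsilon>) \<omega>)) = (\<lambda>\<omega>. (1 / \<epsilon>) *\<^sub>R y + S (T r \<epsilon>) \<omega>)"
        using e by (simp add: scaleR_right_distrib)
      finally have law: "distr Q borel (\<lambda>\<omega>. (1 / \<epsilon>) *\<^sub>R X \<epsilon> (T r \<epsilon>) \<omega>) = distr M borel (\<lambda>\<omega>. (1 / \<epsilon>) *\<^sub>R y + S (T r \<epsilon>) \<omega>)" .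
      note wb = wasserstein_bounds[OF p bS(1)[OF t] U_measurable[OF t] bS(2)[OF t] bS(3)[OF t] law lawZt[OF t]]
      have W: "W r \<epsilon> = wasserstein p Q (\<lambda>\<omega>. (1 / \<epsilon>) *\<^sub>R X \<epsilon> (T r \<epsilon>) \<omega>) N Z"
        unfolding W_def T_def A.cut_time_def[OF w] ..
      show ?thesis
        unfolding W y_def[symmetric]
        using wb(1)[unfolded bS(4)[OF t]] order_trans[OF wb(2) bS(5)[OF t]] by (rule conjI)
    qed
    have W_lim: "((\<lambda>\<epsilon>. W r \<epsilon> - c r * norm (A.osc (T r \<epsilon>))) \<longlongrightarrow> 0) (at_right 0)" for r
    proof -
      define n where "n = (\<lambda>\<epsilon>. norm ((1 / \<epsilon>) *\<^sub>R (matrix_exp (- T r \<epsilon> *\<^sub>R \<Lambda>) *v x)))"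
      have 1: "((\<lambda>\<epsilon>. n \<epsilon> - c r * norm (A.osc (T r \<epsilon>))) \<longlongrightarrow> 0) (at_right 0)"
        using A.rescaled_flow_limit[OF w, of r] unfolding c_def T_def n_def .
      have 2: "((\<lambda>\<epsilon>. W r \<epsilon> - n \<epsilon>) \<longlongrightarrow> 0) (at_right 0)"
      proof (rule Lim_null_comparison[OF _ filterlim_compose[OF b0 T_top]])
        have "\<forall>\<^sub>F \<epsilon> in at_right 0. 0 < \<epsilon> \<and> 0 < T r \<epsilon>"
          using eventually_at_right_less[of 0] filterlim_at_top_dense[THEN iffD1, OF T_top[of r], rule_format, of 0]
          by (rule eventually_conj)
        then show "\<forall>\<^sub>F \<epsilon> in at_right 0. norm (W r \<epsilon> - n \<epsilon>) \<le> b (T r \<epsilon>)"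
        proof (rule eventually_mono)
          fix \<epsilon> assume "0 < \<epsilon> \<and> 0 < T r \<epsilon>"
          then have "n \<epsilon> \<le> W r \<epsilon> \<and> W r \<epsilon> \<le> n \<epsilon> + b (T r \<epsilon>)" unfolding n_def by (intro Wb) auto
          then show "norm (W r \<epsilon> - n \<epsilon>) \<le> b (T r \<epsilon>)" by auto
        qed
      qed
      from tendsto_add[OF 2 1] show ?thesis by simp
    qed
    have inf_v: "\<exists>v\<in>\<omega>x. W_inf r = ereal (c r * norm v)" for r
      unfolding W_inf_def \<omega>x using c_pos[of r] by (intro A.limits_along_osc(1)[OF T_top W_lim]) simp
    have sup_v: "\<exists>v\<in>\<omega>x. W_sup r = ereal (c r * norm v)" for r
      unfolding W_sup_def \<omega>x using c_pos[of r] by (intro A.limits_along_osc(2)[OF T_top W_lim]) simp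
    have shift_c: "W_shift (c r *\<^sub>R v) = c r * norm v" for r v
      using c_pos[of r] by (simp add: shift)
    have part2: "\<forall>r. \<exists>v1\<in>\<omega>x. \<exists>v2\<in>\<omega>x.
            W_inf r = ereal (W_shift (c r *\<^sub>R v1)) \<and> W_shift (c r *\<^sub>R v1) = c r * norm v1 \<and>
            W_sup r = ereal (W_shift (c r *\<^sub>R v2)) \<and> W_shift (c r *\<^sub>R v2) = c r * norm v2"
      unfolding shift_c using inf_v sup_v by blast
    obtain \<mu> where \<mu>: "\<mu> > 0" "\<And>v. v \<in> \<omega>x \<Longrightarrow> \<mu> \<le> norm v" "\<And>v. v \<in> \<omega>x \<Longrightarrow> norm v \<le> A.sup_osc"
      unfolding \<omega>x using A.omega_norm_bounds by blast
    \<comment> \<open>The vector realising the lower limit depends on \<open>r\<close>, so a bound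
      \<open>\<mu>\<close> uniform over \<open>\<omega>x\<close> is used.\<close>
    have part3: "(W_inf \<longlongrightarrow> \<infinity>) at_bot"
      unfolding tendsto_PInfty
    proof
      fix R :: real
      have "filterlim (\<lambda>r. c r * \<mu>) at_top at_bot"
        unfolding c_def using A.lam_pos w0 \<mu>(1) by real_asymp
      then have "\<forall>\<^sub>F r in at_bot. R < c r * \<mu>" by (simp add: filterlim_at_top_dense)
      then show "\<forall>\<^sub>F r in at_bot. ereal R < W_inf r"
      proof (rule eventually_mono)
        fix r assume R: "R < c r * \<mu>"
        obtain v where v: "v \<in> \<omega>x" "W_inf r = ereal (c r * norm v)" using inf_v by blast
        have "c r * \<mu> \<le> c r * norm v" using c_pos[of r] \<mu>(2)[OF v(1)] by (intro mult_left_mono) auto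
        with R v(2) show "ereal R < W_inf r" by simp
      qed
    qed
    have part4: "(W_sup \<longlongrightarrow> 0) at_top"
    proof (rule tendsto_sandwich)
      have bnds: "0 \<le> W_sup r \<and> W_sup r \<le> ereal (c r * A.sup_osc)" for r
      proof -
        obtain v where v: "v \<in> \<omega>x" "W_sup r = ereal (c r * norm v)" using sup_v by blast
        have "c r * norm v \<le> c r * A.sup_osc" using c_pos[of r] \<mu>(3)[OF v(1)] by (intro mult_left_mono) auto
        with v(2) c_pos[of r] show ?thesis by simp
      qed
      show "\<forall>\<^sub>F r in at_top. 0 \<le> W_sup r" "\<forall>\<^sub>F r in at_top. W_sup r \<le> ereal (c r * A.sup_osc)"
        using bnds by (auto intro: always_eventually)
      have "(c \<longlongrightarrow> 0) at_top" unfolding c_def using A.lam_pos w0 by real_asymp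
      from tendsto_mult[OF this tendsto_const[of A.sup_osc]]
      have "((\<lambda>r. c r * A.sup_osc) \<longlongrightarrow> 0) at_top" by simp
      from tendsto_ereal[OF this] show "((\<lambda>r. ereal (c r * A.sup_osc)) \<longlongrightarrow> 0) at_top"
        by (simp add: zero_ereal_def)
    qed (rule tendsto_const)
    have part5: "\<forall>\<rho>>0. \<forall>v\<in>\<omega>x. W_shift (\<rho> *\<^sub>R v) = \<rho> * norm v"
      by (simp add: shift)
    \<comment> \<open>As \<open>W_shift\<close> is the norm, each side amounts to constancy of the
      norm on \<open>\<omega>x\<close>: uniqueness of limits at \<open>r = 0\<close> gives one
      direction, equality of lower and upper limits the other.\<close>
    have part6: "(\<forall>r. \<forall>v\<in>\<omega>x. (W r \<longlongrightarrow> W_shift (c r *\<^sub>R v)) (at_right 0)) \<longleftrightarrow>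
          (\<forall>\<rho>>0. (\<lambda>v. W_shift (\<rho> *\<^sub>R v)) constant_on \<omega>x)"
    proof
      assume lim: "\<forall>r. \<forall>v\<in>\<omega>x. (W r \<longlongrightarrow> W_shift (c r *\<^sub>R v)) (at_right 0)"
      obtain v0 where v0: "v0 \<in> \<omega>x" using A.omega_nonempty unfolding \<omega>x by blast
      have eq: "norm v = norm v0" if v: "v \<in> \<omega>x" for v
      proof -
        have l: "(W 0 \<longlongrightarrow> W_shift (c 0 *\<^sub>R v)) (at_right 0)" "(W 0 \<longlongrightarrow> W_shift (c 0 *\<^sub>R v0)) (at_right 0)"
          using lim v v0 by auto
        have "W_shift (c 0 *\<^sub>R v) = W_shift (c 0 *\<^sub>R v0)"
          by (rule tendsto_unique[OF _ l]) simp
        then show ?thesis unfolding shift_c using c_pos[of 0] by simp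
      qed
      show "\<forall>\<rho>>0. (\<lambda>v. W_shift (\<rho> *\<^sub>R v)) constant_on \<omega>x"
      proof (intro allI impI)
        fix \<rho> :: real
        show "(\<lambda>v. W_shift (\<rho> *\<^sub>R v)) constant_on \<omega>x"
          unfolding constant_on_def
          by (rule exI[of _ "\<bar>\<rho>\<bar> * norm v0"]) (use eq in \<open>simp add: shift\<close>)
      qed
    next
      assume const: "\<forall>\<rho>>0. (\<lambda>v. W_shift (\<rho> *\<^sub>R v)) constant_on \<omega>x"
      show "\<forall>r. \<forall>v\<in>\<omega>x. (W r \<longlongrightarrow> W_shift (c r *\<^sub>R v)) (at_right 0)"
      proof (intro allI ballI)
        fix r v assume v: "v \<in> \<omega>x"
        obtain v1 where v1: "v1 \<in> \<omega>x" "W_inf r = ereal (c r * norm v1)" using inf_v by blast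
        obtain v2 where v2: "v2 \<in> \<omega>x" "W_sup r = ereal (c r * norm v2)" using sup_v by blast
        have "(\<lambda>v. W_shift (c r *\<^sub>R v)) constant_on \<omega>x" using const c_pos[of r] by blast
        then obtain d where d: "\<And>u. u \<in> \<omega>x \<Longrightarrow> W_shift (c r *\<^sub>R u) = d"
          unfolding constant_on_def by blast
        have "W_inf r = ereal (W_shift (c r *\<^sub>R v))" "W_sup r = ereal (W_shift (c r *\<^sub>R v))"
          using v1 v2 d[OF v] d[OF v1(1)] d[OF v2(1)] by (simp_all add: shift_c)
        then have "((\<lambda>\<epsilon>. ereal (W r \<epsilon>)) \<longlongrightarrow> ereal (W_shift (c r *\<^sub>R v))) (at_right 0)"
          unfolding W_inf_def W_sup_def by (subst tendsto_iff_Liminf_eq_Limsup) simp_all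
        then show "(W r \<longlongrightarrow> W_shift (c r *\<^sub>R v)) (at_right 0)" by simp
      qed
    qed
    from part1 part2 part3 part4 part5 part6 show ?case
      unfolding Let_def c_def W_def W_shift_def W_inf_def W_sup_def by (intro conjI)
  qed
qed

end
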